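(* Let $L(n)=\omega_{n+1}$ and $J(n)=J_{n+2}$ for $n\in\mathbb{Z}$, where $\omega,J\in V_L$ are the vectors defined in the context (so that the weights of these operators are $\mathrm{wt}\,L(n)=\mathrm{wt}\,J(n)=-n$). Then for all $m,n\in\mathbb{Z}$: $$[L(m),L(n)]=(m-n)L(m+n)+\frac{m^3-m}{12}\cdot\frac65\cdot\delta_{m+n,0},$$ $$[L(m),J(n)]=(2m-n)J(m+n),$$ $$\begin{aligned}[J(m),J(n)]&=(m-n)\Big(22(m+n+2)(m+n+3)+35(m+2)(n+2)\Big)L(m+n)\\&\quad-120(m-n)\Big(\sum_{k\le-2}L(k)L(m+n-k)+\sum_{k\ge-1}L(m+n-k)L(k)\Big)\\&\quad-\frac7{10}m(m^2-1)(m^2-4)\delta_{m+n,0}.\end{aligned}$$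
   Context: Let $\alpha_1,\alpha_2$ be the simple roots of type $A_2$, $\alpha_0=-(\alpha_1+\alpha_2)$, so $\langle\alpha_i,\alpha_i\rangle=2$ and $\langle\alpha_i,\alpha_j\rangle=-1$ for $i\ne j$. Put $\beta_i=\sqrt2\,\alpha_i$, $L=\mathbb{Z}\beta_1+\mathbb{Z}\beta_2$, $\mathfrak h=\mathbb{C}\otimes_{\mathbb Z}L$. $V_L=M(1)\otimes\mathbb{C}[L]$ is the lattice vertex operator algebra; since $\langle L,L\rangle\subset2\mathbb{Z}$ the cocycle is trivial and $e^{\alpha}e^{\beta}=e^{\alpha+\beta}$. Write $Y(v,z)=\sum_n v_nz^{-n-1}$, $v_n\in\mathrm{End}(V_L)$. Put $w(\alpha_i)=\frac12\alpha_i(-1)^2-(e^{\beta_i}+e^{-\beta_i})$, $\omega=\frac15(w(\alpha_0)+w(\alpha_1)+w(\alpha_2))$, $J=w(\alpha_1)_0w(\alpha_2)-w(\alpha_2)_0w(\alpha_1)$. ($\omega$ is a conformal vector of central charge $6/5$ and $J$ is a vector of weight $3$.) *)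

theory Defs
  imports
    Complex_Main
    "HOL-Library.Multiset"
    "HOL-Library.Product_Plus"
    "HOL-Library.Poly_Mapping"
begin

section \<open>The lattice \<open>L = \<surd>2 A\<^sub>2\<close> and its complexification\<close>

text \<open>
  An element of \<open>\<hh>\<close> is given by its coordinates in the basis of simple roots
  \<open>\<alpha>\<^sub>1, \<alpha>\<^sub>2\<close>.  An element of \<open>L\<close> is given by its integer coordinates in the basis
  \<open>\<beta>\<^sub>1 = \<surd>2 \<alpha>\<^sub>1, \<beta>\<^sub>2 = \<surd>2 \<alpha>\<^sub>2\<close>.
\<close>

type_synonym cartan = "complex \<times> complex"
type_synonym lat = "int \<times> int"

definition form :: "cartan \<Rightarrow> cartan \<Rightarrow> complex" where
  "form x y = 2 * fst x * fst y - fst x * snd y - snd x * fst y + 2 * snd x * snd y"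

definition lat_form :: "lat \<Rightarrow> lat \<Rightarrow> int" where
  "lat_form x y = 4 * fst x * fst y - 2 * fst x * snd y - 2 * snd x * fst y + 4 * snd x * snd y"

definition root_comb :: "int \<times> int \<Rightarrow> cartan" where
  "root_comb r = (of_int (fst r), of_int (snd r))"

definition lat_emb :: "lat \<Rightarrow> cartan" where
  "lat_emb x = (of_real (sqrt 2) * of_int (fst x), of_real (sqrt 2) * of_int (snd x))"

lemma form_lat_emb: "form (lat_emb x) (lat_emb y) = of_int (lat_form x y)"
proof -
  have s: "complex_of_real (sqrt 2) * (complex_of_real (sqrt 2) * z) = 2 * z" for z
    by (simp flip: mult.assoc of_real_mult)
  have "form (lat_emb x) (lat_emb y) = complex_of_real (sqrt 2) * (complex_of_real (sqrt 2) *
      form (root_comb x) (root_comb y))"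
    by (simp add: form_def lat_emb_def root_comb_def algebra_simps)
  then show ?thesis
    unfolding s by (simp add: form_def lat_form_def root_comb_def algebra_simps)
qed

section \<open>The space \<open>V\<^sub>L = M(1) \<otimes> \<complex>[L]\<close>\<close>

text \<open>
  The basis index \<open>((M\<^sub>1, M\<^sub>2), \<gamma>)\<close> stands for
  \<open>(\<Prod>n\<in>M\<^sub>1. \<alpha>\<^sub>1(-n-1)) (\<Prod>n\<in>M\<^sub>2. \<alpha>\<^sub>2(-n-1)) \<otimes> e\<^sup>\<gamma>\<close>; mind the shift, by which
  \<open>n = 0\<close> is the mode \<open>-1\<close>.  The product of type \<^typ>\<open>'a \<Rightarrow>\<^sub>0 'b\<close> is then that of the
  commutative algebra \<open>S(t\<^sup>-\<^sup>1\<hh>[t\<^sup>-\<^sup>1]) \<otimes> \<complex>[L]\<close>, with \<open>e\<^sup>\<alpha> e\<^sup>\<beta> = e\<^sup>\<alpha>\<^sup>+\<^sup>\<beta>\<close> since the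
  cocycle is trivial, and its unit is the vacuum vector.
\<close>

type_synonym vidx = "(nat multiset \<times> nat multiset) \<times> lat"
type_synonym VL = "vidx \<Rightarrow>\<^sub>0 complex"

definition scl :: "complex \<Rightarrow> VL \<Rightarrow> VL" (infixr \<open>*\<^sub>V\<close> 75) where
  "c *\<^sub>V v = Poly_Mapping.map (\<lambda>x. c * x) v"

definition bvec :: "vidx \<Rightarrow> VL" where
  "bvec b = Poly_Mapping.single b 1"

definition lin_ext :: "(vidx \<Rightarrow> VL) \<Rightarrow> VL \<Rightarrow> VL" where
  "lin_ext f v = (\<Sum>b\<in>Poly_Mapping.keys v. Poly_Mapping.lookup v b *\<^sub>V f b)"

definition evec :: "lat \<Rightarrow> VL" where
  "evec \<gamma> = bvec (({#}, {#}), \<gamma>)"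

definition creat :: "cartan \<Rightarrow> nat \<Rightarrow> VL" where
  "creat h n = fst h *\<^sub>V bvec (({#n#}, {#}), 0) + snd h *\<^sub>V bvec (({#}, {#n#}), 0)"

text \<open>
  The Heisenberg operators \<open>h(k)\<close>: for \<open>k < 0\<close> multiplication by \<open>h(k)\<close>, for \<open>k = 0\<close> the scalar
  \<open>\<langle>h, \<gamma>\<rangle>\<close> on \<open>M(1) \<otimes> e\<^sup>\<gamma>\<close>, for \<open>k > 0\<close> the derivation that kills \<open>\<complex>[L]\<close> and sends
  \<open>h'(-k)\<close> to \<open>k \<langle>h, h'\<rangle>\<close> and \<open>h'(-l)\<close>, \<open>l \<noteq> k\<close>, to \<open>0\<close>.
\<close>

definition heis_basis :: "cartan \<Rightarrow> int \<Rightarrow> vidx \<Rightarrow> VL" where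
  "heis_basis h k = (\<lambda>((M1, M2), \<gamma>).
     if k < 0 then creat h (nat (- k - 1)) * bvec ((M1, M2), \<gamma>)
     else if k = 0 then form h (lat_emb \<gamma>) *\<^sub>V bvec ((M1, M2), \<gamma>)
     else (let n = nat (k - 1) in
       (of_int k * form h (1, 0) * of_nat (count M1 n)) *\<^sub>V bvec ((M1 - {#n#}, M2), \<gamma>) +
       (of_int k * form h (0, 1) * of_nat (count M2 n)) *\<^sub>V bvec ((M1, M2 - {#n#}), \<gamma>)))"

definition heis :: "cartan \<Rightarrow> int \<Rightarrow> VL \<Rightarrow> VL" where
  "heis h k = lin_ext (heis_basis h k)"

section \<open>Vertex operators\<close>

text \<open>
  A field \<open>A(z) = \<Sum>\<^sub>n A\<^sub>n z\<^sup>-\<^sup>n\<^sup>-\<^sup>1\<close> is represented by the function \<open>n \<mapsto> A\<^sub>n\<close>.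
  All sums formed with \<^const>\<open>Sum_any\<close> below have only finitely many nonzero terms.
\<close>

type_synonym vfield = "int \<Rightarrow> VL \<Rightarrow> VL"

text \<open>Coefficients of \<open>x\<^sup>k\<close> in \<open>A(x)\<^sup>j\<close> and in \<open>exp A(x)\<close>, where \<open>A(x) = \<Sum>\<^sub>n A\<^sub>n x\<^sup>n\<close> has operator
  coefficients and \<open>A\<^sub>0 = 0\<close>; the latter condition makes powers \<open>j > k\<close> irrelevant.\<close>

primrec op_pow :: "(nat \<Rightarrow> VL \<Rightarrow> VL) \<Rightarrow> nat \<Rightarrow> nat \<Rightarrow> VL \<Rightarrow> VL" where
  "op_pow A 0 k u = (if k = 0 then u else 0)"
| "op_pow A (Suc j) k u = (\<Sum>i\<le>k. A i (op_pow A j (k - i) u))"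

definition op_exp :: "(nat \<Rightarrow> VL \<Rightarrow> VL) \<Rightarrow> nat \<Rightarrow> VL \<Rightarrow> VL" where
  "op_exp A k u = (\<Sum>j\<le>k. (1 / fact j) *\<^sub>V op_pow A j k u)"

text \<open>\<open>exp (\<Sum>\<^sub>n\<^sub>>\<^sub>0 \<alpha>(-n)/n z\<^sup>n)\<close> and \<open>exp (- \<Sum>\<^sub>n\<^sub>>\<^sub>0 \<alpha>(n)/n z\<^sup>-\<^sup>n)\<close>, as series in \<open>z\<close> and \<open>z\<^sup>-\<^sup>1\<close>.\<close>

definition exp_minus :: "lat \<Rightarrow> nat \<Rightarrow> VL \<Rightarrow> VL" where
  "exp_minus a = op_exp (\<lambda>n u. if n = 0 then 0
     else (1 / of_nat n) *\<^sub>V heis (lat_emb a) (- int n) u)"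

definition exp_plus :: "lat \<Rightarrow> nat \<Rightarrow> VL \<Rightarrow> VL" where
  "exp_plus a = op_exp (\<lambda>n u. if n = 0 then 0
     else (- 1 / of_nat n) *\<^sub>V heis (lat_emb a) (int n) u)"

text \<open>
  \<open>Y(e\<^sup>\<alpha>, z) = exp (\<Sum>\<^sub>n\<^sub>>\<^sub>0 \<alpha>(-n)/n z\<^sup>n) exp (- \<Sum>\<^sub>n\<^sub>>\<^sub>0 \<alpha>(n)/n z\<^sup>-\<^sup>n) e\<^sup>\<alpha> z\<^sup>\<alpha>\<^sup>(\<^sup>0\<^sup>)\<close>.  On \<open>M(1) \<otimes> e\<^sup>\<gamma>\<close> the
  coefficient of \<open>z\<^sup>-\<^sup>n\<^sup>-\<^sup>1\<close> collects the terms \<open>z\<^sup>p z\<^sup>-\<^sup>q\<close> of the two exponentials with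
  \<open>p - q + \<langle>\<alpha>, \<gamma>\<rangle> = -n-1\<close>.
\<close>

definition exp_field :: "lat \<Rightarrow> vfield" where
  "exp_field a n = lin_ext (\<lambda>(M, \<gamma>). Sum_any (\<lambda>q::nat.
     let p = int q - n - 1 - lat_form a \<gamma> in
     if p < 0 then 0
     else exp_minus a (nat p) (exp_plus a q (evec a * bvec (M, \<gamma>)))))"

text \<open>\<open>1/r! (d/dz)\<^sup>r A(z)\<close>; the binomial coefficient is that of
  \<open>1/r! (d/dz)\<^sup>r z\<^sup>-\<^sup>m\<^sup>-\<^sup>1 = (-m-1 choose r) z\<^sup>-\<^sup>m\<^sup>-\<^sup>1\<^sup>-\<^sup>r\<close> with \<open>m = k - r\<close>.\<close>

definition div_deriv :: "nat \<Rightarrow> vfield \<Rightarrow> vfield" where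
  "div_deriv r A k u = (of_int (int r - k - 1) gchoose r) *\<^sub>V A (k - int r) u"

definition normal_prod :: "vfield \<Rightarrow> vfield \<Rightarrow> vfield" where
  "normal_prod A B k u = Sum_any (\<lambda>j::int.
     if j < 0 then A j (B (k - j - 1) u) else B (k - j - 1) (A j u))"

text \<open>
  \<open>Y(h\<^sub>1(-n\<^sub>1-1) \<cdots> h\<^sub>r(-n\<^sub>r-1) e\<^sup>\<alpha>, z)\<close> is the normally ordered product of the
  \<open>1/n\<^sub>i! (d/dz)\<^sup>n\<^sup>i h\<^sub>i(z)\<close> and \<open>Y(e\<^sup>\<alpha>, z)\<close>.  It does not depend on the order of the factors,
  so sorting the multisets is only a way to list them.
\<close>

definition vertex_basis :: "vidx \<Rightarrow> vfield" where
  "vertex_basis = (\<lambda>((M1, M2), a).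
     foldr (\<lambda>(h, r). normal_prod (div_deriv r (heis h)))
       (map (Pair (1, 0)) (sorted_list_of_multiset M1) @
        map (Pair (0, 1)) (sorted_list_of_multiset M2))
       (exp_field a))"

text \<open>\<open>vmode v n\<close> is the operator \<open>v\<^sub>n\<close> in \<open>Y(v, z) = \<Sum>\<^sub>n v\<^sub>n z\<^sup>-\<^sup>n\<^sup>-\<^sup>1\<close>.\<close>

definition vmode :: "VL \<Rightarrow> int \<Rightarrow> VL \<Rightarrow> VL" where
  "vmode v n u = lin_ext (\<lambda>b. vertex_basis b n u) v"

section \<open>The vectors \<open>\<omega>\<close> and \<open>J\<close>\<close>

text \<open>
  \<open>w(\<alpha>) = 1/2 \<alpha>(-1)\<^sup>2 - (e\<^sup>\<beta> + e\<^sup>-\<^sup>\<beta>)\<close> with \<open>\<beta> = \<surd>2 \<alpha>\<close>.  As \<open>\<alpha>\<close> has the same coordinates with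
  respect to \<open>\<alpha>\<^sub>1, \<alpha>\<^sub>2\<close> as \<open>\<beta>\<close> has with respect to \<open>\<beta>\<^sub>1, \<beta>\<^sub>2\<close>, one pair of integers gives both.
\<close>

definition w_vec :: "int \<times> int \<Rightarrow> VL" where
  "w_vec r = (1 / 2) *\<^sub>V heis (root_comb r) (- 1) (heis (root_comb r) (- 1) 1)
     - (evec r + evec (- r))"

definition \<alpha>\<^sub>1 :: "int \<times> int" where "\<alpha>\<^sub>1 = (1, 0)"
definition \<alpha>\<^sub>2 :: "int \<times> int" where "\<alpha>\<^sub>2 = (0, 1)"
definition \<alpha>\<^sub>0 :: "int \<times> int" where "\<alpha>\<^sub>0 = - (\<alpha>\<^sub>1 + \<alpha>\<^sub>2)"

definition omega :: VL where
  "omega = (1 / 5) *\<^sub>V (w_vec \<alpha>\<^sub>0 + w_vec \<alpha>\<^sub>1 + w_vec \<alpha>\<^sub>2)"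

definition J_vec :: VL where
  "J_vec = vmode (w_vec \<alpha>\<^sub>1) 0 (w_vec \<alpha>\<^sub>2) - vmode (w_vec \<alpha>\<^sub>2) 0 (w_vec \<alpha>\<^sub>1)"

definition L_op :: "int \<Rightarrow> VL \<Rightarrow> VL" where
  "L_op n = vmode omega (n + 1)"

definition J_op :: "int \<Rightarrow> VL \<Rightarrow> VL" where
  "J_op n = vmode J_vec (n + 2)"

definition commutator :: "(VL \<Rightarrow> VL) \<Rightarrow> (VL \<Rightarrow> VL) \<Rightarrow> VL \<Rightarrow> VL" where
  "commutator A B u = A (B u) - B (A u)"

end

theory Submission
  imports Defs "HOL-Library.Function_Algebras"
begin

text \<open>
  The fields \<open>h(z)\<close> and \<open>Y(e\<^sup>\<gamma>, z)\<close> are mutually local.  For two exponentials this is seen by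
  commuting \<open>(z - w)\<^sup>N [Y(e\<^sup>\<gamma>, z), Y(e\<^sup>\<delta>, w)]\<close> with the \<open>h(k)\<close>, \<open>k > 0\<close>, which leaves a binomial identity
  for the coefficients along \<open>\<complex>[L]\<close>.  Locality passes to normally ordered products (Dong) and, together with the
  translation operator \<open>T\<close>, determines a field by its value on the vacuum (Goddard).  Hence \<open>Y(v\<^sub>i w, z)\<close> is
  the \<open>i\<close>-th product of \<open>Y(v, z)\<close> and \<open>Y(w, z)\<close>, and since \<open>m \<mapsto> [v\<^sub>m, w\<^sub>s\<^sub>-\<^sub>m]\<close> is polynomial, Newton
  interpolation gives \<open>[v\<^sub>m, w\<^sub>n] = \<Sum>\<^sub>i (m choose i) (v\<^sub>i w)\<^sub>m\<^sub>+\<^sub>n\<^sub>-\<^sub>i\<close>.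

  It remains to compute finitely many products of states.  In the modes of \<open>\<beta>\<^sub>1, \<beta>\<^sub>2\<close> no square roots
  occur, and one finds \<open>\<omega>\<^sub>0 = T\<close>, \<open>\<omega>\<^sub>1 = 2, 3\<close> on \<open>\<omega>, J\<close>, \<open>\<omega>\<^sub>3 \<omega> = 3/5\<close>, \<open>J\<^sub>5 J = -84\<close>, \<open>J\<^sub>4 J = 0\<close>,
  \<open>J\<^sub>3 J = -420 \<omega>\<close>, \<open>J\<^sub>2 J = -210 T \<omega>\<close> and \<open>J\<^sub>1 J = -240 \<omega>\<^sub>-\<^sub>1 \<omega> + 9 T\<^sup>2 \<omega>\<close>; skew symmetry then gives
  \<open>J\<^sub>0 J = -120 T (\<omega>\<^sub>-\<^sub>1 \<omega>) + 22 T\<^sup>3 \<omega>\<close>.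
\<close>

text \<open>The obstacle is that Y is given by explicit normally ordered products: no vertex algebra
  axiom is available in advance, and each infinite sum needs its own proof of finite support. The
  translation operator T and the grading are taken from the standard conformal vector of V_L, of
  central charge 2, and not from omega. They act well on all of V_L, whereas omega_0 = T fails on
  V_L as a whole and is checked on omega and J. The grading makes the computations finite: weights
  are nonnegative, so v_i w = 0 for i >= wt v + wt w. This cuts the commutator formula and the
  normally ordered products down to explicit ranges that can be evaluated term by term. J_0 J would
  be the only product of weight 5; skew symmetry spares its computation because it occurs there on
  both sides. The quadratic sums in the theorem are the modes of omega_{-1} omega. The central terms
  are (m+1 choose 3) * 3/5 and (m+2 choose 5) * (-84).\<close>

abbreviation "keys \<equiv> Poly_Mapping.keys"
abbreviation "lookup \<equiv> Poly_Mapping.lookup"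

section \<open>Linear maps on V_L and its monomial basis\<close>

lemma scl_eq_mult: "c *\<^sub>V v = Poly_Mapping.single 0 c * v"
  unfolding scl_def by (rule mult_map_scale_conv_mult)

interpretation VL: vector_space scl
  by standard (simp_all add: scl_eq_mult distrib_left distrib_right single_add mult_single
      flip: mult.assoc)

lemma scl_mult_left: "(c *\<^sub>V u) * v = c *\<^sub>V (u * v)"
  and scl_mult_right: "u * (c *\<^sub>V v) = c *\<^sub>V (u * v)"
  by (simp_all add: scl_eq_mult mult_ac)

lemma lookup_scl: "lookup (c *\<^sub>V v) b = c * lookup v b"
  unfolding scl_def by (simp add: Poly_Mapping.map.rep_eq when_def)

definition lin :: "(VL \<Rightarrow> VL) \<Rightarrow> bool" where
  "lin f \<longleftrightarrow> (\<forall>u v. f (u + v) = f u + f v) \<and> (\<forall>c u. f (c *\<^sub>V u) = c *\<^sub>V f u)"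

lemma linI: "(\<And>u v. f (u + v) = f u + f v) \<Longrightarrow> (\<And>c u. f (c *\<^sub>V u) = c *\<^sub>V f u) \<Longrightarrow> lin f"
  by (simp add: lin_def)

lemma lin_add: "lin f \<Longrightarrow> f (u + v) = f u + f v"
  and lin_scl: "lin f \<Longrightarrow> f (c *\<^sub>V u) = c *\<^sub>V f u"
  by (simp_all add: lin_def)

lemma lin_0: "lin f \<Longrightarrow> f 0 = 0"
  using lin_scl[of f 0 0] by simp

lemma lin_minus: "lin f \<Longrightarrow> f (- u) = - f u"
  using lin_scl[of f "-1" u] by simp

lemma lin_diff: "lin f \<Longrightarrow> f (u - v) = f u - f v"
  using lin_add[of f u "- v"] by (simp add: lin_minus)

lemma lin_sum: "lin f \<Longrightarrow> f (\<Sum>i\<in>A. g i) = (\<Sum>i\<in>A. f (g i))"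
  by (induction A rule: infinite_finite_induct) (simp_all add: lin_0 lin_add)

lemma lin_Sum_any:
  assumes "lin f" "finite {i. g i \<noteq> 0}"
  shows "f (Sum_any g) = Sum_any (\<lambda>i. f (g i))"
proof -
  have "{i. f (g i) \<noteq> 0} \<subseteq> {i. g i \<noteq> 0}"
    using lin_0[OF assms(1)] by auto
  then have "Sum_any (\<lambda>i. f (g i)) = (\<Sum>i\<in>{i. g i \<noteq> 0}. f (g i))"
    by (rule Sum_any.expand_superset[OF assms(2)])
  then show ?thesis
    by (simp add: Sum_any.expand_set lin_sum[OF assms(1)])
qed

lemma lin_compose: "lin f \<Longrightarrow> lin g \<Longrightarrow> lin (\<lambda>u. f (g u))"
  and lin_plus: "lin f \<Longrightarrow> lin g \<Longrightarrow> lin (\<lambda>u. f u + g u)"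
  and lin_subtract: "lin f \<Longrightarrow> lin g \<Longrightarrow> lin (\<lambda>u. f u - g u)"
  and lin_scale: "lin f \<Longrightarrow> lin (\<lambda>u. c *\<^sub>V f u)"
  and lin_id: "lin (\<lambda>u. u)"
  and lin_zero: "lin (\<lambda>u. 0)"
  and lin_times: "lin ((*) w)"
  by (simp_all add: lin_def VL.scale_right_distrib VL.scale_right_diff_distrib distrib_left
      scl_mult_right mult.commute)

lemma lin_big_sum: "(\<And>i. i \<in> A \<Longrightarrow> lin (f i)) \<Longrightarrow> lin (\<lambda>u. \<Sum>i\<in>A. f i u)"
  by (induction A rule: infinite_finite_induct) (simp_all add: lin_zero lin_plus)

lemma finite_support_pull:
  fixes f :: "VL \<Rightarrow> VL"
  shows "lin f \<Longrightarrow> finite {i. g i \<noteq> 0} \<Longrightarrow> finite {i. f (g i) \<noteq> 0}"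
  by (erule rev_finite_subset) (auto simp: lin_0)

lemma finite_support_add:
  fixes f g :: "'a \<Rightarrow> VL"
  shows "finite {i. f i \<noteq> 0} \<Longrightarrow> finite {i. g i \<noteq> 0} \<Longrightarrow> finite {i. f i + g i \<noteq> 0}"
  by (rule finite_subset[of _ "{i. f i \<noteq> 0} \<union> {i. g i \<noteq> 0}"]) auto

lemma lin_Sum_any_pointwise:
  assumes "\<And>i. lin (f i)" "\<And>u. finite {i. f i u \<noteq> 0}"
  shows "lin (\<lambda>u. Sum_any (\<lambda>i. f i u))"
proof (rule linI)
  show "Sum_any (\<lambda>i. f i (u + v)) = Sum_any (\<lambda>i. f i u) + Sum_any (\<lambda>i. f i v)" for u v
    by (simp add: lin_add[OF assms(1)] Sum_any.distrib[OF assms(2) assms(2)])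
  show "Sum_any (\<lambda>i. f i (c *\<^sub>V u)) = c *\<^sub>V Sum_any (\<lambda>i. f i u)" for c u
    using lin_Sum_any[OF lin_scale[OF lin_id] assms(2)] by (simp add: lin_scl[OF assms(1)])
qed

lemma lookup_bvec: "lookup (bvec b) c = (if b = c then 1 else 0)"
  by (simp add: bvec_def lookup_single when_def)

lemma VL_expand: "v = (\<Sum>b\<in>keys v. lookup v b *\<^sub>V bvec b)"
proof (rule poly_mapping_eqI)
  fix c
  have "lookup (\<Sum>b\<in>keys v. lookup v b *\<^sub>V bvec b) c = (\<Sum>b\<in>keys v. if b = c then lookup v b else 0)"
    by (simp add: lookup_sum lookup_scl lookup_bvec if_distrib cong: if_cong)
  then show "lookup v c = lookup (\<Sum>b\<in>keys v. lookup v b *\<^sub>V bvec b) c"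
    by (simp add: in_keys_iff)
qed

lemma lin_ext_superset:
  assumes "finite S" "keys v \<subseteq> S"
  shows "lin_ext f v = (\<Sum>b\<in>S. lookup v b *\<^sub>V f b)"
  unfolding lin_ext_def using assms
  by (intro sum.mono_neutral_left) (auto simp: in_keys_iff)

lemma lin_lin_ext: "lin (lin_ext f)"
proof (rule linI)
  fix u v :: VL
  let ?S = "keys u \<union> keys v"
  have "keys (u + v) \<subseteq> ?S" by (rule keys_add)
  then show "lin_ext f (u + v) = lin_ext f u + lin_ext f v"
    by (simp add: lin_ext_superset[of ?S] lookup_add VL.scale_left_distrib sum.distrib)
next
  fix c and u :: VL
  have "keys (c *\<^sub>V u) \<subseteq> keys u" by (auto simp: in_keys_iff lookup_scl)
  then show "lin_ext f (c *\<^sub>V u) = c *\<^sub>V lin_ext f u"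
    by (simp add: lin_ext_superset[of "keys u"] lookup_scl VL.scale_sum_right)
qed

lemma lin_ext_bvec [simp]: "lin_ext f (bvec b) = f b"
  by (simp add: lin_ext_def bvec_def)

lemma VL_basis_induct [case_names bvec add scl]:
  assumes "\<And>b. P (bvec b)" "\<And>u v. P u \<Longrightarrow> P v \<Longrightarrow> P (u + v)" "\<And>c u. P u \<Longrightarrow> P (c *\<^sub>V u)"
  shows "P v"
proof -
  have "P 0" using assms(3)[OF assms(1), of 0] by simp
  then have "P (\<Sum>b\<in>S. c b *\<^sub>V bvec b)" for S :: "vidx set" and c
    by (induction S rule: infinite_finite_induct) (simp_all add: assms)
  then have "P (\<Sum>b\<in>keys v. lookup v b *\<^sub>V bvec b)" .
  then show ?thesis by (simp only: VL_expand[symmetric])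
qed

lemma lin_eqI: "lin f \<Longrightarrow> lin g \<Longrightarrow> (\<And>b. f (bvec b) = g (bvec b)) \<Longrightarrow> f u = g u"
  by (induction u rule: VL_basis_induct) (simp_all add: lin_add lin_scl)

lemma bvec_mult: "bvec b * bvec c = bvec (b + c)"
  by (simp add: bvec_def mult_single)

lemma evec_mult: "evec a * evec b = evec (a + b)"
  by (simp add: evec_def bvec_mult)

lemma evec_0: "evec 0 = 1"
  by (simp add: evec_def bvec_def zero_prod_def zero_multiset_def single_one[symmetric] del: single_one)

section \<open>Heisenberg operators\<close>

lemma lin_heis: "lin (heis h k)"
  by (simp add: heis_def lin_lin_ext)

lemmas heis_lin = lin_add[OF lin_heis] lin_scl[OF lin_heis]

lemma heis_neg: "k < 0 \<Longrightarrow> heis h k u = creat h (nat (- k - 1)) * u"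
  by (rule lin_eqI[OF lin_heis lin_times]) (auto simp: heis_def heis_basis_def)

text \<open>The monomials in creation operators applied to the e^gamma span V_L, so an operator
  identity need only be checked on \<open>evec\<close> and carried past one creation
  operator.\<close>

lemma VL_induct [case_names evec creat add scl]:
  assumes e: "\<And>\<gamma>. P (evec \<gamma>)" and c: "\<And>h n u. P u \<Longrightarrow> P (creat h n * u)"
    and "\<And>u v. P u \<Longrightarrow> P v \<Longrightarrow> P (u + v)" "\<And>c u. P u \<Longrightarrow> P (c *\<^sub>V u)"
  shows "P v"
proof (induction v rule: VL_basis_induct)
  case (bvec b)
  obtain M1 M2 \<gamma> where b: "b = ((M1, M2), \<gamma>)" by (metis surj_pair)
  have "P (bvec ((M1, {#}), \<gamma>))"
  proof (induction M1)
    case empty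
    then show ?case using e by (simp add: evec_def)
  next
    case (add n M1)
    then have "P (creat (1, 0) n * bvec ((M1, {#}), \<gamma>))" by (rule c)
    then show ?case by (simp add: creat_def bvec_mult)
  qed
  then have "P (bvec ((M1, M2), \<gamma>))"
  proof (induction M2)
    case (add n M2)
    then have "P (creat (0, 1) n * bvec ((M1, M2), \<gamma>))" by (intro c)
    then show ?case by (simp add: creat_def bvec_mult)
  qed
  then show ?case by (simp add: b)
qed (use assms in auto)

lemma heis_pos_evec: "k > 0 \<Longrightarrow> heis h k (evec \<gamma>) = 0"
  and heis_0_evec: "heis h 0 (evec \<gamma>) = form h (lat_emb \<gamma>) *\<^sub>V evec \<gamma>"
  by (simp_all add: heis_def heis_basis_def evec_def)

lemma heis_0_mult_creat: "heis h 0 (creat h' n * u) = creat h' n * heis h 0 u"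
proof (rule lin_eqI[of "\<lambda>u. heis h 0 (creat h' n * u)"])
  show "lin (\<lambda>u. heis h 0 (creat h' n * u))"
    by (intro lin_compose[OF lin_heis lin_times])
  show "lin (\<lambda>u. creat h' n * heis h 0 u)"
    by (intro lin_compose[OF lin_times lin_heis])
  show "heis h 0 (creat h' n * bvec b) = creat h' n * heis h 0 (bvec b)" for b
    by (cases b, cases "fst b")
       (simp add: creat_def distrib_right scl_mult_left scl_mult_right bvec_mult lin_add[OF lin_heis]
        lin_scl[OF lin_heis],
        simp add: heis_def heis_basis_def scl_mult_left scl_mult_right bvec_mult
          VL.scale_right_distrib distrib_right mult.commute)
qed

lemma form_sym: "form x y = form y x"
  by (simp add: form_def algebra_simps)

lemma form_coord: "form h h' = fst h' * form h (1, 0) + snd h' * form h (0, 1)"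
  by (simp add: form_def algebra_simps)

lemma heis_pos_mult_creat:
  assumes "k > 0"
  shows "heis h k (creat h' n * u) = creat h' n * heis h k u
    + (if k = int n + 1 then of_int k * form h h' else 0) *\<^sub>V u"
proof (rule lin_eqI[of "\<lambda>u. heis h k (creat h' n * u)"])
  show "lin (\<lambda>u. heis h k (creat h' n * u))"
    by (intro lin_compose[OF lin_heis lin_times])
  show "lin (\<lambda>u. creat h' n * heis h k u
      + (if k = int n + 1 then of_int k * form h h' else 0) *\<^sub>V u)"
    by (intro lin_plus lin_compose[OF lin_times lin_heis] lin_scale lin_id)
  fix b :: vidx
  obtain M1 M2 \<gamma> where b: "b = ((M1, M2), \<gamma>)" by (metis surj_pair)
  define l where "l = nat (k - 1)"
  then have l: "nat (k - 1) = l" "k = int l + 1"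
    using assms by auto
  \<comment> \<open>Multiset difference is truncated: if \<open>n\<close> is not in
    \<open>M\<close>, removing and re-adding it does not give \<open>M\<close> back, but then the
    scalar \<open>count M n\<close> is 0.\<close>
  have rm: "(c * of_nat (count M n)) *\<^sub>V f (add_mset n (M - {#n#})) = (c * of_nat (count M n)) *\<^sub>V f M"
    for M c and f :: "nat multiset \<Rightarrow> VL"
  proof (cases "n \<in># M")
    case True
    then show ?thesis by simp
  next
    case False
    then have "count M n = 0" by (simp add: not_in_iff)
    show ?thesis unfolding \<open>count M n = 0\<close> by simp
  qed
  have H: "heis h k (bvec ((N1, N2), \<gamma>)) =
      (of_int k * form h (1, 0) * of_nat (count N1 l)) *\<^sub>V bvec ((N1 - {#l#}, N2), \<gamma>) +
      (of_int k * form h (0, 1) * of_nat (count N2 l)) *\<^sub>V bvec ((N1, N2 - {#l#}), \<gamma>)" for N1 N2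
    using assms l(1) by (simp add: heis_def heis_basis_def Let_def)
  have H1: "heis h k (bvec ((add_mset n M1, M2), \<gamma>)) = bvec (({#n#}, {#}), 0) * heis h k (bvec b)
     + (if l = n then of_int k * form h (1, 0) else 0) *\<^sub>V bvec b"
    using rm[of "of_int k * form h (1, 0)" M1 "\<lambda>M. bvec ((M, M2), \<gamma>)"]
    unfolding b H distrib_left scl_mult_right bvec_mult
    by (cases "l = n") (simp_all add: distrib_left VL.scale_left_distrib add_ac del: VL.scale_cancel_left)
  have H2: "heis h k (bvec ((M1, add_mset n M2), \<gamma>)) = bvec (({#}, {#n#}), 0) * heis h k (bvec b)
     + (if l = n then of_int k * form h (0, 1) else 0) *\<^sub>V bvec b"
    using rm[of "of_int k * form h (0, 1)" M2 "\<lambda>M. bvec ((M1, M), \<gamma>)"]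
    unfolding b H distrib_left scl_mult_right bvec_mult
    by (cases "l = n") (simp_all add: distrib_left VL.scale_left_distrib add_ac del: VL.scale_cancel_left)
  have "heis h k (creat h' n * bvec b) =
      fst h' *\<^sub>V heis h k (bvec ((add_mset n M1, M2), \<gamma>)) + snd h' *\<^sub>V heis h k (bvec ((M1, add_mset n M2), \<gamma>))"
    by (simp add: creat_def b distrib_right scl_mult_left bvec_mult heis_lin)
  also have "\<dots> = creat h' n * heis h k (bvec b)
    + (if k = int n + 1 then of_int k * form h h' else 0) *\<^sub>V bvec b"
    unfolding H1 H2 using l(2) form_coord[of h h']
    by (auto simp add: creat_def VL.scale_right_distrib distrib_right scl_mult_left scl_mult_right algebra_simps
        simp flip: VL.scale_left_distrib)
  finally show "heis h k (creat h' n * bvec b) = creat h' n * heis h k (bvec b)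
    + (if k = int n + 1 then of_int k * form h h' else 0) *\<^sub>V bvec b" .
qed

text \<open>The Heisenberg relation. Negative modes are multiplications in a commutative algebra,
  nonnegative ones commute by induction over the generators, and only a derivation against a
  multiplication leaves a central term.\<close>

lemma heis_commute:
  "heis h k (heis h' l u) = heis h' l (heis h k u)
    + (if k + l = 0 then of_int k * form h h' else 0) *\<^sub>V u"
proof -
  have nn: "heis h k (heis h' l u) = heis h' l (heis h k u)" if "k \<ge> 0" "l \<ge> 0" for k l h h'
  proof (induction u rule: VL_induct)
    case (evec \<gamma>)
    have "heis h k (evec \<gamma>) = (if k = 0 then form h (lat_emb \<gamma>) else 0) *\<^sub>V evec \<gamma>"
      if "k \<ge> 0" for k h
      using that by (auto simp: heis_0_evec heis_pos_evec)
    then show ?case using that by (simp add: lin_scl[OF lin_heis] mult.commute)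
  next
    case (creat h n u)
    have "heis h' k (creat h n * u) = creat h n * heis h' k u
      + (if k = int n + 1 then of_int k * form h' h else 0) *\<^sub>V u" if "k \<ge> 0" for k h' u
      using that by (cases "k = 0") (simp_all add: heis_0_mult_creat heis_pos_mult_creat)
    then show ?case using that
      by (simp add: heis_lin creat)
  qed (simp_all add: heis_lin)
  have np: "heis h k (heis h' l u) = heis h' l (heis h k u)
    + (if k + l = 0 then of_int k * form h h' else 0) *\<^sub>V u" if "k \<ge> 0" "l < 0" for k l h h'
    using that by (cases "k = 0") (auto simp: heis_neg heis_0_mult_creat heis_pos_mult_creat)
  consider "k \<ge> 0" "l \<ge> 0" | "k \<ge> 0" "l < 0" | "k < 0" "l \<ge> 0" | "k < 0" "l < 0" by linarith
  then show ?thesis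
  proof cases
    case 1 then show ?thesis using nn[of k l] by auto
  next
    case 2 then show ?thesis using np by blast
  next
    case 3 then show ?thesis using np[of l k h' h]
      by (auto simp: add.commute form_sym[of h] VL.scale_left_distrib[symmetric] add_eq_0_iff)
  next
    case 4 then show ?thesis by (simp add: heis_neg mult.left_commute)
  qed
qed

text \<open>A vector involves finitely many creation modes, so one bound serves all \<open>h\<close>
  at once.\<close>

lemma heis_eventually_0: "\<exists>K. \<forall>k\<ge>K. \<forall>h. heis h k u = 0"
proof (induction u rule: VL_induct)
  case (evec \<gamma>)
  then show ?case using heis_pos_evec by (intro exI[of _ 1]) auto
next
  case (creat h n u)
  then obtain K where K: "\<And>k h. k \<ge> K \<Longrightarrow> heis h k u = 0" by blast
  show ?case
    by (rule exI[of _ "max K (int n + 2)"]) (auto simp: heis_pos_mult_creat K)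
next
  case (add u v)
  then obtain K K' where "\<And>k h. k \<ge> K \<Longrightarrow> heis h k u = 0" "\<And>k h. k \<ge> K' \<Longrightarrow> heis h k v = 0" by blast
  then show ?case by (intro exI[of _ "max K K'"]) (auto simp: lin_add[OF lin_heis])
next
  case (scl c u)
  then show ?case by (metis lin_scl[OF lin_heis] VL.scale_zero_right)
qed

section \<open>Local fields\<close>

lemma Sum_any_shift:
  fixes g :: "int \<Rightarrow> 'a::comm_monoid_add"
  shows "Sum_any (\<lambda>j. g (j + c)) = Sum_any g"
proof -
  have "bij (\<lambda>j::int. j + c)" by (rule bijI) (auto intro: injI surjI[of _ "\<lambda>j. j - c"])
  then show ?thesis using Sum_any.reindex_cong[of "\<lambda>j. j + c" g "\<lambda>j. g (j + c)"] by (simp add: comp_def)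
qed

text \<open>A field in the sense of vertex algebras: A(z)u is a Laurent series in z, with finitely
  many negative powers, for each u.\<close>

definition field_like :: "vfield \<Rightarrow> bool" where
  "field_like A \<longleftrightarrow> (\<forall>k. lin (A k)) \<and> (\<forall>u. \<exists>K. \<forall>k\<ge>K. A k u = 0)"

lemma field_like_lin: "field_like A \<Longrightarrow> lin (A k)"
  by (simp add: field_like_def)

lemma field_like_bound:
  assumes "field_like A" obtains K where "\<And>k. k \<ge> K \<Longrightarrow> A k u = 0"
  using assms unfolding field_like_def by meson

text \<open>Multiplication of a formal distribution \<open>F(z, w)\<close> by \<open>z - w\<close>.\<close>

definition dd :: "(int \<Rightarrow> int \<Rightarrow> VL) \<Rightarrow> int \<Rightarrow> int \<Rightarrow> VL" where
  "dd F a b = F (a + 1) b - F a (b + 1)"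

definition bracket :: "vfield \<Rightarrow> vfield \<Rightarrow> VL \<Rightarrow> int \<Rightarrow> int \<Rightarrow> VL" where
  "bracket A B u a b = commutator (A a) (B b) u"

text \<open>This is (z - w)^N [A(z), B(w)] = 0, read off on coefficients.\<close>

definition local_to :: "vfield \<Rightarrow> vfield \<Rightarrow> bool" where
  "local_to A B \<longleftrightarrow> (\<exists>N. \<forall>u. (dd ^^ N) (bracket A B u) = 0)"

lemma dd_diff: "dd (F - G) = dd F - dd G"
  and dd_add: "dd (F + G) = dd F + dd G"
  and dd_0: "dd 0 = 0"
  by (auto simp: dd_def fun_eq_iff)

lemma dd_pow_diff: "(dd ^^ n) (F - G) = (dd ^^ n) F - (dd ^^ n) G"
  and dd_pow_add: "(dd ^^ n) (F + G) = (dd ^^ n) F + (dd ^^ n) G"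
  and dd_pow_0: "(dd ^^ n) 0 = 0"
  by (induction n) (simp_all add: dd_diff dd_add dd_0)

lemma dd_pow_Suc: "(dd ^^ Suc n) F a b = (dd ^^ n) F (a + 1) b - (dd ^^ n) F a (b + 1)"
  by (simp add: dd_def)

lemma dd_pow_lin: "lin f \<Longrightarrow> (dd ^^ n) (\<lambda>a b. f (F a b)) = (\<lambda>a b. f ((dd ^^ n) F a b))"
  by (induction n) (simp_all add: dd_def fun_eq_iff lin_diff)

lemma dd_pow_mono: "(dd ^^ n) F = 0 \<Longrightarrow> n \<le> m \<Longrightarrow> (dd ^^ m) F = 0"
  using dd_pow_0[of "m - n"] funpow_add[of "m - n" n dd] by simp

lemma local_to_add:
  assumes "local_to A C" "local_to B C" "field_like C"
  shows "local_to (\<lambda>k u. A k u + B k u) C"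
proof -
  obtain M N where "\<And>u. (dd ^^ M) (bracket A C u) = 0" "\<And>u. (dd ^^ N) (bracket B C u) = 0"
    using assms by (auto simp: local_to_def)
  then have "(dd ^^ max M N) (bracket A C u) = 0" "(dd ^^ max M N) (bracket B C u) = 0" for u
    by (meson dd_pow_mono max.cobounded1 max.cobounded2)+
  moreover have "bracket (\<lambda>k u. A k u + B k u) C u = bracket A C u + bracket B C u" for u
    using assms(3) by (simp add: bracket_def commutator_def fun_eq_iff field_like_lin lin_add)
  ultimately have "(dd ^^ max M N) (bracket (\<lambda>k u. A k u + B k u) C u) = 0" for u
    by (simp add: dd_pow_add)
  then show ?thesis unfolding local_to_def by blast
qed

lemma local_to_scl:
  assumes "local_to A C" "field_like C"
  shows "local_to (\<lambda>k u. c *\<^sub>V A k u) C"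
proof -
  have E: "bracket (\<lambda>k u. c *\<^sub>V A k u) C u = (\<lambda>a b. c *\<^sub>V bracket A C u a b)" for u
    using assms(2) by (simp add: bracket_def commutator_def fun_eq_iff field_like_lin lin_scl
        VL.scale_right_diff_distrib)
  obtain N where N: "\<And>u. (dd ^^ N) (bracket A C u) = 0"
    using assms(1) by (auto simp: local_to_def)
  have "(dd ^^ N) (bracket (\<lambda>k u. c *\<^sub>V A k u) C u) = 0" for u
    unfolding E dd_pow_lin[OF lin_scale[OF lin_id]] by (simp add: N fun_eq_iff)
  then show ?thesis unfolding local_to_def by blast
qed

text \<open>The constant is (-1)^n, since exchanging z and w changes the sign of z - w.\<close>

lemma dd_pow_swap: "\<exists>c. (dd ^^ n) (\<lambda>a b. F b a) = (\<lambda>a b. c *\<^sub>V (dd ^^ n) F b a)"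
proof (induction n)
  case 0
  show ?case by (rule exI[of _ 1]) simp
next
  case (Suc n)
  then obtain c where "(dd ^^ n) (\<lambda>a b. F b a) = (\<lambda>a b. c *\<^sub>V (dd ^^ n) F b a)" by blast
  then have "(dd ^^ Suc n) (\<lambda>a b. F b a) = (\<lambda>a b. (- c) *\<^sub>V (dd ^^ Suc n) F b a)"
    by (simp add: dd_def fun_eq_iff VL.scale_right_diff_distrib)
  then show ?case by blast
qed

lemma local_to_sym: "local_to A B \<Longrightarrow> local_to B A"
proof -
  assume "local_to A B"
  then obtain N where N: "\<And>u. (dd ^^ N) (bracket A B u) = 0" by (auto simp: local_to_def)
  have "bracket B A u = (\<lambda>a b. (-1) *\<^sub>V bracket A B u b a)" for u
    by (simp add: bracket_def commutator_def fun_eq_iff)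
  then have "(dd ^^ N) (bracket B A u) = (\<lambda>a b. (-1) *\<^sub>V (dd ^^ N) (\<lambda>a b. bracket A B u b a) a b)" for u
    using dd_pow_lin[OF lin_scale[OF lin_id], of N "-1" "\<lambda>a b. bracket A B u b a"] by simp
  moreover have "(dd ^^ N) (\<lambda>a b. bracket A B u b a) = 0" for u
    using dd_pow_swap[of N "bracket A B u"] by (auto simp: N fun_eq_iff)
  ultimately have "(dd ^^ N) (bracket B A u) = 0" for u
    by (simp add: fun_eq_iff)
  then show ?thesis unfolding local_to_def by blast
qed

lemma field_like_add:
  assumes "field_like A" "field_like B"
  shows "field_like (\<lambda>k u. A k u + B k u)"
  unfolding field_like_def
proof (intro conjI allI)
  show "lin (\<lambda>u. A k u + B k u)" for k
    by (intro lin_plus field_like_lin assms)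
  show "\<exists>K. \<forall>k\<ge>K. A k u + B k u = 0" for u
  proof -
    obtain K L where "\<And>k. k \<ge> K \<Longrightarrow> A k u = 0" "\<And>k. k \<ge> L \<Longrightarrow> B k u = 0"
      using assms field_like_bound by metis
    then show ?thesis by (intro exI[of _ "max K L"]) auto
  qed
qed

lemma field_like_scl: "field_like A \<Longrightarrow> field_like (\<lambda>k u. c *\<^sub>V A k u)"
  unfolding field_like_def by (auto intro: lin_scale) (metis VL.scale_zero_right)

section \<open>Products of fields\<close>

text \<open>\<open>nprod i A B\<close> is the field \<open>A(w)\<^sub>(\<^sub>i\<^sub>)B(w) = Res\<^sub>z (z - w)\<^sup>i [A(z), B(w)]\<close>.\<close>

definition nprod :: "nat \<Rightarrow> vfield \<Rightarrow> vfield \<Rightarrow> vfield" where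
  "nprod i A B k u = (dd ^^ i) (bracket A B u) 0 k"

text \<open>Along a line a + b = s the operator \<open>dd\<close> is the forward difference in a, up
  to lowering s by one. So the hypothesis makes the values on the line a polynomial in a of degree
  below N, expanded here in Newton form at a = 0.\<close>

lemma dd_newton:
  assumes "(dd ^^ N) F = 0"
  shows "F a (s - a) = (\<Sum>i<N. (of_int a gchoose i) *\<^sub>V (dd ^^ i) F 0 (s - int i))"
  using assms
proof (induction N arbitrary: F s a)
  case (Suc N)
  \<comment> \<open>\<open>g\<close> is the error of the expansion. By Pascal's rule its difference
    is the error for \<open>dd F\<close>, which is zero by induction, so \<open>g\<close> is
    constant and equal to \<open>g 0 = 0\<close>.\<close>
  define g where "g a = F a (s - a) - (\<Sum>i<Suc N. (of_int a gchoose i) *\<^sub>V (dd ^^ i) F 0 (s - int i))" for a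
  have gb: "1 + x gchoose Suc i = (x gchoose i) + (x gchoose Suc i)" for x :: complex and i
    using gbinomial_Suc_Suc[of x i] by (simp add: add.commute)
  have step: "g (a + 1) = g a" for a
  proof -
    have "g (a + 1) - g a = dd F a (s - 1 - a) -
      (\<Sum>i<Suc N. ((of_int (a + 1) gchoose i) - (of_int a gchoose i)) *\<^sub>V (dd ^^ i) F 0 (s - int i))"
      by (simp add: g_def dd_def VL.scale_left_diff_distrib sum_subtractf algebra_simps del: sum.lessThan_Suc)
    also have "(\<Sum>i<Suc N. ((of_int (a + 1) gchoose i) - (of_int a gchoose i)) *\<^sub>V (dd ^^ i) F 0 (s - int i))
      = (\<Sum>i<N. (of_int a gchoose i) *\<^sub>V (dd ^^ i) (dd F) 0 (s - 1 - int i))"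
      by (subst sum.lessThan_Suc_shift)
         (simp add: gb VL.scale_left_distrib funpow_Suc_right algebra_simps del: funpow.simps)
    also have "\<dots> = dd F a (s - 1 - a)"
      using Suc by (simp add: funpow_Suc_right del: funpow.simps)
    finally show ?thesis by simp
  qed
  have "g a = g 0"
  proof (induction a rule: int_induct[where k = 0])
    case (step2 i)
    then show ?case using step[of "i - 1"] by simp
  qed (simp_all add: step)
  moreover have "g 0 = 0" unfolding g_def by (subst sum.lessThan_Suc_shift) simp
  ultimately show ?case by (simp add: g_def)
qed simp

lemma dd_pow_eventually:
  assumes "\<And>a. \<exists>K. \<forall>b\<ge>K. F a b = 0"
  shows "\<exists>K. \<forall>b\<ge>K. (dd ^^ n) F a b = 0"
proof (induction n arbitrary: a)
  case (Suc n)
  obtain K L where "\<And>b. b \<ge> K \<Longrightarrow> (dd ^^ n) F (a + 1) b = 0" "\<And>b. b \<ge> L \<Longrightarrow> (dd ^^ n) F a b = 0"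
    using Suc by metis
  then show ?case by (intro exI[of _ "max K L"]) (auto simp: dd_pow_Suc simp del: funpow.simps)
qed (use assms in simp)

lemma lin_commutator: "lin f \<Longrightarrow> lin g \<Longrightarrow> lin (commutator f g)"
  unfolding commutator_def
  using lin_subtract[OF lin_compose[of f g] lin_compose[of g f]] by simp

lemma field_like_nprod:
  assumes "field_like A" "field_like B"
  shows "field_like (nprod i A B)"
  unfolding field_like_def
proof (intro conjI allI)
  have L: "lin (\<lambda>u. (dd ^^ i) (bracket A B u) a b)" for a b
  proof (induction i arbitrary: a b)
    case 0
    then show ?case
      using assms lin_commutator[of "A a" "B b"] by (simp add: bracket_def field_like_lin)
  next
    case (Suc i)
    show ?case unfolding dd_pow_Suc by (intro lin_subtract Suc)
  qed
  show "lin (nprod i A B k)" for k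
    using L[of 0 k] unfolding nprod_def .
  show "\<exists>K. \<forall>k\<ge>K. nprod i A B k u = 0" for u
    unfolding nprod_def
  proof (rule dd_pow_eventually)
    fix a
    obtain K L where "\<And>k. k \<ge> K \<Longrightarrow> B k u = 0" "\<And>k. k \<ge> L \<Longrightarrow> B k (A a u) = 0"
      using field_like_bound[OF assms(2)] by metis
    then show "\<exists>K. \<forall>b\<ge>K. bracket A B u a b = 0"
      using lin_0[OF field_like_lin[OF assms(1)]]
      by (intro exI[of _ "max K L"]) (auto simp: bracket_def commutator_def)
  qed
qed

lemma normal_prod_finite:
  assumes "field_like A" "field_like B"
  shows "finite {j. (if j < 0 then A j (B (k - j - 1) u) else B (k - j - 1) (A j u)) \<noteq> 0}"
proof -
  obtain K L where K: "\<And>k. k \<ge> K \<Longrightarrow> A k u = 0" and L: "\<And>k. k \<ge> L \<Longrightarrow> B k u = 0"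
    using assms field_like_bound by metis
  have "j \<in> {k - 1 - L..0} \<union> {0..K}"
    if "(if j < 0 then A j (B (k - j - 1) u) else B (k - j - 1) (A j u)) \<noteq> 0" for j
    using that K[of j] L[of "k - j - 1"] lin_0[OF field_like_lin[OF assms(1)]]
      lin_0[OF field_like_lin[OF assms(2)]] by (cases "j < 0"; force)
  then have "{j. (if j < 0 then A j (B (k - j - 1) u) else B (k - j - 1) (A j u)) \<noteq> 0} \<subseteq> {k - 1 - L..0} \<union> {0..K}"
    by blast
  then show ?thesis by (rule finite_subset) simp
qed

lemma field_like_normal_prod:
  assumes A: "field_like A" and B: "field_like B"
  shows "field_like (normal_prod A B)"
  unfolding field_like_def
proof (intro conjI allI)
  show "lin (normal_prod A B k)" for k
    unfolding normal_prod_def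
  proof (rule lin_Sum_any_pointwise[OF _ normal_prod_finite[OF A B]])
    show "lin (\<lambda>u. if j < 0 then A j (B (k - j - 1) u) else B (k - j - 1) (A j u))" for j
      using lin_compose[OF field_like_lin[OF A] field_like_lin[OF B]]
        lin_compose[OF field_like_lin[OF B] field_like_lin[OF A]] by (cases "j < 0") simp_all
  qed
  show "\<exists>K. \<forall>k\<ge>K. normal_prod A B k u = 0" for u
  proof -
    obtain K L where K: "\<And>k. k \<ge> K \<Longrightarrow> A k u = 0" and L: "\<And>k. k \<ge> L \<Longrightarrow> B k u = 0"
      using assms field_like_bound by metis
    have "\<forall>j. \<exists>K. \<forall>k\<ge>K. B k (A j u) = 0"
      using B unfolding field_like_def by blast
    then obtain M where M: "\<And>j k. k \<ge> M j \<Longrightarrow> B k (A j u) = 0" by metis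
    \<comment> \<open>The bound \<open>M j\<close> for B on \<open>A j u\<close> depends on j, but
      \<open>A j u\<close> vanishes beyond K, so finitely many j matter; L takes care of the terms
      with j < 0.\<close>
    define N where "N = Max ((\<lambda>j. M j + j + 1) ` {0..K} \<union> {L})"
    have N: "M j + j + 1 \<le> N" if "0 \<le> j" "j \<le> K" for j
      unfolding N_def using that by (intro Max_ge) auto
    have N': "L \<le> N" unfolding N_def by (intro Max_ge) auto
    have Z: "(if j < 0 then A j (B (k - j - 1) u) else B (k - j - 1) (A j u)) = 0" if "k \<ge> N" for k j
    proof (cases "j < 0")
      case True
      then show ?thesis using that N' L lin_0[OF field_like_lin[OF A]] by simp
    next
      case False
      show ?thesis
      proof (cases "j \<le> K")
        case True
        then show ?thesis using False that N[of j] by (simp add: M)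
      next
        case f: False
        then show ?thesis using False K lin_0[OF field_like_lin[OF B]] by simp
      qed
    qed
    have "normal_prod A B k u = 0" if "k \<ge> N" for k
      unfolding normal_prod_def by (simp only: Z[OF that] Sum_any.neutral)
    then show ?thesis by blast
  qed
qed

section \<open>Dong's lemma\<close>

type_synonym dist3 = "int \<Rightarrow> int \<Rightarrow> int \<Rightarrow> VL"

text \<open>Multiplication of a formal distribution in \<open>x, y, z\<close> by \<open>x - y\<close>, \<open>y - z\<close> and \<open>x - z\<close>.\<close>

definition xy :: "dist3 \<Rightarrow> dist3" where "xy F a b c = F (a + 1) b c - F a (b + 1) c"
definition yz :: "dist3 \<Rightarrow> dist3" where "yz F a b c = F a (b + 1) c - F a b (c + 1)"
definition xz :: "dist3 \<Rightarrow> dist3" where "xz F a b c = F (a + 1) b c - F a b (c + 1)"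

lemma yz_eq: "yz F = xz F - xy F"
  by (auto simp: xy_def yz_def xz_def fun_eq_iff)

definition vanishing_x :: "dist3 \<Rightarrow> bool" where
  "vanishing_x F \<longleftrightarrow> (\<forall>c. \<exists>t. \<forall>a\<ge>t. \<forall>b. F a b c = 0)"
definition vanishing_y :: "dist3 \<Rightarrow> bool" where
  "vanishing_y F \<longleftrightarrow> (\<forall>c. \<exists>t. \<forall>b\<ge>t. \<forall>a. F a b c = 0)"

text \<open>Stands for multiplication by a polynomial in the differences x - y, y - z, x - z: it
  collects those properties of such multiplications on which Dong's argument rests.\<close>

definition shift_op :: "(dist3 \<Rightarrow> dist3) \<Rightarrow> bool" where
  "shift_op R \<longleftrightarrow> (\<forall>F G. R (F - G) = R F - R G) \<and> (\<forall>F. R (xy F) = xy (R F)) \<and>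
     (\<forall>F. R (yz F) = yz (R F)) \<and> (\<forall>F. R (xz F) = xz (R F)) \<and>
     (\<forall>F. vanishing_x F \<longrightarrow> vanishing_x (R F)) \<and> (\<forall>F. vanishing_y F \<longrightarrow> vanishing_y (R F))"

lemma shift_op_diff_arg: "shift_op R \<Longrightarrow> R (F - G) = R F - R G"
  and shift_op_xy: "shift_op R \<Longrightarrow> R (xy F) = xy (R F)"
  and shift_op_yz: "shift_op R \<Longrightarrow> R (yz F) = yz (R F)"
  and shift_op_xz: "shift_op R \<Longrightarrow> R (xz F) = xz (R F)"
  and shift_op_vx: "shift_op R \<Longrightarrow> vanishing_x F \<Longrightarrow> vanishing_x (R F)"
  and shift_op_vy: "shift_op R \<Longrightarrow> vanishing_y F \<Longrightarrow> vanishing_y (R F)"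
  by (simp_all add: shift_op_def)

lemma shift_op_0: "shift_op R \<Longrightarrow> R 0 = 0"
  using shift_op_diff_arg[of R 0 0] by simp

lemma shift_op_pow:
  assumes "shift_op R"
  shows "R ((xy ^^ n) F) = (xy ^^ n) (R F)" "R ((yz ^^ n) F) = (yz ^^ n) (R F)"
    "R ((xz ^^ n) F) = (xz ^^ n) (R F)"
  by (induction n) (simp_all add: shift_op_xy shift_op_yz shift_op_xz assms)

lemma vanishing_diff:
  shows "vanishing_x F \<Longrightarrow> vanishing_x G \<Longrightarrow> vanishing_x (F - G)"
    and "vanishing_y F \<Longrightarrow> vanishing_y G \<Longrightarrow> vanishing_y (F - G)"
proof -
  have *: "\<exists>t. \<forall>a\<ge>t. P a \<and> Q a" if "\<exists>t. \<forall>a\<ge>t. P a" "\<exists>t. \<forall>a\<ge>t. Q a" for P Q :: "int \<Rightarrow> bool"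
  proof -
    from that obtain s t where "\<forall>a\<ge>s. P a" "\<forall>a\<ge>t. Q a" by blast
    then show ?thesis by (intro exI[of _ "max s t"]) auto
  qed
  have x: "vanishing_x (F - G)" if "vanishing_x F" "vanishing_x G" for F G
    unfolding vanishing_x_def
  proof
    fix c
    have "\<exists>t. \<forall>a\<ge>t. (\<forall>b. F a b c = 0) \<and> (\<forall>b. G a b c = 0)"
      using that unfolding vanishing_x_def by (intro *) blast+
    then obtain t where "\<forall>a\<ge>t. (\<forall>b. F a b c = 0) \<and> (\<forall>b. G a b c = 0)" by blast
    then show "\<exists>t. \<forall>a\<ge>t. \<forall>b. (F - G) a b c = 0" by (intro exI[of _ t]) simp
  qed
  from x show "vanishing_x F \<Longrightarrow> vanishing_x G \<Longrightarrow> vanishing_x (F - G)" .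
  have y: "vanishing_y F \<longleftrightarrow> vanishing_x (\<lambda>a b c. F b a c)" for F
    by (simp add: vanishing_x_def vanishing_y_def)
  show "vanishing_y (F - G)" if "vanishing_y F" "vanishing_y G"
  proof -
    have "vanishing_x ((\<lambda>a b c. F b a c) - (\<lambda>a b c. G b a c))"
      by (rule x) (use that in \<open>simp_all only: y\<close>)
    also have "(\<lambda>a b c. F b a c) - (\<lambda>a b c. G b a c) = (\<lambda>a b c. (F - G) b a c)"
      by (simp add: fun_eq_iff)
    finally show ?thesis by (simp only: y)
  qed
qed

lemma vanishing_shift:
  assumes "vanishing_x F" shows "vanishing_x (\<lambda>a b c. F (a + 1) b c)"
    "vanishing_x (\<lambda>a b c. F a (b + 1) c)" "vanishing_x (\<lambda>a b c. F a b (c + 1))"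
  using assms unfolding vanishing_x_def by (metis add_increasing2 zero_le_one)+

lemma vanishing_shift':
  assumes "vanishing_y F" shows "vanishing_y (\<lambda>a b c. F (a + 1) b c)"
    "vanishing_y (\<lambda>a b c. F a (b + 1) c)" "vanishing_y (\<lambda>a b c. F a b (c + 1))"
  using assms unfolding vanishing_y_def by (metis add_increasing2 zero_le_one)+

lemma shift_op_base: "shift_op xy" "shift_op yz" "shift_op xz" "shift_op (\<lambda>F. F)" "shift_op (\<lambda>F. 0)"
proof -
  have v: "xy F = (\<lambda>a b c. F (a + 1) b c) - (\<lambda>a b c. F a (b + 1) c)"
      "yz F = (\<lambda>a b c. F a (b + 1) c) - (\<lambda>a b c. F a b (c + 1))"
      "xz F = (\<lambda>a b c. F (a + 1) b c) - (\<lambda>a b c. F a b (c + 1))" for F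
    by (simp_all add: fun_eq_iff xy_def yz_def xz_def)
  have "vanishing_x (xy F)" "vanishing_x (yz F)" "vanishing_x (xz F)" if "vanishing_x F" for F
    unfolding v using that by (blast intro: vanishing_diff vanishing_shift)+
  moreover have "vanishing_y (xy F)" "vanishing_y (yz F)" "vanishing_y (xz F)" if "vanishing_y F" for F
    unfolding v using that by (blast intro: vanishing_diff vanishing_shift')+
  moreover have "vanishing_x 0" "vanishing_y 0" by (simp_all add: vanishing_x_def vanishing_y_def)
  ultimately show "shift_op xy" "shift_op yz" "shift_op xz" "shift_op (\<lambda>F. F)" "shift_op (\<lambda>F. 0)"
    unfolding shift_op_def by (auto simp: fun_eq_iff xy_def yz_def xz_def)
qed

lemma shift_op_comp: "shift_op R \<Longrightarrow> shift_op S \<Longrightarrow> shift_op (\<lambda>F. R (S F))"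
  by (simp add: shift_op_def)

lemma shift_op_minus: "shift_op R \<Longrightarrow> shift_op S \<Longrightarrow> shift_op (\<lambda>F. R F - S F)"
  by (simp add: shift_op_def vanishing_diff)
     (auto simp: fun_eq_iff xy_def yz_def xz_def)

lemma shift_op_funpow: "shift_op R \<Longrightarrow> shift_op (R ^^ n)"
proof (induction n)
  case 0
  then show ?case using shift_op_base(4) by (simp add: id_def)
next
  case (Suc n)
  then show ?case using shift_op_comp[of R "R ^^ n"] by (simp add: comp_def)
qed

text \<open>With \<open>q = s - p\<close>, the power \<open>q\<^sup>k\<^sup>+\<^sup>l\<close> lies in the ideal generated by \<open>p\<^sup>k\<close> and \<open>s\<^sup>l\<close>.\<close>

lemma yz_pow_ideal:
  "\<exists>R S. shift_op R \<and> shift_op S \<and> (\<forall>F. (yz ^^ (k + l)) F = (xy ^^ k) (R F) + (xz ^^ l) (S F))"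
proof (induction "k + l" arbitrary: k l)
  case 0
  then have "(yz ^^ (k + l)) F = (xy ^^ k) F + (xz ^^ l) 0" for F by simp
  then show ?case using shift_op_base(4,5) by blast
next
  case (Suc n)
  consider "k = 0" | "l = 0" | k' l' where "k = Suc k'" "l = Suc l'" by (cases k; cases l) auto
  then show ?case
  proof cases
    case 1
    have "(yz ^^ (k + l)) F = (xy ^^ k) ((yz ^^ l) F) + (xz ^^ l) 0" for F
      using shift_op_0[OF shift_op_funpow[OF shift_op_base(3)]] 1 by simp
    then show ?thesis using shift_op_funpow[OF shift_op_base(2)] shift_op_base(5) by blast
  next
    case 2
    have "(yz ^^ (k + l)) F = (xy ^^ k) 0 + (xz ^^ l) ((yz ^^ k) F)" for F
      using shift_op_0[OF shift_op_funpow[OF shift_op_base(1)]] 2 by simp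
    then show ?thesis using shift_op_funpow[OF shift_op_base(2)] shift_op_base(5) by blast
  next
    case 3
    obtain R S where RS: "shift_op R" "shift_op S"
      "\<And>F. (yz ^^ (k + l')) F = (xy ^^ k) (R F) + (xz ^^ l') (S F)"
      using Suc.hyps(1)[of k l'] Suc.hyps(2) 3 by auto
    obtain R' S' where RS': "shift_op R'" "shift_op S'"
      "\<And>F. (yz ^^ (k' + l)) F = (xy ^^ k') (R' F) + (xz ^^ l) (S' F)"
      using Suc.hyps(1)[of k' l] Suc.hyps(2) 3 by auto
    have pm: "(xy ^^ i) (F - G) = (xy ^^ i) F - (xy ^^ i) G" "(xz ^^ i) (F - G) = (xz ^^ i) F - (xz ^^ i) G"
        "(yz ^^ i) (F - G) = (yz ^^ i) F - (yz ^^ i) G" for i F G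
      using shift_op_diff_arg shift_op_funpow shift_op_base by blast+
    have e: "k + l = Suc (k + l')" "k + l' = k' + l" using 3 by auto
    \<comment> \<open>One factor \<open>yz\<close> is split into \<open>xz\<close> minus
      \<open>xy\<close>. The \<open>xz\<close> part uses the hypothesis for (k, l'), the
      \<open>xy\<close> part that for (k', l), and in each the split-off factor restores the missing
      power.\<close>
    have "(yz ^^ (k + l)) F = (xy ^^ k) (R (xz F) - R' F) + (xz ^^ l) (S F - S' (xy F))" for F
    proof -
      have "(yz ^^ (k + l)) F = (yz ^^ (k + l')) (xz F - xy F)"
        unfolding e(1) by (simp only: funpow_Suc_right comp_apply yz_eq[of F])
      also have "\<dots> = (yz ^^ (k + l')) (xz F) - (yz ^^ (k' + l)) (xy F)"
        unfolding pm(3) e(2) ..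
      also have "\<dots> = (xy ^^ k) (R (xz F)) + (xz ^^ l') (S (xz F)) - ((xy ^^ k') (R' (xy F)) + (xz ^^ l) (S' (xy F)))"
        unfolding RS(3) RS'(3) ..
      also have "(xz ^^ l') (S (xz F)) = (xz ^^ l) (S F)"
        by (simp only: 3 funpow_Suc_right comp_apply shift_op_xz[OF RS(2)])
      also have "(xy ^^ k') (R' (xy F)) = (xy ^^ k) (R' F)"
        by (simp only: 3 funpow_Suc_right comp_apply shift_op_xy[OF RS'(1)])
      finally show ?thesis unfolding pm by (simp only: add_diff_add)
    qed
    moreover have "shift_op (\<lambda>F. R (xz F) - R' F)" "shift_op (\<lambda>F. S F - S' (xy F))"
      by (rule shift_op_minus[OF shift_op_comp[OF RS(1) shift_op_base(3)] RS'(1)],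
          rule shift_op_minus[OF RS(2) shift_op_comp[OF RS'(2) shift_op_base(1)]])
    ultimately show ?thesis by blast
  qed
qed

lemma xy_pow: "(xy ^^ n) F a b c = (dd ^^ n) (\<lambda>a b. F a b c) a b"
  and yz_pow: "(yz ^^ n) F a b c = (dd ^^ n) (F a) b c"
  and xz_pow: "(xz ^^ n) F a b c = (dd ^^ n) (\<lambda>a c. F a b c) a c"
  by (induction n arbitrary: a b c) (simp_all add: xy_def yz_def xz_def dd_def)

lemma xy_pow_eq_0: "(\<And>c. (dd ^^ n) (\<lambda>a b. F a b c) = 0) \<Longrightarrow> (xy ^^ n) F = 0"
  and yz_pow_eq_0: "(\<And>a. (dd ^^ n) (F a) = 0) \<Longrightarrow> (yz ^^ n) F = 0"
  and xz_pow_eq_0: "(\<And>b. (dd ^^ n) (\<lambda>a c. F a b c) = 0) \<Longrightarrow> (xz ^^ n) F = 0"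
  by (simp_all add: fun_eq_iff xy_pow yz_pow xz_pow)

lemma pow_diff3: "(xy ^^ i) (F - G) = (xy ^^ i) F - (xy ^^ i) G"
  "(yz ^^ i) (F - G) = (yz ^^ i) F - (yz ^^ i) G"
  "(xz ^^ i) (F - G) = (xz ^^ i) F - (xz ^^ i) G"
  using shift_op_diff_arg shift_op_funpow shift_op_base by blast+

lemma yz_xz_kill:
  assumes "(yz ^^ N) F = 0" "(xz ^^ N) G = 0"
  shows "(yz ^^ N) ((xz ^^ N) (F - G)) = 0"
proof -
  have "(yz ^^ N) ((xz ^^ N) F) = (xz ^^ N) ((yz ^^ N) F)"
    by (rule shift_op_pow(3)[OF shift_op_funpow[OF shift_op_base(2)]])
  then show ?thesis
    using assms shift_op_0[OF shift_op_funpow[OF shift_op_base(3)]]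
      shift_op_0[OF shift_op_funpow[OF shift_op_base(2)]] by (simp add: pow_diff3)
qed

text \<open>Of the 3N factors y - z, the last 2N become a multiple of (x - y)^N plus a multiple of
  (x - z)^N. The first kills G, and the second does so together with the N factors y - z that were
  kept.\<close>

lemma yz_power_kill:
  assumes "(xy ^^ N) G = 0" "(yz ^^ N) ((xz ^^ N) G) = 0"
  shows "(yz ^^ (N + (N + N))) G = 0"
proof -
  obtain R S where RS: "shift_op R" "shift_op S"
    "\<And>F. (yz ^^ (N + N)) F = (xy ^^ N) (R F) + (xz ^^ N) (S F)"
    using yz_pow_ideal by metis
  have pw: "(yz ^^ (N + k)) F = (yz ^^ N) ((yz ^^ k) F)" for k F
    by (simp add: funpow_add)
  have q: "shift_op (yz ^^ N)" by (intro shift_op_funpow shift_op_base)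
  have add: "(yz ^^ N) (F + G) = (yz ^^ N) F + (yz ^^ N) G" for F G
    using shift_op_diff_arg[OF q, of F "- G"] shift_op_diff_arg[OF q, of 0 G] shift_op_0[OF q] by simp
  have "(yz ^^ (N + (N + N))) G = (yz ^^ N) ((xy ^^ N) (R G)) + (yz ^^ N) ((xz ^^ N) (S G))"
    unfolding pw[of "N + N"] RS(3) add ..
  also have "(yz ^^ N) ((xy ^^ N) (R G)) = (yz ^^ N) (R ((xy ^^ N) G))"
    unfolding shift_op_pow(1)[OF RS(1)] ..
  also have "(yz ^^ N) ((xz ^^ N) (S G)) = S ((yz ^^ N) ((xz ^^ N) G))"
    by (simp only: shift_op_pow[OF RS(2)])
  finally show ?thesis
    unfolding assms shift_op_0[OF RS(1)] shift_op_0[OF RS(2)] shift_op_0[OF q] by (simp only: add_0)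
qed

text \<open>With one more factor y - z the ideal decomposition leaves a factor x - y in front. The
  remaining operator \<open>T\<close> contains (x - y)^N, which does not distinguish
  \<open>F1\<close> from \<open>F2\<close>; so both give the same f, which inherits truncation in y
  from \<open>F1\<close> and in x from \<open>F2\<close>.\<close>

lemma yz_power_telescope:
  assumes F1: "(yz ^^ N) ((xz ^^ N) F1) = 0" and F2: "(yz ^^ N) ((xz ^^ N) F2) = 0"
    and "(xy ^^ N) (F1 - F2) = 0" "vanishing_y F1" "vanishing_x F2"
  shows "\<exists>f. (yz ^^ (N + (Suc N + N))) F1 = xy f \<and> (yz ^^ (N + (Suc N + N))) F2 = xy f \<and>
    vanishing_x f \<and> vanishing_y f"
proof -
  obtain R S where RS: "shift_op R" "shift_op S"
    "\<And>F. (yz ^^ (Suc N + N)) F = (xy ^^ Suc N) (R F) + (xz ^^ N) (S F)"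
    using yz_pow_ideal by metis
  have pw: "(yz ^^ (N + k)) F = (yz ^^ N) ((yz ^^ k) F)" for k F
    by (simp add: funpow_add)
  have q: "shift_op (yz ^^ N)" by (intro shift_op_funpow shift_op_base)
  have add: "(yz ^^ N) (F + G) = (yz ^^ N) F + (yz ^^ N) G" for F G
    using shift_op_diff_arg[OF q, of F "- G"] shift_op_diff_arg[OF q, of 0 G] shift_op_0[OF q] by simp
  define T where "T F = (yz ^^ N) (R ((xy ^^ N) F))" for F
  have T: "shift_op T"
    unfolding T_def[abs_def]
    by (rule shift_op_comp[OF q shift_op_comp[OF RS(1) shift_op_funpow[OF shift_op_base(1)]]])
  have main: "(yz ^^ (N + (Suc N + N))) F = xy (T F)" if "(yz ^^ N) ((xz ^^ N) F) = 0" for F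
  proof -
    have "(yz ^^ (N + (Suc N + N))) F = (yz ^^ N) ((xy ^^ Suc N) (R F)) + (yz ^^ N) ((xz ^^ N) (S F))"
      unfolding pw[of "Suc N + N"] RS(3) add ..
    also have "(yz ^^ N) ((xz ^^ N) (S F)) = S ((yz ^^ N) ((xz ^^ N) F))"
      by (simp only: shift_op_pow[OF RS(2)])
    also have "(yz ^^ N) ((xy ^^ Suc N) (R F)) = xy (T F)"
      unfolding T_def by (simp add: shift_op_pow[OF RS(1)] shift_op_xy[OF q])
    finally show ?thesis unfolding that shift_op_0[OF RS(2)] by (simp only: add_0_right)
  qed
  have "T F1 - T F2 = T (F1 - F2)" by (rule shift_op_diff_arg[OF T, symmetric])
  also have "\<dots> = 0" unfolding T_def assms(3) shift_op_0[OF RS(1)] shift_op_0[OF q] ..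
  finally have "T F1 = T F2" by (simp only: right_minus_eq)
  then show ?thesis
    using main[OF F1] main[OF F2] shift_op_vx[OF T assms(5)] shift_op_vy[OF T assms(4)] by metis
qed

lemma local_to_common:
  assumes "local_to A B" "local_to A C" "local_to B C"
  obtains N where "\<And>u. (dd ^^ N) (bracket A B u) = 0" "\<And>u. (dd ^^ N) (bracket A C u) = 0"
    "\<And>u. (dd ^^ N) (bracket B C u) = 0"
proof -
  obtain K L M where "\<And>u. (dd ^^ K) (bracket A B u) = 0" "\<And>u. (dd ^^ L) (bracket A C u) = 0"
    "\<And>u. (dd ^^ M) (bracket B C u) = 0"
    using assms unfolding local_to_def by blast
  then show ?thesis
    by (intro that[of "max K (max L M)"]) (meson dd_pow_mono max.cobounded1 max.cobounded2 le_trans)+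
qed

context
  fixes A B C :: vfield and N :: nat and u :: VL and P Q G :: dist3
  assumes A: "field_like A" and B: "field_like B" and C: "field_like C"
    and AB: "\<And>u. (dd ^^ N) (bracket A B u) = 0" and AC: "\<And>u. (dd ^^ N) (bracket A C u) = 0"
    and BC: "\<And>u. (dd ^^ N) (bracket B C u) = 0"
  defines "P \<equiv> (\<lambda>a b c. commutator (\<lambda>u. A a (B b u)) (C c) u)"
    and "Q \<equiv> (\<lambda>a b c. commutator (\<lambda>u. B b (A a u)) (C c) u)"
    and "G \<equiv> (\<lambda>a b c. commutator (\<lambda>u. bracket A B u a b) (C c) u)"
begin

lemma AB_bracket_eq: "G = P - Q"
  by (simp add: P_def Q_def G_def fun_eq_iff bracket_def commutator_def lin_diff[OF field_like_lin[OF C]])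

lemma AB_xy: "(xy ^^ N) (P - Q) = 0"
  unfolding AB_bracket_eq[symmetric]
proof (rule xy_pow_eq_0)
  fix c
  have "(\<lambda>a b. G a b c) = bracket A B (C c u) - (\<lambda>a b. C c (bracket A B u a b))"
    by (simp add: G_def fun_eq_iff commutator_def)
  then show "(dd ^^ N) (\<lambda>a b. G a b c) = 0"
    by (simp only: dd_pow_diff AB dd_pow_lin[OF field_like_lin[OF C]])
       (simp add: lin_0[OF field_like_lin[OF C]] fun_eq_iff)
qed

text \<open>[AB, C] = A[B, C] + [A, C]B. The first summand is killed by (y - z)^N, the second by (x
  - z)^N; the sign in \<open>H\<close> writes the sum as a difference.\<close>

lemma AB_P: "(yz ^^ N) ((xz ^^ N) P) = 0"
proof -
  define F where "F = (\<lambda>a b c. A a (bracket B C u b c))"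
  define H where "H = (\<lambda>a b c. (-1) *\<^sub>V bracket A C (B b u) a c)"
  have "P = F - H"
    by (simp add: P_def F_def H_def fun_eq_iff bracket_def commutator_def lin_diff[OF field_like_lin[OF A]])
  moreover have "(yz ^^ N) F = 0"
    unfolding F_def using BC
    by (intro yz_pow_eq_0) (simp add: dd_pow_lin[OF field_like_lin[OF A]] lin_0[OF field_like_lin[OF A]] fun_eq_iff)
  moreover have "(xz ^^ N) H = 0"
    unfolding H_def using AC
    by (intro xz_pow_eq_0) (simp only: dd_pow_lin[OF lin_scale[OF lin_id]], simp add: fun_eq_iff)
  ultimately show ?thesis using yz_xz_kill by simp
qed

lemma AB_Q: "(yz ^^ N) ((xz ^^ N) Q) = 0"
proof -
  define H where "H = (\<lambda>a b c. (-1) *\<^sub>V B b (bracket A C u a c))"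
  define F where "F = (\<lambda>a b c. bracket B C (A a u) b c)"
  have "Q = F - H"
    by (simp add: Q_def F_def H_def fun_eq_iff bracket_def commutator_def lin_diff[OF field_like_lin[OF B]])
  moreover have "(yz ^^ N) F = 0"
    unfolding F_def using BC by (intro yz_pow_eq_0) simp
  moreover have "(xz ^^ N) H = 0"
    unfolding H_def using AC
    by (intro xz_pow_eq_0) (simp only: dd_pow_lin[OF lin_scale[OF field_like_lin[OF B]]],
       simp add: fun_eq_iff lin_0[OF field_like_lin[OF B]])
  ultimately show ?thesis using yz_xz_kill by simp
qed

lemma AB_G: "(yz ^^ (N + (N + N))) G = 0"
  unfolding AB_bracket_eq using AB_xy AB_P AB_Q
  by (intro yz_power_kill) (simp_all add: pow_diff3)

text \<open>In both terms of \<open>P\<close> the operator B acts before A, on \<open>u\<close> or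
  on \<open>C c u\<close>, so the bound does not depend on the index of A. In \<open>Q\<close> the
  roles of A and B are exchanged.\<close>

lemma P_vanishing: "vanishing_y P"
  unfolding vanishing_y_def
proof
  fix c
  obtain K L where "\<And>b. b \<ge> K \<Longrightarrow> B b u = 0" "\<And>b. b \<ge> L \<Longrightarrow> B b (C c u) = 0"
    using field_like_bound[OF B] by metis
  then show "\<exists>t. \<forall>b\<ge>t. \<forall>a. P a b c = 0"
    by (intro exI[of _ "max K L"]) (simp add: P_def commutator_def lin_0 field_like_lin A C)
qed

lemma Q_vanishing: "vanishing_x Q"
  unfolding vanishing_x_def
proof
  fix c
  obtain K L where "\<And>b. b \<ge> K \<Longrightarrow> A b u = 0" "\<And>b. b \<ge> L \<Longrightarrow> A b (C c u) = 0"
    using field_like_bound[OF A] by metis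
  then show "\<exists>t. \<forall>a\<ge>t. \<forall>b. Q a b c = 0"
    by (intro exI[of _ "max K L"]) (simp add: Q_def commutator_def lin_0 field_like_lin B C)
qed

lemma nprod_pow_bracket: "(dd ^^ (N + (N + N))) (bracket (nprod i A B) C u) = 0"
proof -
  have e: "bracket (nprod i A B) C u = (xy ^^ i) G 0"
  proof (intro ext)
    fix k c
    have "(\<lambda>a b. G a b c) = bracket A B (C c u) - (\<lambda>a b. C c (bracket A B u a b))"
      by (simp add: G_def fun_eq_iff commutator_def)
    then show "bracket (nprod i A B) C u k c = (xy ^^ i) G 0 k c"
      by (simp only: xy_pow dd_pow_diff dd_pow_lin[OF field_like_lin[OF C]])
         (simp add: bracket_def[of "nprod i A B"] commutator_def nprod_def)
  qed
  have "(yz ^^ (N + (N + N))) ((xy ^^ i) G) = (xy ^^ i) ((yz ^^ (N + (N + N))) G)"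
    by (rule shift_op_pow(1)[OF shift_op_funpow[OF shift_op_base(2)]])
  also have "\<dots> = 0" unfolding AB_G by (rule shift_op_0[OF shift_op_funpow[OF shift_op_base(1)]])
  finally show ?thesis unfolding e by (simp add: fun_eq_iff yz_pow)
qed

text \<open>A mode of the normally ordered product sums \<open>P\<close> over j < 0 and
  \<open>Q\<close> over j >= 0. After enough factors y - z both become the same multiple of x - y,
  so the cut at j = 0 disappears and the sum over j telescopes to zero.\<close>

lemma normal_prod_pow_bracket: "(dd ^^ (N + (Suc N + N))) (bracket (normal_prod A B) C u) = 0"
proof -
  define t where "t u k j = (if j < 0 then A j (B (k - j - 1) u) else B (k - j - 1) (A j u))" for u k j
  define K where "K F1 F2 j k c = (if j < 0 then F1 j (k - j - 1) c else F2 j (k - j - 1) c :: VL)"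
    for F1 F2 :: dist3 and j k c
  have supp: "finite {j. K F1 F2 j k c \<noteq> 0}" if V: "vanishing_y F1" "vanishing_x F2" for F1 F2 k c
  proof -
    obtain s where s: "\<And>a b. b \<ge> s \<Longrightarrow> F1 a b c = 0"
      using V(1) unfolding vanishing_y_def by meson
    obtain t where t: "\<And>a b. a \<ge> t \<Longrightarrow> F2 a b c = 0"
      using V(2) unfolding vanishing_x_def by meson
    have "j \<in> {k - 1 - s..0} \<union> {0..t}" if "K F1 F2 j k c \<noteq> 0" for j
      using that s[of "k - j - 1" j] t[of j "k - j - 1"] unfolding K_def by (cases "j < 0"; force)
    then have "{j. K F1 F2 j k c \<noteq> 0} \<subseteq> {k - 1 - s..0} \<union> {0..t}" by blast
    then show ?thesis by (rule finite_subset) simp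
  qed
  have dd_sum: "(dd ^^ n) (\<lambda>k c. Sum_any (\<lambda>j. K F1 F2 j k c))
      = (\<lambda>k c. Sum_any (\<lambda>j. K ((yz ^^ n) F1) ((yz ^^ n) F2) j k c))"
    if "vanishing_y F1" "vanishing_x F2" for n F1 F2
  proof (induction n)
    case (Suc n)
    let ?F = "(yz ^^ n) F1" and ?G = "(yz ^^ n) F2"
    have v: "vanishing_y ?F" "vanishing_x ?G"
      using that shift_op_vx shift_op_vy shift_op_funpow shift_op_base by blast+
    show ?case
    proof (intro ext)
      fix k c
      have K: "K (yz ?F) (yz ?G) j k c = K ?F ?G j (k + 1) c + (-1) *\<^sub>V K ?F ?G j k (c + 1)" for j
        by (simp add: K_def yz_def algebra_simps)
      have "Sum_any (\<lambda>j. K (yz ?F) (yz ?G) j k c) =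
        Sum_any (\<lambda>j. K ?F ?G j (k + 1) c) + Sum_any (\<lambda>j. (-1) *\<^sub>V K ?F ?G j k (c + 1))"
        unfolding K by (intro Sum_any.distrib supp[OF v] finite_support_pull[OF lin_scale[OF lin_id]])
      also have "Sum_any (\<lambda>j. (-1) *\<^sub>V K ?F ?G j k (c + 1)) = (-1) *\<^sub>V Sum_any (\<lambda>j. K ?F ?G j k (c + 1))"
        using lin_Sum_any[OF lin_scale[OF lin_id] supp[OF v], of "-1" k "c + 1"] by simp
      finally show "(dd ^^ Suc n) (\<lambda>k c. Sum_any (\<lambda>j. K F1 F2 j k c)) k c
        = Sum_any (\<lambda>j. K ((yz ^^ Suc n) F1) ((yz ^^ Suc n) F2) j k c)"
        unfolding dd_pow_Suc Suc.IH by simp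
    qed
  qed simp
  have br: "bracket (normal_prod A B) C u = (\<lambda>k c. Sum_any (\<lambda>j. K P Q j k c))"
  proof (intro ext)
    fix k c
    have NP: "normal_prod A B k v = Sum_any (t v k)" for v
      by (simp add: normal_prod_def t_def)
    have fin: "finite {j. t v k j \<noteq> 0}" for v
      unfolding t_def by (rule normal_prod_finite[OF A B])
    have L: "lin (\<lambda>v. (-1) *\<^sub>V C c v)" by (intro lin_scale field_like_lin C)
    have K: "K P Q j k c = t (C c u) k j + (-1) *\<^sub>V C c (t u k j)" for j
      by (simp add: K_def P_def Q_def commutator_def t_def)
    have "Sum_any (\<lambda>j. K P Q j k c) = Sum_any (t (C c u) k) + Sum_any (\<lambda>j. (-1) *\<^sub>V C c (t u k j))"
      unfolding K by (intro Sum_any.distrib fin finite_support_pull[OF L])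
    also have "Sum_any (\<lambda>j. (-1) *\<^sub>V C c (t u k j)) = (-1) *\<^sub>V C c (Sum_any (t u k))"
      using lin_Sum_any[OF L fin] by simp
    finally show "bracket (normal_prod A B) C u k c = Sum_any (\<lambda>j. K P Q j k c)"
      by (simp add: bracket_def commutator_def NP)
  qed
  obtain f where f: "(yz ^^ (N + (Suc N + N))) P = xy f" "(yz ^^ (N + (Suc N + N))) Q = xy f"
    "vanishing_x f" "vanishing_y f"
    using yz_power_telescope[OF AB_P AB_Q AB_xy P_vanishing Q_vanishing] by blast
  have Z: "Sum_any (\<lambda>j. K (xy f) (xy f) j k c) = 0" for k c
  proof -
    \<comment> \<open>On the line of summation a + b = k - 1, multiplication by x - y is a
      difference of neighbouring values of \<open>g\<close>. The two truncations of f make the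
      support of \<open>g\<close> finite.\<close>
    define g where "g j = f j (k - j) c" for j
    obtain s where s: "\<And>a b. b \<ge> s \<Longrightarrow> f a b c = 0"
      using f(4) unfolding vanishing_y_def by meson
    obtain t where t: "\<And>a b. a \<ge> t \<Longrightarrow> f a b c = 0"
      using f(3) unfolding vanishing_x_def by meson
    have "g j = 0" if "j \<notin> {k - s..t}" for j
      using that s t unfolding g_def by (cases "j < k - s") auto
    then have "{j. g j \<noteq> 0} \<subseteq> {k - s..t}" by blast
    then have fin: "finite {j. g j \<noteq> 0}" by (rule finite_subset) simp
    have eq: "Sum_any (\<lambda>j. g (j + 1)) = Sum_any g"
      by (rule Sum_any_shift)
    have fin': "finite {j. g (j + 1) \<noteq> 0}"
      by (rule finite_subset[of _ "(\<lambda>j. j - 1) ` {j. g j \<noteq> 0}"])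
         (use fin in \<open>force simp: image_iff\<close>)+
    have "K (xy f) (xy f) j k c = g (j + 1) + (-1) *\<^sub>V g j" for j
      by (simp add: K_def xy_def g_def algebra_simps)
    then have "Sum_any (\<lambda>j. K (xy f) (xy f) j k c) = Sum_any (\<lambda>j. g (j + 1)) + Sum_any (\<lambda>j. (-1) *\<^sub>V g j)"
      by (simp only:) (intro Sum_any.distrib fin fin' finite_support_pull[OF lin_scale[OF lin_id]])
    also have "Sum_any (\<lambda>j. (-1) *\<^sub>V g j) = (-1) *\<^sub>V Sum_any g"
      using lin_Sum_any[OF lin_scale[OF lin_id] fin, of "-1"] by simp
    finally show ?thesis by (simp add: eq)
  qed
  show ?thesis
    unfolding br dd_sum[OF P_vanishing Q_vanishing] f(1,2) Z by (simp only: zero_fun_def)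
qed

end

theorem Dong:
  assumes "field_like A" "field_like B" "field_like C"
    and "local_to A B" "local_to A C" "local_to B C"
  shows "local_to (nprod i A B) C" "local_to (normal_prod A B) C"
proof -
  obtain N where N: "\<And>u. (dd ^^ N) (bracket A B u) = 0" "\<And>u. (dd ^^ N) (bracket A C u) = 0"
    "\<And>u. (dd ^^ N) (bracket B C u) = 0"
    using local_to_common[OF assms(4-6)] by metis
  show "local_to (nprod i A B) C"
    unfolding local_to_def using nprod_pow_bracket[OF assms(1-3) N] by blast
  show "local_to (normal_prod A B) C"
    unfolding local_to_def using normal_prod_pow_bracket[OF assms(1-3) N] by blast
qed

section \<open>Derivatives of fields\<close>

definition deriv_field :: "vfield \<Rightarrow> vfield" where
  "deriv_field A k u = of_int (- k) *\<^sub>V A (k - 1) u"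

text \<open>By Leibniz, differentiation in z commutes with multiplication by z - w up to the
  identity, so it costs one more power of z - w.\<close>

lemma dd_pow_deriv:
  "(dd ^^ N) F = 0 \<Longrightarrow> (dd ^^ Suc N) (\<lambda>a b. of_int (- a) *\<^sub>V F (a - 1) b) = 0"
proof (induction N arbitrary: F)
  case 0
  then show ?case by (simp add: fun_eq_iff dd_def)
next
  case (Suc N)
  let ?X = "\<lambda>F a b. of_int (- a) *\<^sub>V F (a - 1) b"
  have e: "dd (?X F) = ?X (dd F) - F"
    by (simp add: fun_eq_iff dd_def VL.scale_left_diff_distrib VL.scale_left_distrib VL.scale_right_diff_distrib)
  have F: "(dd ^^ N) (dd F) = 0" "(dd ^^ Suc N) F = 0"
    using Suc.prems by (simp_all only: funpow_Suc_right comp_apply)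
  have "(dd ^^ Suc (Suc N)) (?X F) = (dd ^^ Suc N) (dd (?X F))"
    by (simp only: funpow_Suc_right comp_apply)
  also have "\<dots> = (dd ^^ Suc N) (?X (dd F)) - (dd ^^ Suc N) F"
    unfolding e dd_pow_diff ..
  also have "\<dots> = 0"
    unfolding Suc.IH[OF F(1)] F(2) by (simp only: diff_self)
  finally show ?case .
qed

lemma local_to_deriv:
  assumes "local_to A C" "field_like C"
  shows "local_to (deriv_field A) C"
proof -
  obtain N where N: "\<And>u. (dd ^^ N) (bracket A C u) = 0"
    using assms(1) by (auto simp: local_to_def)
  have E: "bracket (deriv_field A) C u = (\<lambda>a b. of_int (- a) *\<^sub>V bracket A C u (a - 1) b)" for u
    by (simp add: fun_eq_iff bracket_def deriv_field_def commutator_def lin_scl lin_minus field_like_lin assms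
        VL.scale_right_diff_distrib)
  show ?thesis
    unfolding local_to_def E using dd_pow_deriv[OF N] by blast
qed

lemma field_like_deriv:
  assumes "field_like A" shows "field_like (deriv_field A)"
  unfolding field_like_def
proof (intro conjI allI)
  show "lin (deriv_field A k)" for k
    using lin_scale[OF field_like_lin[OF assms], of "of_int (- k)" "k - 1"]
    unfolding deriv_field_def[abs_def] .
  show "\<exists>K. \<forall>k\<ge>K. deriv_field A k u = 0" for u
  proof -
    obtain K where "\<And>k. k \<ge> K \<Longrightarrow> A k u = 0" using field_like_bound[OF assms] by metis
    then show ?thesis by (intro exI[of _ "K + 1"]) (simp add: deriv_field_def)
  qed
qed

lemma div_deriv_0: "div_deriv 0 A = A"
  by (simp add: div_deriv_def fun_eq_iff)

text \<open>Reduces divided derivatives to iterated plain ones, so that each closure property has to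
  be shown only for \<open>deriv_field\<close>. The factor comes from the absorption identity for
  binomials.\<close>

lemma div_deriv_Suc:
  "div_deriv (Suc r) A = (\<lambda>k u. (1 / of_nat (Suc r)) *\<^sub>V deriv_field (div_deriv r A) k u)"
proof (intro ext)
  fix k u
  let ?x = "of_int (int r - k) :: complex"
  have "of_nat (Suc r) * (?x gchoose Suc r) = (?x - of_nat r) * (?x gchoose r)"
    by (simp only: gbinomial_absorption gbinomial_absorb_comp)
  moreover have "?x - of_nat r = of_int (- k)" by simp
  moreover have "?x gchoose Suc r = 1 / of_nat (Suc r) * (of_nat (Suc r) * (?x gchoose Suc r))"
    by (simp only: mult.assoc[symmetric]) (simp del: of_nat_Suc)
  ultimately have "?x gchoose Suc r = 1 / of_nat (Suc r) * (of_int (- k) * (?x gchoose r))"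
    by (simp only:)
  moreover have "int (Suc r) - k - 1 = int r - k" "int r - (k - 1) - 1 = int r - k" "k - 1 - int r = k - int (Suc r)"
    by simp_all
  ultimately show "div_deriv (Suc r) A k u = (1 / of_nat (Suc r)) *\<^sub>V deriv_field (div_deriv r A) k u"
    unfolding deriv_field_def div_deriv_def VL.scale_scale by (simp only: mult.assoc)
qed

lemma field_like_div_deriv: "field_like A \<Longrightarrow> field_like (div_deriv r A)"
  by (induction r) (simp_all add: div_deriv_0 div_deriv_Suc field_like_scl field_like_deriv)

lemma local_to_div_deriv:
  "local_to A C \<Longrightarrow> field_like C \<Longrightarrow> local_to (div_deriv r A) C"
  by (induction r) (simp_all add: div_deriv_0 div_deriv_Suc local_to_scl local_to_deriv)

section \<open>Vacuum and translation covariance\<close>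

text \<open>The creation property: A(z)1 is a power series in z. Its constant term
  \<open>A (-1) 1\<close> is the state of the field.\<close>

definition creative :: "vfield \<Rightarrow> bool" where
  "creative A \<longleftrightarrow> (\<forall>k\<ge>0. A k 1 = 0)"

definition covariant :: "(VL \<Rightarrow> VL) \<Rightarrow> vfield \<Rightarrow> bool" where
  "covariant T A \<longleftrightarrow> (\<forall>k u. commutator T (A k) u = deriv_field A k u)"

lemma creative_deriv: "creative A \<Longrightarrow> creative (deriv_field A)"
  unfolding creative_def deriv_field_def
proof (intro allI impI)
  fix k :: int
  assume "\<forall>k\<ge>0. A k 1 = 0" "0 \<le> k"
  then show "of_int (- k) *\<^sub>V A (k - 1) 1 = 0" by (cases "k = 0") auto
qed

lemma creative_scl: "creative A \<Longrightarrow> creative (\<lambda>k u. c *\<^sub>V A k u)"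
  and creative_add: "creative A \<Longrightarrow> creative B \<Longrightarrow> creative (\<lambda>k u. A k u + B k u)"
  by (simp_all add: creative_def)

lemma creative_div_deriv: "creative A \<Longrightarrow> creative (div_deriv r A)"
  by (induction r) (simp_all add: div_deriv_0 div_deriv_Suc creative_scl creative_deriv)

lemma div_deriv_vacuum: "div_deriv r A (-1) u = A (- 1 - int r) u"
  by (simp add: div_deriv_def flip: binomial_gbinomial)

text \<open>At b = -1 the term of \<open>dd\<close> that raises b falls into the quadrant and
  vanishes, so there \<open>dd\<close> only shifts a. In terms of series this is setting w =
  0.\<close>

lemma dd_pow_vanish_quadrant:
  assumes "\<And>a b. a \<ge> 0 \<Longrightarrow> b \<ge> 0 \<Longrightarrow> F a b = 0"
  shows "a \<ge> 0 \<Longrightarrow> b \<ge> 0 \<Longrightarrow> (dd ^^ i) F a b = 0"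
    and "a \<ge> 0 \<Longrightarrow> (dd ^^ i) F a (-1) = F (a + int i) (-1)"
proof -
  have *: "(dd ^^ i) F a b = 0" if "a \<ge> 0" "b \<ge> 0" for i a b
    using that assms by (induction i arbitrary: a b) (simp_all add: dd_pow_Suc del: funpow.simps)
  then show "a \<ge> 0 \<Longrightarrow> b \<ge> 0 \<Longrightarrow> (dd ^^ i) F a b = 0" .
  show "a \<ge> 0 \<Longrightarrow> (dd ^^ i) F a (-1) = F (a + int i) (-1)"
  proof (induction i arbitrary: a)
    case (Suc i)
    then show ?case using *[of a 0 i] by (simp add: dd_pow_Suc algebra_simps del: funpow.simps)
  qed simp
qed

lemma nprod_vacuum:
  assumes "field_like A" "field_like B" "creative A" "creative B"
  shows "creative (nprod i A B)" "nprod i A B (-1) 1 = A (int i) (B (-1) 1)"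
proof -
  have "bracket A B 1 a b = 0" if "a \<ge> 0" "b \<ge> 0" for a b
    using that assms by (simp add: bracket_def commutator_def creative_def lin_0 field_like_lin)
  note Q = dd_pow_vanish_quadrant[where F = "bracket A B 1", OF this]
  show "creative (nprod i A B)"
    unfolding creative_def nprod_def using Q(1) by simp
  have "bracket A B 1 (int i) (-1) = A (int i) (B (-1) 1)"
    using assms by (simp add: bracket_def commutator_def creative_def lin_0 field_like_lin)
  then show "nprod i A B (-1) 1 = A (int i) (B (-1) 1)"
    unfolding nprod_def using Q(2)[where a = 0 and i = i] by simp
qed

lemma Sum_any_single: "(\<And>j. j \<noteq> i \<Longrightarrow> g j = 0) \<Longrightarrow> Sum_any g = g i"
  using Sum_any.expand_superset[of "{i}" g] by auto

lemma normal_prod_vacuum: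
  assumes "field_like A" "field_like B" "creative A" "creative B"
  shows "creative (normal_prod A B)" "normal_prod A B (-1) 1 = A (-1) (B (-1) 1)"
proof -
  have Z: "(if j < 0 then A j (B (k - j - 1) 1) else B (k - j - 1) (A j 1)) = 0"
    if "k \<ge> 0 \<or> j \<noteq> -1 \<and> k = - 1" for j k
    using that assms by (auto simp: creative_def lin_0 field_like_lin)
  show "creative (normal_prod A B)"
    unfolding creative_def normal_prod_def using Z by simp
  have "normal_prod A B (-1) 1 =
      (\<lambda>j. if j < 0 then A j (B (- 1 - j - 1) 1) else B (- 1 - j - 1) (A j 1)) (-1)"
    unfolding normal_prod_def using Z by (intro Sum_any_single) blast
  then show "normal_prod A B (-1) 1 = A (-1) (B (-1) 1)" by simp
qed

lemma covariantD: "covariant T A \<Longrightarrow> T (A k u) = A k (T u) + of_int (- k) *\<^sub>V A (k - 1) u"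
  unfolding covariant_def commutator_def deriv_field_def by (simp only: diff_eq_eq add.commute)

lemma covariantI: "(\<And>k u. T (A k u) = A k (T u) + of_int (- k) *\<^sub>V A (k - 1) u) \<Longrightarrow> covariant T A"
  by (simp add: covariant_def commutator_def deriv_field_def)

lemma covariant_scl: "lin T \<Longrightarrow> covariant T A \<Longrightarrow> covariant T (\<lambda>k u. c *\<^sub>V A k u)"
  by (intro covariantI) (simp only: covariantD lin_scl VL.scale_right_distrib VL.scale_scale mult.commute)

lemma covariant_add: "lin T \<Longrightarrow> covariant T A \<Longrightarrow> covariant T B \<Longrightarrow> covariant T (\<lambda>k u. A k u + B k u)"
  by (intro covariantI) (simp only: covariantD lin_add VL.scale_right_distrib add_ac)

lemma covariant_deriv: "lin T \<Longrightarrow> covariant T A \<Longrightarrow> covariant T (deriv_field A)"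
  by (intro covariantI)
     (simp only: deriv_field_def covariantD lin_scl VL.scale_right_distrib VL.scale_scale mult.commute)

lemma covariant_div_deriv: "lin T \<Longrightarrow> covariant T A \<Longrightarrow> covariant T (div_deriv r A)"
  by (induction r) (simp_all add: div_deriv_0 div_deriv_Suc covariant_scl covariant_deriv)

lemma covariant_nprod:
  assumes T: "lin T" and A: "field_like A" "covariant T A" and B: "field_like B" "covariant T B"
  shows "covariant T (nprod i A B)"
proof (rule covariantI)
  \<comment> \<open>\<open>D\<close> is d/dz + d/dw on coefficients. It annihilates z - w and hence
    commutes with \<open>dd\<close>; at first index 0 only its d/dw part survives, which is the
    derivative of the product.\<close>
  define D :: "(int \<Rightarrow> int \<Rightarrow> VL) \<Rightarrow> int \<Rightarrow> int \<Rightarrow> VL"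
    where "D F = (\<lambda>a b. of_int (- a) *\<^sub>V F (a - 1) b + of_int (- b) *\<^sub>V F a (b - 1))" for F
  have D: "dd (D F) = D (dd F)" for F
    by (simp add: fun_eq_iff dd_def D_def VL.scale_left_diff_distrib VL.scale_left_distrib
        VL.scale_right_diff_distrib algebra_simps)
  have Dn: "(dd ^^ n) (D F) = D ((dd ^^ n) F)" for n F
    by (induction n) (simp_all add: D)
  fix k u
  have "(\<lambda>a b. T (bracket A B u a b)) = bracket A B (T u) + D (bracket A B u)"
    by (simp add: fun_eq_iff bracket_def commutator_def D_def lin_diff[OF T] covariantD[OF A(2)]
        covariantD[OF B(2)] lin_add lin_diff lin_scl lin_minus field_like_lin A B VL.scale_right_diff_distrib
        algebra_simps)
  then have "(dd ^^ i) (\<lambda>a b. T (bracket A B u a b)) 0 k = (dd ^^ i) (bracket A B (T u) + D (bracket A B u)) 0 k"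
    by (simp only:)
  then show "T (nprod i A B k u) = nprod i A B k (T u) + of_int (- k) *\<^sub>V nprod i A B (k - 1) u"
    unfolding nprod_def dd_pow_lin[OF T] dd_pow_add Dn by (simp add: D_def)
qed

lemma covariant_normal_prod:
  assumes T: "lin T" and A: "field_like A" "covariant T A" and B: "field_like B" "covariant T B"
  shows "covariant T (normal_prod A B)"
proof (rule covariantI)
  fix k u
  define t where "t u k j = (if j < 0 then A j (B (k - j - 1) u) else B (k - j - 1) (A j u))" for u k j
  have NP: "normal_prod A B k v = Sum_any (t v k)" for v k
    by (simp add: normal_prod_def t_def)
  have fin: "finite {j. t v k j \<noteq> 0}" for v k
    unfolding t_def by (rule normal_prod_finite[OF A(1) B(1)])
  \<comment> \<open>\<open>g\<close> and \<open>h\<close> come from the derivative hitting A and B.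
    The former shifts the summation index by one, and its coefficient is 0 where j crosses from one
    order of the factors to the other; after shifting back, the coefficients -(j+1) and -(k-j-1) add
    up to -k.\<close>
  define g where "g j = of_int (- (j + 1)) *\<^sub>V t u (k - 1) j" for j
  define h where "h j = of_int (- (k - j - 1)) *\<^sub>V t u (k - 1) j" for j
  have gh: "g j + h j = of_int (- k) *\<^sub>V t u (k - 1) j" for j
    by (simp add: g_def h_def flip: VL.scale_left_distrib)
  have fg: "finite {j. g j \<noteq> 0}" and fh: "finite {j. h j \<noteq> 0}"
    using fin[of u "k - 1"] by (auto simp: g_def h_def elim!: rev_finite_subset)
  have fg': "finite {j. g (j + (-1)) \<noteq> 0}"
    by (rule finite_subset[of _ "(\<lambda>j. j + 1) ` {j. g j \<noteq> 0}"])
       (use fg in \<open>force simp: image_iff\<close>)+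
  have e: "T (t u k j) = t (T u) k j + (g (j + (-1)) + h j)" for j
  proof -
    consider "j < 0" | "j = 0" | "j > 0" by linarith
    then show ?thesis
      by cases (simp_all add: t_def g_def h_def covariantD[OF A(2)] covariantD[OF B(2)] lin_add lin_diff lin_scl lin_minus
          field_like_lin A B algebra_simps)
  qed
  have "T (normal_prod A B k u) = Sum_any (\<lambda>j. T (t u k j))"
    unfolding NP by (rule lin_Sum_any[OF T fin])
  also have "\<dots> = Sum_any (t (T u) k) + Sum_any (\<lambda>j. g (j + (-1)) + h j)"
    unfolding e by (intro Sum_any.distrib fin finite_support_add fg' fh)
  also have "Sum_any (\<lambda>j. g (j + (-1)) + h j) = Sum_any g + Sum_any h"
    unfolding Sum_any.distrib[OF fg' fh] Sum_any_shift ..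
  also have "\<dots> = Sum_any (\<lambda>j. of_int (- k) *\<^sub>V t u (k - 1) j)"
    unfolding gh[symmetric] by (rule Sum_any.distrib[OF fg fh, symmetric])
  also have "\<dots> = of_int (- k) *\<^sub>V normal_prod A B (k - 1) u"
    unfolding NP by (rule lin_Sum_any[OF lin_scale[OF lin_id] fin, symmetric])
  finally show "T (normal_prod A B k u) = normal_prod A B k (T u) + of_int (- k) *\<^sub>V normal_prod A B (k - 1) u"
    unfolding NP .
qed

text \<open>On the vacuum covariance reads T A_k 1 = -k A_{k-1} 1, so vanishing spreads from mode -1
  to all lower ones.\<close>

lemma covariant_vacuum_modes:
  assumes "lin T" "T 1 = 0" "covariant T A" "field_like A" "creative A" "A (-1) 1 = 0"
  shows "A k 1 = 0"
proof -
  have "A (- 1 - int n) 1 = 0" for n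
  proof (induction n)
    case (Suc n)
    have "of_int (- (- 1 - int n)) *\<^sub>V A (- 1 - int n - 1) 1 = 0"
      using covariantD[OF assms(3), of "- 1 - int n" 1]
      by (simp only: Suc lin_0[OF assms(1)] assms(2) lin_0[OF field_like_lin[OF assms(4)]] add_0_left)
    moreover have "(of_int (- (- 1 - int n)) :: complex) \<noteq> 0"
      unfolding of_int_eq_0_iff by linarith
    ultimately have "A (- 1 - int n - 1) 1 = 0" by (simp only: VL.scale_eq_0_iff simp_thms)
    then show ?case by (simp add: algebra_simps)
  qed (use assms in simp)
  note * = this[of "nat (- 1 - k)"]
  show ?thesis
  proof (cases "k \<ge> 0")
    case True
    then show ?thesis using assms(5) by (simp add: creative_def)
  next
    case False
    then have "- 1 - int (nat (- 1 - k)) = k" by simp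
    then show ?thesis using * by simp
  qed
qed

text \<open>As D(z) kills the vacuum, [D(z), B(w)]1 = D(z)B(w)1, which is a power series in w.
  Locality and w = 0 then give z^N D(z) B_{-1} 1 = 0.\<close>

lemma Goddard_vanishing:
  assumes "field_like D" "\<And>k. D k 1 = 0" "field_like B" "creative B" "local_to D B"
  shows "D m (B (-1) 1) = 0"
proof -
  obtain N where N: "\<And>u. (dd ^^ N) (bracket D B u) = 0"
    using assms(5) by (auto simp: local_to_def)
  \<comment> \<open>Shifted so that N applications of \<open>dd\<close> at first index 0 arrive
    exactly at mode m.\<close>
  define F where "F a b = bracket D B 1 (a + (m - int N)) b" for a b
  have sh: "(dd ^^ n) (\<lambda>a b. G (a + c) b) = (\<lambda>a b. (dd ^^ n) G (a + c) b)" for n c and G :: "int \<Rightarrow> int \<Rightarrow> VL"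
    by (induction n) (simp_all add: fun_eq_iff dd_def algebra_simps)
  have "F a b = D (a + (m - int N)) (B b 1)" for a b
    by (simp add: F_def bracket_def commutator_def assms(2) lin_0[OF field_like_lin[OF assms(3)]])
  moreover have "F a b = 0" if "a \<ge> 0" "b \<ge> 0" for a b
    using that assms(4) lin_0[OF field_like_lin[OF assms(1)]] by (simp add: calculation creative_def)
  note dd_pow_vanish_quadrant(2)[where F = F and a = 0 and i = N, OF this]
  moreover have "(dd ^^ N) F = 0"
    unfolding F_def[abs_def] sh N by (simp add: fun_eq_iff)
  ultimately show ?thesis by simp
qed

section \<open>Exponentials of commuting operators\<close>

lemma sum_triangle_swap:
  fixes f :: "nat \<Rightarrow> nat \<Rightarrow> 'a::comm_monoid_add"
  shows "(\<Sum>i\<le>k. \<Sum>l\<le>k - i. f i l) = (\<Sum>l\<le>k. \<Sum>i\<le>k - l. f i l)"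
proof -
  have "(\<Sum>i\<le>k. \<Sum>l\<le>k - i. f i l) = (\<Sum>i\<le>k. \<Sum>l | l \<in> {..k} \<and> i + l \<le> k. f i l)"
    by (intro sum.cong) auto
  also have "\<dots> = (\<Sum>l\<le>k. \<Sum>i | i \<in> {..k} \<and> i + l \<le> k. f i l)"
    by (rule sum.swap_restrict) auto
  also have "\<dots> = (\<Sum>l\<le>k. \<Sum>i\<le>k - l. f i l)"
    by (intro sum.cong) auto
  finally show ?thesis .
qed

context
  fixes A :: "nat \<Rightarrow> VL \<Rightarrow> VL"
  assumes linA: "\<And>i. lin (A i)" and commA: "\<And>i j u. A i (A j u) = A j (A i u)"
    and A0: "\<And>u. A 0 u = 0"
begin

lemma op_pow_high: "k < j \<Longrightarrow> op_pow A j k u = 0"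
proof (induction j arbitrary: k)
  case (Suc j)
  have "A i (op_pow A j (k - i) u) = 0" if "i \<le> k" for i
    using Suc that A0 lin_0[OF linA] by (cases "i = 0") auto
  then show ?case by simp
qed simp

text \<open>The coefficient form of x d/dx A(x)^(j+1) = (j+1) x A'(x) A(x)^j, valid because the
  coefficients of A(x) commute.\<close>

lemma op_pow_derivative:
  "of_nat k *\<^sub>V op_pow A (Suc j) k u = of_nat (Suc j) *\<^sub>V (\<Sum>i\<le>k. of_nat i *\<^sub>V A i (op_pow A j (k - i) u))"
proof (induction j arbitrary: k)
  case 0
  have "of_nat k *\<^sub>V A i (op_pow A 0 (k - i) u) = of_nat i *\<^sub>V A i (op_pow A 0 (k - i) u)" if "i \<le> k" for i
    using that lin_0[OF linA] by (cases "i = k") auto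
  then have "(\<Sum>i\<le>k. of_nat k *\<^sub>V A i (op_pow A 0 (k - i) u)) = (\<Sum>i\<le>k. of_nat i *\<^sub>V A i (op_pow A 0 (k - i) u))"
    by (intro sum.cong refl) (simp only: atMost_iff)
  then show ?case by (simp only: VL.scale_sum_right op_pow.simps(2) of_nat_Suc of_nat_0 add_0_right VL.scale_one)
next
  case (Suc j)
  have "of_nat k *\<^sub>V op_pow A (Suc (Suc j)) k u
      = (\<Sum>i\<le>k. (of_nat i + of_nat (k - i)) *\<^sub>V A i (op_pow A (Suc j) (k - i) u))"
    by (simp add: VL.scale_sum_right of_nat_diff)
  also have "\<dots> = (\<Sum>i\<le>k. of_nat i *\<^sub>V A i (op_pow A (Suc j) (k - i) u))
      + (\<Sum>i\<le>k. A i (of_nat (k - i) *\<^sub>V op_pow A (Suc j) (k - i) u))"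
    by (simp only: VL.scale_left_distrib sum.distrib lin_scl[OF linA])
  also have "(\<Sum>i\<le>k. A i (of_nat (k - i) *\<^sub>V op_pow A (Suc j) (k - i) u))
     = of_nat (Suc j) *\<^sub>V (\<Sum>i\<le>k. \<Sum>l\<le>k - i. of_nat l *\<^sub>V A l (A i (op_pow A j (k - i - l) u)))"
    unfolding Suc.IH by (simp only: lin_scl[OF linA] lin_sum[OF linA] commA VL.scale_sum_right)
  also have "(\<Sum>i\<le>k. \<Sum>l\<le>k - i. of_nat l *\<^sub>V A l (A i (op_pow A j (k - i - l) u)))
     = (\<Sum>l\<le>k. of_nat l *\<^sub>V A l (op_pow A (Suc j) (k - l) u))"
    by (subst sum_triangle_swap) (simp add: lin_sum[OF linA] VL.scale_sum_right add.commute)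
  finally show ?case
    by (simp only: of_nat_Suc[of "Suc j"] VL.scale_left_distrib VL.scale_one)
qed

lemma op_exp_0: "op_exp A 0 u = u"
  by (simp add: op_exp_def)

text \<open>The coefficients of x d/dx exp A(x) = x A'(x) exp A(x). Most later facts about
  exponentials are inductions over this recursion, where the factor k is cancelled at the
  end.\<close>

lemma op_exp_rec:
  "of_nat k *\<^sub>V op_exp A k u = (\<Sum>i\<le>k. of_nat i *\<^sub>V A i (op_exp A (k - i) u))"
proof (cases k)
  case (Suc k')
  have E: "op_exp A l u = (\<Sum>j\<le>m. (1 / fact j) *\<^sub>V op_pow A j l u)" if "l \<le> m" for l m
    unfolding op_exp_def using that
    by (intro sum.mono_neutral_left) (auto simp: op_pow_high)
  have "of_nat k *\<^sub>V op_exp A k u = (\<Sum>j\<le>k. (1 / fact j) *\<^sub>V of_nat k *\<^sub>V op_pow A j k u)"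
    unfolding op_exp_def VL.scale_sum_right by (simp only: VL.scale_left_commute)
  also have "\<dots> = (\<Sum>j\<le>k'. (1 / fact (Suc j)) *\<^sub>V of_nat k *\<^sub>V op_pow A (Suc j) k u)"
    unfolding Suc by (subst sum.atMost_Suc_shift) simp
  also have "\<dots> = (\<Sum>j\<le>k'. \<Sum>i\<le>k. (1 / fact j) *\<^sub>V of_nat i *\<^sub>V A i (op_pow A j (k - i) u))"
    by (simp only: op_pow_derivative VL.scale_scale VL.scale_sum_right)
       (simp add: field_simps del: of_nat_Suc)
  also have "\<dots> = (\<Sum>i\<le>k. of_nat i *\<^sub>V A i (\<Sum>j\<le>k'. (1 / fact j) *\<^sub>V op_pow A j (k - i) u))"
    by (subst sum.swap) (simp add: lin_sum[OF linA] VL.scale_sum_right lin_scl[OF linA] VL.scale_left_commute mult.commute)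
  also have "\<dots> = (\<Sum>i\<le>k. of_nat i *\<^sub>V A i (op_exp A (k - i) u))"
  proof (intro sum.cong refl)
    fix i
    show "of_nat i *\<^sub>V A i (\<Sum>j\<le>k'. (1 / fact j) *\<^sub>V op_pow A j (k - i) u)
      = of_nat i *\<^sub>V A i (op_exp A (k - i) u)"
      using Suc E[of "k - i" k'] by (cases "i = 0") simp_all
  qed
  finally show ?thesis .
qed (simp add: A0)

lemma lin_op_exp: "lin (op_exp A k)"
proof -
  have "lin (\<lambda>u. op_pow A j k u)" for j k
  proof (induction j arbitrary: k)
    case (Suc j)
    show ?case unfolding op_pow.simps by (intro lin_big_sum lin_compose[OF linA Suc])
  qed (auto simp: lin_def)
  then show ?thesis unfolding op_exp_def[abs_def] by (intro lin_big_sum lin_scale)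
qed

text \<open>If [D, A(x)] = c x^r, then [D, exp A(x)] = c x^r exp A(x). In the induction the weights
  k - r, from the shorter exponential, and r, from the contraction, add up to k.\<close>

lemma op_exp_commute:
  assumes D: "lin D" and c: "\<And>i u. D (A i u) = A i (D u) + (if i = r then c else 0) *\<^sub>V u" and "r > 0"
  shows "D (op_exp A k u) = op_exp A k (D u) + (if r \<le> k then c *\<^sub>V op_exp A (k - r) u else 0)"
proof (induction k rule: less_induct)
  case (less k)
  show ?case
  proof (cases "k = 0")
    case True
    then show ?thesis using \<open>r > 0\<close> by (simp add: op_exp_0)
  next
    case False
    let ?E = "\<lambda>i u. op_exp A (k - i) u"
    have step: "of_nat i *\<^sub>V D (A i (?E i u)) = of_nat i *\<^sub>V A i (?E i (D u))
        + (if i + r \<le> k then c *\<^sub>V of_nat i *\<^sub>V A i (op_exp A (k - r - i) u) else 0)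
        + (if i = r then (of_nat r * c) *\<^sub>V ?E r u else 0)" if "i \<le> k" for i
    proof (cases "i = 0")
      case True
      then show ?thesis using \<open>r > 0\<close> lin_0[OF D] by (simp add: A0)
    next
      case f: False
      have "D (?E i u) = ?E i (D u) + (if r \<le> k - i then c *\<^sub>V op_exp A (k - i - r) u else 0)"
        using less[of "k - i"] f False by simp
      moreover have "r \<le> k - i \<longleftrightarrow> i + r \<le> k" "k - i - r = k - r - i" using that by auto
      ultimately show ?thesis
        by (auto simp: c lin_add[OF linA] lin_scl[OF linA] lin_0[OF linA] VL.scale_right_distrib VL.scale_left_commute mult.commute)
    qed
    have "of_nat k *\<^sub>V D (op_exp A k u) = (\<Sum>i\<le>k. of_nat i *\<^sub>V D (A i (?E i u)))"
      by (simp only: lin_scl[OF D, symmetric] lin_sum[OF D, symmetric] op_exp_rec)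
    also have "\<dots> = (\<Sum>i\<le>k. of_nat i *\<^sub>V A i (?E i (D u)))
       + (\<Sum>i\<le>k. if i + r \<le> k then c *\<^sub>V of_nat i *\<^sub>V A i (op_exp A (k - r - i) u) else 0)
       + (\<Sum>i\<le>k. if i = r then (of_nat r * c) *\<^sub>V ?E r u else 0)"
      using step by (simp add: sum.distrib)
    also have "(\<Sum>i\<le>k. of_nat i *\<^sub>V A i (?E i (D u))) = of_nat k *\<^sub>V op_exp A k (D u)"
      by (simp only: op_exp_rec)
    also have "(\<Sum>i\<le>k. if i = r then (of_nat r * c) *\<^sub>V ?E r u else 0)
      = (if r \<le> k then (of_nat r * c) *\<^sub>V ?E r u else 0)"
      by (simp add: sum.delta)
    also have "(\<Sum>i\<le>k. if i + r \<le> k then c *\<^sub>V of_nat i *\<^sub>V A i (op_exp A (k - r - i) u) else 0)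
      = (if r \<le> k then c *\<^sub>V of_nat (k - r) *\<^sub>V ?E r u else 0)"
    proof (cases "r \<le> k")
      case True
      have "(\<Sum>i\<le>k. if i + r \<le> k then c *\<^sub>V of_nat i *\<^sub>V A i (op_exp A (k - r - i) u) else 0)
        = (\<Sum>i\<le>k - r. c *\<^sub>V of_nat i *\<^sub>V A i (op_exp A (k - r - i) u))"
        using True by (intro sum.mono_neutral_cong_right) auto
      then show ?thesis using True by (simp only: VL.scale_sum_right[symmetric] op_exp_rec if_True)
    next
      case False
      then show ?thesis by (auto intro!: sum.neutral)
    qed
    also have "of_nat k *\<^sub>V op_exp A k (D u) + (if r \<le> k then c *\<^sub>V of_nat (k - r) *\<^sub>V ?E r u else 0)
       + (if r \<le> k then (of_nat r * c) *\<^sub>V ?E r u else 0)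
       = of_nat k *\<^sub>V (op_exp A k (D u) + (if r \<le> k then c *\<^sub>V op_exp A (k - r) u else 0))"
      by (simp add: of_nat_diff VL.scale_right_distrib algebra_simps flip: VL.scale_left_distrib)
    finally show ?thesis using False by simp
  qed
qed

end

text \<open>The sign \<open>s\<close> covers both exponentials: 1 gives the exponent of
  \<open>exp_minus\<close>, -1 that of \<open>exp_plus\<close>.\<close>

definition heis_scaled :: "cartan \<Rightarrow> int \<Rightarrow> nat \<Rightarrow> VL \<Rightarrow> VL" where
  "heis_scaled h s n u = (if n = 0 then 0 else (of_int s / of_nat n) *\<^sub>V heis h (- s * int n) u)"

lemma exp_minus_eq: "exp_minus a = op_exp (heis_scaled (lat_emb a) 1)"
  and exp_plus_eq: "exp_plus a = op_exp (heis_scaled (lat_emb a) (-1))"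
proof -
  have "(\<lambda>n u. if n = 0 then 0 else (1 / of_nat n) *\<^sub>V heis (lat_emb a) (- int n) u) = heis_scaled (lat_emb a) 1"
    "(\<lambda>n u. if n = 0 then 0 else (- 1 / of_nat n) *\<^sub>V heis (lat_emb a) (int n) u) = heis_scaled (lat_emb a) (-1)"
    by (auto simp: heis_scaled_def fun_eq_iff)
  then show "exp_minus a = op_exp (heis_scaled (lat_emb a) 1)" "exp_plus a = op_exp (heis_scaled (lat_emb a) (-1))"
    by (simp_all only: exp_minus_def exp_plus_def)
qed

lemma heis_scaled_props:
  assumes "s = 1 \<or> s = -1"
  shows "lin (heis_scaled h s i)" "heis_scaled h s 0 u = 0"
    "heis_scaled h s i (heis_scaled h s j u) = heis_scaled h s j (heis_scaled h s i u)"
proof -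
  show "lin (heis_scaled h s i)"
    using lin_scale[OF lin_heis] lin_zero by (cases "i = 0") (simp_all add: heis_scaled_def[abs_def])
  show "heis_scaled h s 0 u = 0" by (simp add: heis_scaled_def)
  have "- s * int i + - s * int j \<noteq> 0" if "i > 0" "j > 0" using assms that by auto
  then show "heis_scaled h s i (heis_scaled h s j u) = heis_scaled h s j (heis_scaled h s i u)"
    using heis_commute[of h "- s * int i" h "- s * int j" u]
    by (simp add: heis_scaled_def lin_scl[OF lin_heis] lin_0[OF lin_heis] mult.commute)
qed

lemma heis_heis_scaled:
  assumes "s = 1 \<or> s = -1"
  shows "heis h k (heis_scaled h' s i u) = heis_scaled h' s i (heis h k u)
    + (if i > 0 \<and> int i = s * k then form h h' else 0) *\<^sub>V u"
proof (cases "i = 0")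
  case True
  then show ?thesis using lin_0[OF lin_heis] by (simp add: heis_scaled_def)
qed (use assms heis_commute[of h k h' "- s * int i" u] in
  \<open>auto simp: heis_scaled_def lin_scl[OF lin_heis] VL.scale_right_distrib\<close>)

lemma lin_exp_minus: "lin (exp_minus a k)" and lin_exp_plus: "lin (exp_plus a k)"
  unfolding exp_minus_eq exp_plus_eq by (intro lin_op_exp; simp add: heis_scaled_props)+

lemma exp_minus_0: "exp_minus a 0 u = u" and exp_plus_0: "exp_plus a 0 u = u"
  unfolding exp_minus_eq exp_plus_eq by (intro op_exp_0; simp add: heis_scaled_props)+

lemma exp_minus_rec:
  "of_nat k *\<^sub>V exp_minus a k u = (\<Sum>i=1..k. heis (lat_emb a) (- int i) (exp_minus a (k - i) u))"
proof -
  have "of_nat k *\<^sub>V exp_minus a k u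
      = (\<Sum>i\<le>k. of_nat i *\<^sub>V heis_scaled (lat_emb a) 1 i (exp_minus a (k - i) u))"
    unfolding exp_minus_eq by (intro op_exp_rec; simp add: heis_scaled_props)
  also have "\<dots> = (\<Sum>i=1..k. heis (lat_emb a) (- int i) (exp_minus a (k - i) u))"
    by (intro sum.mono_neutral_cong_right) (auto simp: heis_scaled_def)
  finally show ?thesis .
qed

lemma exp_plus_rec:
  "of_nat k *\<^sub>V exp_plus a k u = (\<Sum>i=1..k. - heis (lat_emb a) (int i) (exp_plus a (k - i) u))"
proof -
  have "of_nat k *\<^sub>V exp_plus a k u
      = (\<Sum>i\<le>k. of_nat i *\<^sub>V heis_scaled (lat_emb a) (-1) i (exp_plus a (k - i) u))"
    unfolding exp_plus_eq by (intro op_exp_rec; simp add: heis_scaled_props)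
  also have "\<dots> = (\<Sum>i=1..k. - heis (lat_emb a) (int i) (exp_plus a (k - i) u))"
    by (intro sum.mono_neutral_cong_right) (auto simp: heis_scaled_def)
  finally show ?thesis .
qed

lemma heis_exp_scaled:
  assumes s: "s = 1 \<or> s = -1"
  shows "heis h k (op_exp (heis_scaled h' s) n u) = op_exp (heis_scaled h' s) n (heis h k u)
    + (if 0 < s * k \<and> s * k \<le> int n then form h h' *\<^sub>V op_exp (heis_scaled h' s) (n - nat (s * k)) u else 0)"
proof (cases "s * k > 0")
  case True
  then have "heis h k (heis_scaled h' s i u) = heis_scaled h' s i (heis h k u)
    + (if i = nat (s * k) then form h h' else 0) *\<^sub>V u" for i u
    using heis_heis_scaled[OF s, of h k h' i u] by auto
  then have "heis h k (op_exp (heis_scaled h' s) n u) = op_exp (heis_scaled h' s) n (heis h k u)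
    + (if nat (s * k) \<le> n then form h h' *\<^sub>V op_exp (heis_scaled h' s) (n - nat (s * k)) u else 0)"
    using True by (intro op_exp_commute lin_heis; simp add: heis_scaled_props[OF s])
  then show ?thesis using True by (simp add: nat_le_iff)
next
  case False
  then have "heis h k (heis_scaled h' s i u) = heis_scaled h' s i (heis h k u)
    + (if i = 1 then 0 else 0) *\<^sub>V u" for i u
    using heis_heis_scaled[OF s, of h k h' i u] by auto
  then have "heis h k (op_exp (heis_scaled h' s) n u) = op_exp (heis_scaled h' s) n (heis h k u)
    + (if 1 \<le> n then 0 *\<^sub>V op_exp (heis_scaled h' s) (n - 1) u else 0)"
    by (intro op_exp_commute lin_heis; simp add: heis_scaled_props[OF s])
  then show ?thesis using False by simp
qed

lemma heis_exp_minus: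
  "heis h k (exp_minus a n u) = exp_minus a n (heis h k u)
    + (if 0 < k \<and> k \<le> int n then form h (lat_emb a) *\<^sub>V exp_minus a (n - nat k) u else 0)"
  unfolding exp_minus_eq using heis_exp_scaled[of 1 h k "lat_emb a" n u] by simp

lemma heis_exp_plus:
  "heis h k (exp_plus a n u) = exp_plus a n (heis h k u)
    + (if k < 0 \<and> - k \<le> int n then form h (lat_emb a) *\<^sub>V exp_plus a (n - nat (- k)) u else 0)"
  unfolding exp_plus_eq using heis_exp_scaled[of "-1" h k "lat_emb a" n u] by simp

lemma VL_heis_induct [case_names evec heis add scl]:
  assumes "\<And>\<gamma>. P (evec \<gamma>)" and "\<And>h k u. k < 0 \<Longrightarrow> P u \<Longrightarrow> P (heis h k u)"
    and "\<And>u v. P u \<Longrightarrow> P v \<Longrightarrow> P (u + v)" "\<And>c u. P u \<Longrightarrow> P (c *\<^sub>V u)"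
  shows "P v"
proof (induction v rule: VL_induct)
  case (creat h n u)
  then show ?case using assms(2)[of "- int n - 1" u h] by (simp add: heis_neg)
qed (use assms in auto)

lemma exp_plus_evec: "exp_plus a n (evec \<gamma>) = (if n = 0 then evec \<gamma> else 0)"
proof (induction n rule: less_induct)
  case (less n)
  show ?case
  proof (cases "n = 0")
    case False
    have "of_nat n *\<^sub>V exp_plus a n (evec \<gamma>) = 0"
      unfolding exp_plus_rec
    proof (intro sum.neutral ballI)
      fix i assume "i \<in> {1..n}"
      then show "- heis (lat_emb a) (int i) (exp_plus a (n - i) (evec \<gamma>)) = 0"
        using less[of "n - i"] lin_0[OF lin_heis] by (auto simp: heis_pos_evec)
    qed
    then show ?thesis using False by simp
  qed (simp add: exp_plus_0)
qed

lemma exp_plus_eventually_0: "\<exists>Q. \<forall>q\<ge>Q. exp_plus a q u = 0"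
proof (induction u rule: VL_heis_induct)
  case (evec \<gamma>)
  then show ?case by (intro exI[of _ 1]) (simp add: exp_plus_evec)
next
  case (heis h k u)
  then obtain Q where Q: "\<And>q. q \<ge> Q \<Longrightarrow> exp_plus a q u = 0" by blast
  have "exp_plus a q (heis h k u) = 0" if "q \<ge> Q + nat (- k)" for q
    using heis_exp_plus[of h k a q u] Q[of q] Q[of "q - nat (- k)"] that heis(1) lin_0[OF lin_heis]
    by (auto split: if_splits)
  then show ?case by blast
next
  case (add u v)
  then obtain P Q where "\<And>q. q \<ge> P \<Longrightarrow> exp_plus a q u = 0" "\<And>q. q \<ge> Q \<Longrightarrow> exp_plus a q v = 0" by blast
  then show ?case by (intro exI[of _ "max P Q"]) (simp add: lin_add[OF lin_exp_plus])
next
  case (scl c u)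
  then show ?case by (auto simp: lin_scl[OF lin_exp_plus])
qed

section \<open>The fields of the lattice\<close>

text \<open>The subspace M(1) tensor e^gamma, on which z^{alpha(0)} is a single power of z. There
  the coefficient of Y(e^alpha, z) is one sum over q that holds for arbitrary vectors, not only for
  basis vectors.\<close>

definition sector :: "lat \<Rightarrow> VL set" where
  "sector \<gamma> = {u. \<forall>b\<in>keys u. snd b = \<gamma>}"

lemma sector_0: "0 \<in> sector \<gamma>"
  and sector_bvec: "bvec b \<in> sector (snd b)"
  by (simp_all add: sector_def bvec_def)

lemma sector_add: "u \<in> sector \<gamma> \<Longrightarrow> v \<in> sector \<gamma> \<Longrightarrow> u + v \<in> sector \<gamma>"
  unfolding sector_def using keys_add[of u v] by blast

lemma sector_scl: "u \<in> sector \<gamma> \<Longrightarrow> c *\<^sub>V u \<in> sector \<gamma>"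
  unfolding sector_def by (auto simp: in_keys_iff lookup_scl)

lemma sector_sum: "(\<And>i. i \<in> S \<Longrightarrow> f i \<in> sector \<gamma>) \<Longrightarrow> (\<Sum>i\<in>S. f i) \<in> sector \<gamma>"
  by (induction S rule: infinite_finite_induct) (simp_all add: sector_0 sector_add)

lemma sector_heis:
  assumes "u \<in> sector \<gamma>" shows "heis h k u \<in> sector \<gamma>"
proof -
  have "heis_basis h k b \<in> sector (snd b)" for b
  proof -
    obtain M1 M2 \<gamma> where b: "b = ((M1, M2), \<gamma>)" by (metis surj_pair)
    have s: "bvec (M, \<gamma>) \<in> sector \<gamma>" for M using sector_bvec[of "(M, \<gamma>)"] by simp
    show ?thesis
      unfolding b heis_basis_def creat_def Let_def
      by (auto simp: distrib_right scl_mult_left bvec_mult intro!: sector_add sector_scl s)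
  qed
  note * = this
  have "(\<Sum>b\<in>keys u. lookup u b *\<^sub>V heis_basis h k b) \<in> sector \<gamma>"
  proof (intro sector_sum sector_scl)
    fix b assume "b \<in> keys u"
    then have "snd b = \<gamma>" using assms by (simp add: sector_def)
    then show "heis_basis h k b \<in> sector \<gamma>" using *[of b] by simp
  qed
  then show ?thesis by (simp add: heis_def lin_ext_def)
qed

definition exp_term :: "lat \<Rightarrow> int \<Rightarrow> lat \<Rightarrow> nat \<Rightarrow> VL \<Rightarrow> VL" where
  "exp_term a n \<gamma> q u = (let p = int q - n - 1 - lat_form a \<gamma> in
     if p < 0 then 0 else exp_minus a (nat p) (exp_plus a q (evec a * u)))"

lemma lin_exp_term: "lin (exp_term a n \<gamma> q)"
proof (cases "int q - n - 1 - lat_form a \<gamma> < 0")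
  case False
  then show ?thesis
    using lin_compose[OF lin_exp_minus lin_compose[OF lin_exp_plus lin_times]]
    unfolding exp_term_def[abs_def] by (simp add: Let_def)
qed (simp add: exp_term_def[abs_def] Let_def lin_zero)

lemma exp_term_finite: "finite {q. exp_term a n \<gamma> q u \<noteq> 0}"
proof -
  obtain Q where Q: "\<And>q. q \<ge> Q \<Longrightarrow> exp_plus a q (evec a * u) = 0" using exp_plus_eventually_0 by blast
  have "exp_term a n \<gamma> q u = 0" if "q \<ge> Q" for q
    using Q[OF that] lin_0[OF lin_exp_minus] by (simp add: exp_term_def Let_def)
  then have "{q. exp_term a n \<gamma> q u \<noteq> 0} \<subseteq> {..<Q}" using linorder_not_less by blast
  then show ?thesis by (rule finite_subset) simp
qed

lemma lin_exp_field: "lin (exp_field a n)"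
  by (simp add: exp_field_def lin_lin_ext)

lemmas exp_field_lin = lin_add[OF lin_exp_field] lin_scl[OF lin_exp_field]

lemma exp_field_sector:
  assumes "u \<in> sector \<gamma>"
  shows "exp_field a n u = Sum_any (\<lambda>q. exp_term a n \<gamma> q u)"
proof -
  have L: "lin (\<lambda>u. Sum_any (\<lambda>q. exp_term a n \<gamma> q u))"
    by (rule lin_Sum_any_pointwise[OF lin_exp_term exp_term_finite])
  have "exp_field a n u = (\<Sum>b\<in>keys u. lookup u b *\<^sub>V Sum_any (\<lambda>q. exp_term a n \<gamma> q (bvec b)))"
    unfolding exp_field_def lin_ext_def
  proof (intro sum.cong refl)
    fix b assume "b \<in> keys u"
    then have "snd b = \<gamma>" using assms by (simp add: sector_def)
    then obtain M where "b = (M, \<gamma>)" by (cases b) auto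
    then show "lookup u b *\<^sub>V (case b of (M, \<gamma>) \<Rightarrow> Sum_any (\<lambda>q::nat.
       let p = int q - n - 1 - lat_form a \<gamma> in
       if p < 0 then 0
       else exp_minus a (nat p) (exp_plus a q (evec a * bvec (M, \<gamma>)))))
       = lookup u b *\<^sub>V Sum_any (\<lambda>q. exp_term a n \<gamma> q (bvec b))"
      by (simp add: exp_term_def)
  qed
  also have "\<dots> = Sum_any (\<lambda>q. exp_term a n \<gamma> q (\<Sum>b\<in>keys u. lookup u b *\<^sub>V bvec b))"
    unfolding lin_sum[OF L] lin_scl[OF L] ..
  finally show ?thesis by (simp only: VL_expand[symmetric])
qed

lemma exp_field_evec:
  "exp_field a n (evec \<gamma>) = (let p = - n - 1 - lat_form a \<gamma> in
     if p < 0 then 0 else exp_minus a (nat p) (evec (a + \<gamma>)))"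
proof -
  have "evec \<gamma> \<in> sector \<gamma>" using sector_bvec[of "(({#}, {#}), \<gamma>)"] by (simp add: evec_def)
  then have "exp_field a n (evec \<gamma>) = Sum_any (\<lambda>q. exp_term a n \<gamma> q (evec \<gamma>))"
    by (rule exp_field_sector)
  also have "\<dots> = exp_term a n \<gamma> 0 (evec \<gamma>)"
    using lin_0[OF lin_exp_minus] by (intro Sum_any_single) (simp add: exp_term_def evec_mult exp_plus_evec Let_def)
  finally show ?thesis by (simp add: exp_term_def exp_plus_0 evec_mult Let_def)
qed

lemma heis_evec_mult:
  "heis h k (evec a * u) = evec a * heis h k u + (if k = 0 then form h (lat_emb a) else 0) *\<^sub>V (evec a * u)"
proof (cases "k < 0")
  case True
  then show ?thesis by (simp add: heis_neg mult.left_commute)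
next
  case False
  then show ?thesis
  proof (induction u rule: VL_induct)
    case (evec \<gamma>)
    have "form h (lat_emb (a + \<gamma>)) = form h (lat_emb a) + form h (lat_emb \<gamma>)"
      by (simp add: form_def lat_emb_def algebra_simps)
    then show ?case using evec
      by (cases "k = 0") (simp_all add: evec_mult heis_0_evec heis_pos_evec scl_mult_right VL.scale_left_distrib)
  next
    case (creat h' n u)
    have e: "evec a * (creat h' n * u) = creat h' n * (evec a * u)" by (simp add: mult_ac)
    show ?case
    proof (cases "k = 0")
      case True
      show ?thesis unfolding True e heis_0_mult_creat using creat True
        by (simp add: distrib_left scl_mult_right mult.left_commute)
    next
      case f: False
      then have "k > 0" using creat by simp
      show ?thesis unfolding e heis_pos_mult_creat[OF \<open>k > 0\<close>] using creat f
        by (simp add: distrib_left scl_mult_right mult.left_commute)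
    qed
  qed (simp_all add: distrib_left heis_lin scl_mult_right
      VL.scale_right_distrib algebra_simps)
qed

lemma Sum_any_nat_shift:
  fixes g :: "nat \<Rightarrow> 'a::comm_monoid_add"
  shows "Sum_any (\<lambda>q. if q < r then 0 else g (q - r)) = Sum_any g"
proof -
  have e: "{q. (if q < r then 0 else g (q - r)) \<noteq> 0} = (\<lambda>q. q + r) ` {q. g q \<noteq> 0}"
    by (auto simp: image_iff split: if_splits intro!: exI[of _ "_ - r"])
  show ?thesis
    unfolding Sum_any.expand_set e by (subst sum.reindex) (auto intro: injI)
qed

text \<open>The relation [h(k), Y(e^a, z)] = <h, a> z^k Y(e^a, z). For k > 0 the contraction is with
  \<open>exp_minus\<close>, for k < 0 with \<open>exp_plus\<close>, and for k = 0 with e^a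
  itself.\<close>

lemma heis_exp_field:
  "heis h k (exp_field a n u) = exp_field a n (heis h k u) + form h (lat_emb a) *\<^sub>V exp_field a (n + k) u"
proof (induction u rule: VL_basis_induct)
  case (bvec b)
  define \<gamma> where "\<gamma> = snd b"
  define u where "u = bvec b"
  let ?c = "form h (lat_emb a)" and ?t = "exp_term a"
  have u: "u \<in> sector \<gamma>" and hu: "heis h k u \<in> sector \<gamma>"
    using sector_bvec[of b] sector_heis by (simp_all add: u_def \<gamma>_def)
  \<comment> \<open>Contraction with \<open>exp_plus\<close> lowers q by -k, so for k < 0 the extra
    terms are those of the mode n + k with q shifted.\<close>
  define g where "g q = (if k < 0 then (if q < nat (- k) then 0 else ?t (n + k) \<gamma> (q - nat (- k)) u)
      else ?t (n + k) \<gamma> q u)" for q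
  have G: "Sum_any g = Sum_any (\<lambda>q. ?t (n + k) \<gamma> q u)"
    unfolding g_def using Sum_any_nat_shift[of "nat (- k)" "\<lambda>q. ?t (n + k) \<gamma> q u"]
    by (cases "k < 0") simp_all
  have Gf: "finite {q. g q \<noteq> 0}"
  proof (cases "k < 0")
    case True
    have "{q. g q \<noteq> 0} \<subseteq> (\<lambda>q. q + nat (- k)) ` {q. ?t (n + k) \<gamma> q u \<noteq> 0}"
    proof
      fix q assume "q \<in> {q. g q \<noteq> 0}"
      then show "q \<in> (\<lambda>q. q + nat (- k)) ` {q. ?t (n + k) \<gamma> q u \<noteq> 0}"
        using True by (intro image_eqI[of _ _ "q - nat (- k)"]) (auto simp: g_def split: if_splits)
    qed
    then show ?thesis using exp_term_finite finite_subset by blast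
  qed (simp add: g_def exp_term_finite)
  have step: "heis h k (?t n \<gamma> q u) = ?t n \<gamma> q (heis h k u) + ?c *\<^sub>V g q" for q
  proof -
    have idx: "int (q - nat (- k)) - (n + k) - 1 - lat_form a \<gamma> = int q - n - 1 - lat_form a \<gamma>" if "k < 0" "\<not> q < nat (- k)"
      using that by auto
    have idx': "nat (int q - n - 1 - lat_form a \<gamma>) - nat k = nat (int q - (n + k) - 1 - lat_form a \<gamma>)" if "k > 0"
      using that by linarith
    show ?thesis
      apply (cases "k > 0")
      subgoal
        apply (simp add: exp_term_def g_def Let_def heis_exp_minus heis_exp_plus heis_evec_mult lin_0[OF lin_heis] lin_add[OF lin_exp_minus] lin_scl[OF lin_exp_minus])
        apply (auto simp: idx')
        done
      subgoal
        apply (cases "k = 0")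
        subgoal by (simp add: exp_term_def g_def Let_def heis_exp_minus heis_exp_plus heis_evec_mult lin_0[OF lin_heis] lin_add[OF lin_exp_minus] lin_scl[OF lin_exp_minus] lin_add[OF lin_exp_plus] lin_scl[OF lin_exp_plus])
        subgoal using idx
          by (auto simp: exp_term_def g_def Let_def heis_exp_minus heis_exp_plus heis_evec_mult lin_0[OF lin_heis] lin_add[OF lin_exp_minus] lin_scl[OF lin_exp_minus] lin_0[OF lin_exp_minus] not_less)
        done
      done
  qed
  have "heis h k (exp_field a n u) = Sum_any (\<lambda>q. heis h k (?t n \<gamma> q u))"
    unfolding exp_field_sector[OF u] by (rule lin_Sum_any[OF lin_heis exp_term_finite])
  also have "\<dots> = Sum_any (\<lambda>q. ?t n \<gamma> q (heis h k u)) + Sum_any (\<lambda>q. ?c *\<^sub>V g q)"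
    unfolding step by (intro Sum_any.distrib exp_term_finite finite_support_pull[OF lin_scale[OF lin_id]] Gf)
  also have "Sum_any (\<lambda>q. ?c *\<^sub>V g q) = ?c *\<^sub>V Sum_any g"
    using lin_Sum_any[OF lin_scale[OF lin_id] Gf] by simp
  finally show ?case
    by (simp only: G exp_field_sector[OF u, symmetric] exp_field_sector[OF hu, symmetric] u_def[symmetric])
qed (simp_all add: heis_lin exp_field_lin
     VL.scale_right_distrib VL.scale_left_commute mult.commute algebra_simps)

lemma field_like_heis: "field_like (heis h)"
  unfolding field_like_def using lin_heis heis_eventually_0 by metis

lemma field_like_exp_field: "field_like (exp_field a)"
  unfolding field_like_def
proof (intro conjI allI)
  show "lin (exp_field a k)" for k by (rule lin_exp_field)
  show "\<exists>K. \<forall>k\<ge>K. exp_field a k u = 0" for u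
  proof (induction u rule: VL_heis_induct)
    case (evec \<gamma>)
    show ?case by (intro exI[of _ "- lat_form a \<gamma>"]) (simp add: exp_field_evec Let_def)
  next
    case (heis h j u)
    then obtain K where K: "\<And>k. k \<ge> K \<Longrightarrow> exp_field a k u = 0" by blast
    have "exp_field a k (heis h j u) = 0" if "k \<ge> K - j" for k
      using heis_exp_field[of h j a k u] K[of k] K[of "k + j"] heis(1) that lin_0[OF lin_heis] by simp
    then show ?case by blast
  next
    case (add u v)
    then obtain P Q where "\<And>q. q \<ge> P \<Longrightarrow> exp_field a q u = 0" "\<And>q. q \<ge> Q \<Longrightarrow> exp_field a q v = 0" by blast
    then show ?case by (intro exI[of _ "max P Q"]) (simp add: lin_add[OF lin_exp_field])
  next
    case (scl c u)
    then show ?case by (auto simp: lin_scl[OF lin_exp_field])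
  qed
qed

lemma lat_form_0: "lat_form a 0 = 0" "lat_form 0 a = 0"
  by (simp_all add: lat_form_def)

lemma creative_heis: "creative (heis h)"
proof -
  have "heis h k (evec 0) = 0" if "k \<ge> 0" for k
    using that by (cases "k = 0") (simp_all add: heis_0_evec heis_pos_evec form_def lat_emb_def)
  then show ?thesis by (simp add: creative_def evec_0)
qed

lemma creative_exp_field: "creative (exp_field a)"
  and exp_field_vacuum: "exp_field a (-1) 1 = evec a"
  using exp_field_evec[of a _ 0] by (simp_all add: creative_def evec_0 lat_form_0 exp_minus_0)

lemma exp_field_zero: "exp_field 0 n u = (if n = -1 then u else 0)"
proof -
  have h0: "heis (lat_emb 0) k u = 0" for k u
    by (rule lin_eqI[OF lin_heis lin_zero])
       (auto simp: heis_def heis_basis_def lat_emb_def creat_def form_def Let_def)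
  have m: "exp_minus 0 k u = (if k = 0 then u else 0)" for k u
    using exp_minus_rec[of k 0 u] by (cases "k = 0") (simp_all add: exp_minus_0 h0)
  have c: "exp_field 0 n (heis h k u) = heis h k (exp_field 0 n u)" for h k u
    using heis_exp_field[of h k 0 n u] by (simp add: form_def lat_emb_def)
  show ?thesis
    by (induction u rule: VL_heis_induct)
       (auto simp: exp_field_evec Let_def lat_form_0 m c lin_0[OF lin_heis] exp_field_lin)
qed

section \<open>The translation operator\<close>

lemma heis_comb:
  assumes "h = (c * fst h1 + d * fst h2, c * snd h1 + d * snd h2)"
  shows "heis h k u = c *\<^sub>V heis h1 k u + d *\<^sub>V heis h2 k u"
proof -
  have f: "form h x = c * form h1 x + d * form h2 x" for x
    unfolding assms by (simp add: form_def algebra_simps)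
  have cr: "creat h n = c *\<^sub>V creat h1 n + d *\<^sub>V creat h2 n" for n
    unfolding assms by (simp add: creat_def VL.scale_left_distrib VL.scale_right_distrib)
  show ?thesis
  proof (rule lin_eqI[OF lin_heis lin_plus[OF lin_scale[OF lin_heis] lin_scale[OF lin_heis]]])
    fix b :: vidx
    obtain M1 M2 \<gamma> where b: "b = ((M1, M2), \<gamma>)" by (metis surj_pair)
    have "heis_basis h k b = c *\<^sub>V heis_basis h1 k b + d *\<^sub>V heis_basis h2 k b"
      unfolding b heis_basis_def
      by (simp add: cr f Let_def distrib_right scl_mult_left VL.scale_left_distrib VL.scale_right_distrib scl_mult_right algebra_simps)
    then show "heis h k (bvec b) = c *\<^sub>V heis h1 k (bvec b) + d *\<^sub>V heis h2 k (bvec b)"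
      by (simp add: heis_def)
  qed
qed

definition fw1 :: cartan where "fw1 = (2 / 3, 1 / 3)"
definition fw2 :: cartan where "fw2 = (1 / 3, 2 / 3)"

lemma heis_dual:
  "heis h k u = form (1, 0) h *\<^sub>V heis fw1 k u + form (0, 1) h *\<^sub>V heis fw2 k u"
  "heis h k u = form fw1 h *\<^sub>V heis (1, 0) k u + form fw2 h *\<^sub>V heis (0, 1) k u"
  by (rule heis_comb; simp add: form_def fw1_def fw2_def prod_eq_iff; simp add: field_simps)+

text \<open>In the normally ordered sum for L(-1) the terms k and -1-k agree after summing over the
  dual bases; this absorbs the factor 1/2 and leaves k >= 0.\<close>

definition tr_term :: "nat \<Rightarrow> VL \<Rightarrow> VL" where
  "tr_term k u = heis fw1 (- 1 - int k) (heis (1, 0) (int k) u) + heis fw2 (- 1 - int k) (heis (0, 1) (int k) u)"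

text \<open>\<open>L(-1)\<close> for the standard conformal vector; \<open>fw1, fw2\<close> is dual to \<open>\<alpha>\<^sub>1, \<alpha>\<^sub>2\<close>.\<close>

definition transl :: "VL \<Rightarrow> VL" where
  "transl u = Sum_any (\<lambda>k. tr_term k u)"

lemma lin_tr_term: "lin (tr_term k)"
  unfolding tr_term_def[abs_def] by (intro lin_plus lin_compose[OF lin_heis lin_heis])

lemma tr_term_finite: "finite {k. tr_term k u \<noteq> 0}"
proof -
  obtain K where K: "\<And>k h. k \<ge> K \<Longrightarrow> heis h k u = 0" using heis_eventually_0 by blast
  have "tr_term k u = 0" if "k \<ge> nat K" for k
    using K[of "int k"] that lin_0[OF lin_heis] by (simp add: tr_term_def)
  then have "{k. tr_term k u \<noteq> 0} \<subseteq> {..<nat K}" using linorder_not_less by blast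
  then show ?thesis by (rule finite_subset) simp
qed

lemma lin_transl: "lin transl"
  unfolding transl_def[abs_def] by (rule lin_Sum_any_pointwise[OF lin_tr_term tr_term_finite])

lemmas transl_lin = lin_add[OF lin_transl] lin_scl[OF lin_transl]

lemma covariant_heis: "covariant transl (heis h)"
proof (rule covariantI)
  fix n u
  \<comment> \<open>For n <= 0 the mode h(n) contracts with the annihilating factor of
    \<open>tr_term\<close>, at k = -n; for n >= 1 with the creating one, at k = n - 1. Duality of
    the bases turns either contraction into -n h(n-1).\<close>
  let ?a = "\<lambda>k::nat. (if k = nat (- n) \<and> n \<le> 0 then of_int (- n) *\<^sub>V heis h (n - 1) u else 0)"
  let ?b = "\<lambda>k::nat. (if k = nat (n - 1) \<and> n \<ge> 1 then of_int (- n) *\<^sub>V heis h (n - 1) u else 0)"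
  have e: "tr_term k (heis h n u) = heis h n (tr_term k u) + (?a k + ?b k)" for k
  proof -
    have 1: "heis h' (int k) (heis h n u) = heis h n (heis h' (int k) u) +
        (if n \<le> 0 \<and> k = nat (- n) then of_int (- n) * form h' h else 0) *\<^sub>V u" for h'
      using heis_commute[of h' "int k" h n u] by auto
    have 2: "heis h' (- 1 - int k) (heis h n v) = heis h n (heis h' (- 1 - int k) v) +
        (if n \<ge> 1 \<and> k = nat (n - 1) then of_int (- n) * form h' h else 0) *\<^sub>V v" for h' v
      using heis_commute[of h' "- 1 - int k" h n v] by auto
    have "tr_term k (heis h n u) = heis h n (tr_term k u)
      + (if n \<le> 0 \<and> k = nat (- n) then of_int (- n) *\<^sub>V (form (1, 0) h *\<^sub>V heis fw1 (- 1 - int k) u + form (0, 1) h *\<^sub>V heis fw2 (- 1 - int k) u) else 0)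
      + (if n \<ge> 1 \<and> k = nat (n - 1) then of_int (- n) *\<^sub>V (form fw1 h *\<^sub>V heis (1, 0) (int k) u + form fw2 h *\<^sub>V heis (0, 1) (int k) u) else 0)"
      unfolding tr_term_def 1 by (simp add: heis_lin 2 VL.scale_right_distrib)
    then show ?thesis
      by (auto simp add: heis_dual(1)[symmetric] heis_dual(2)[symmetric])
  qed
  have fa: "finite {k. ?a k \<noteq> 0}" by (rule finite_subset[of _ "{nat (- n)}"]) auto
  have fb: "finite {k. ?b k \<noteq> 0}" by (rule finite_subset[of _ "{nat (n - 1)}"]) auto
  have "transl (heis h n u) = Sum_any (\<lambda>k. heis h n (tr_term k u)) + (Sum_any ?a + Sum_any ?b)"
    unfolding transl_def e
    by (subst Sum_any.distrib[OF finite_support_pull[OF lin_heis tr_term_finite] finite_support_add[OF fa fb]])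
       (simp only: Sum_any.distrib[OF fa fb])
  also have "Sum_any (\<lambda>k. heis h n (tr_term k u)) = heis h n (transl u)"
    unfolding transl_def by (rule lin_Sum_any[OF lin_heis tr_term_finite, symmetric])
  also have "Sum_any ?a + Sum_any ?b = of_int (- n) *\<^sub>V heis h (n - 1) u"
    using Sum_any_single[of "nat (- n)" ?a] Sum_any_single[of "nat (n - 1)" ?b]
    by (cases "n \<le> 0") auto
  finally show "transl (heis h n u) = heis h n (transl u) + of_int (- n) *\<^sub>V heis h (n - 1) u" .
qed

lemma lat_form_sym: "lat_form a b = lat_form b a"
  by (simp add: lat_form_def)

text \<open>The annihilator with k = 0 reads off the charge gamma; those with k > 0 contract with
  the exponential and give a(-1-k).\<close>

lemma transl_exp_minus_evec:
  "transl (exp_minus a p (evec \<gamma>)) = heis (lat_emb \<gamma>) (- 1) (exp_minus a p (evec \<gamma>))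
    + (\<Sum>k=1..p. heis (lat_emb a) (- 1 - int k) (exp_minus a (p - k) (evec \<gamma>)))"
proof -
  let ?S = "\<lambda>k. exp_minus a k (evec \<gamma>)"
  have t0: "tr_term 0 (?S p) = heis (lat_emb \<gamma>) (- 1) (?S p)"
    unfolding tr_term_def
    by (simp add: heis_exp_minus heis_0_evec lin_scl[OF lin_exp_minus] lin_scl[OF lin_heis] lin_add[OF lin_exp_minus]
        heis_dual(1)[of "lat_emb \<gamma>" "-1"])
  have tk: "tr_term k (?S p) = (if k \<le> p then heis (lat_emb a) (- 1 - int k) (?S (p - k)) else 0)" if "k \<noteq> 0" for k
    using that unfolding tr_term_def
    by (simp add: heis_exp_minus heis_pos_evec lin_0[OF lin_exp_minus] lin_scl[OF lin_heis] lin_0[OF lin_heis] lin_add[OF lin_exp_minus] lin_scl[OF lin_exp_minus]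
        heis_dual(1)[of "lat_emb a" "- 1 - int k"])
  have "transl (?S p) = (\<Sum>k\<le>p. tr_term k (?S p))"
    unfolding transl_def by (rule Sum_any.expand_superset) (auto simp: tk intro: ccontr)
  also have "\<dots> = tr_term 0 (?S p) + (\<Sum>k=1..p. tr_term k (?S p))"
  proof -
    have "{..p} = insert 0 {1..p}" by auto
    then show ?thesis by simp
  qed
  also have "(\<Sum>k=1..p. tr_term k (?S p)) = (\<Sum>k=1..p. heis (lat_emb a) (- 1 - int k) (?S (p - k)))"
    by (intro sum.cong refl) (simp add: tk)
  finally show ?thesis unfolding t0 .
qed

lemma transl_1: "transl 1 = 0"
  using transl_exp_minus_evec[of 0 0 0] heis_exp_minus
  by (simp add: exp_minus_0 evec_0 heis_neg creat_def lat_emb_def)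

lemma lat_emb_add: "lat_emb (a + b) = (fst (lat_emb a) + fst (lat_emb b), snd (lat_emb a) + snd (lat_emb b))"
  by (simp add: lat_emb_def algebra_simps)

lemma covariant_exp_field: "covariant transl (exp_field a)"
proof (rule covariantI)
  fix n u
  show "transl (exp_field a n u) = exp_field a n (transl u) + of_int (- n) *\<^sub>V exp_field a (n - 1) u"
  proof (induction u arbitrary: n rule: VL_heis_induct)
    case (evec \<gamma>)
    let ?S = "\<lambda>k. exp_minus a k (evec (a + \<gamma>))"
    let ?h = "lat_emb \<gamma>"
    define E where "E m = (if m < 0 then 0 else ?S (nat m))" for m :: int
    have f: "exp_field a n (evec \<gamma>) = E (- n - 1 - lat_form a \<gamma>)" for n
      by (simp add: exp_field_evec E_def Let_def)
    define p where "p = - n - 1 - lat_form a \<gamma>"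
    have t: "transl (evec \<gamma>) = heis ?h (- 1) (evec \<gamma>)"
      using transl_exp_minus_evec[of 0 0 \<gamma>] by (simp add: exp_minus_0)
    have A: "exp_field a n (heis ?h (- 1) (evec \<gamma>)) = heis ?h (- 1) (E p) - of_int (lat_form a \<gamma>) *\<^sub>V E (p + 1)"
      using heis_exp_field[of ?h "-1" a n "evec \<gamma>"]
      by (simp add: f p_def form_lat_emb lat_form_sym[of \<gamma>] algebra_simps)
    \<comment> \<open>The charge is a + gamma, so a(-1) joins the terms a(-1-k); together they are
      the recursion for (p+1) times the next coefficient of the exponential. At p = -1 that factor
      is 0.\<close>
    have B: "transl (E p) = heis ?h (- 1) (E p) + of_int (p + 1) *\<^sub>V E (p + 1)"
    proof (cases "p \<ge> 0")
      case True
      have "transl (E p) = heis (lat_emb (a + \<gamma>)) (- 1) (?S (nat p))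
         + (\<Sum>k=1..nat p. heis (lat_emb a) (- 1 - int k) (?S (nat p - k)))"
        using True by (simp add: E_def transl_exp_minus_evec)
      also have "heis (lat_emb (a + \<gamma>)) (- 1) (?S (nat p)) = heis ?h (- 1) (?S (nat p)) + heis (lat_emb a) (- 1) (?S (nat p))"
        using heis_comb[of "lat_emb (a + \<gamma>)" 1 ?h 1 "lat_emb a" "-1" "?S (nat p)"] by (simp add: lat_emb_add add.commute)
      also have "(\<Sum>k=1..nat p. heis (lat_emb a) (- 1 - int k) (?S (nat p - k)))
        = (\<Sum>k=Suc 1..Suc (nat p). heis (lat_emb a) (- int k) (?S (Suc (nat p) - k)))"
        by (subst sum.shift_bounds_cl_Suc_ivl) (simp add: algebra_simps)
      also have "heis ?h (- 1) (?S (nat p)) + heis (lat_emb a) (- 1) (?S (nat p)) + \<dots>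
        = heis ?h (- 1) (?S (nat p)) + (\<Sum>k=1..Suc (nat p). heis (lat_emb a) (- int k) (?S (Suc (nat p) - k)))"
        by (subst (2) sum.atLeast_Suc_atMost) (simp_all add: add.assoc)
      also have "\<dots> = heis ?h (- 1) (E p) + of_int (p + 1) *\<^sub>V E (p + 1)"
        unfolding exp_minus_rec[symmetric] using True by (simp add: E_def nat_add_distrib add.commute)
      finally show ?thesis .
    next
      case False
      then show ?thesis by (cases "p = -1") (simp_all add: E_def lin_0[OF lin_transl] lin_0[OF lin_heis])
    qed
    have pe: "- (n - 1) - 1 - lat_form a \<gamma> = p + 1" by (simp add: p_def)
    have "p + 1 = - n - lat_form a \<gamma>" by (simp add: p_def)
    then have pn: "(of_int (p + 1) :: complex) = of_int (- n) - of_int (lat_form a \<gamma>)" by simp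
    show ?case
      unfolding t f pe p_def[symmetric] A B pn by (simp add: VL.scale_left_diff_distrib)
  next
    case (heis h k u)
    have c: "exp_field a n (heis h k v) = heis h k (exp_field a n v) - form h (lat_emb a) *\<^sub>V exp_field a (n + k) v" for n v k
      using heis_exp_field[of h k a n v] by simp
    note T = covariantD[OF covariant_heis, of h]
    show ?case
      unfolding T c lin_diff[OF lin_transl] lin_scl[OF lin_transl] heis.IH exp_field_lin
        heis_lin
      by (simp add: VL.scale_right_diff_distrib VL.scale_right_distrib VL.scale_left_distrib VL.scale_left_diff_distrib algebra_simps)
  next
    case (add u v)
    then show ?case by (simp add: lin_add[OF lin_transl] lin_add[OF lin_exp_field] VL.scale_right_distrib)
  next
    case (scl c u)
    show ?case
      unfolding lin_scl[OF lin_transl] lin_scl[OF lin_exp_field] scl.IH VL.scale_right_distrib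
      by (simp add: mult.commute)
  qed
qed

section \<open>Locality of the generating fields\<close>

lemma bracket_heis_heis: "bracket (heis h) (heis h') u a b = (if a + b = 0 then of_int a * form h h' else 0) *\<^sub>V u"
  by (simp add: bracket_def commutator_def heis_commute[of h a h' b])

text \<open>The bracket is a multiple of the derivative of the delta function, which (z - w)^2
  annihilates.\<close>

lemma local_to_heis_heis: "local_to (heis h) (heis h')"
  unfolding local_to_def
proof (intro exI allI)
  fix u
  have e: "bracket (heis h) (heis h') u = (\<lambda>a b. (if a + b = 0 then of_int a * form h h' else 0) *\<^sub>V u)"
    by (simp add: fun_eq_iff bracket_heis_heis)
  have d: "dd (\<lambda>a b. (if a + b = 0 then of_int a * form h h' else 0) *\<^sub>V u)
      = (\<lambda>a b. (if a + b = - 1 then form h h' else 0) *\<^sub>V u)"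
    by (auto simp: fun_eq_iff dd_def distrib_right VL.scale_left_distrib)
  have "dd (\<lambda>a b. (if a + b = - 1 then form h h' else 0) *\<^sub>V u) = 0"
    by (auto simp: fun_eq_iff dd_def)
  then show "(dd ^^ 2) (bracket (heis h) (heis h') u) = 0"
    by (simp only: numeral_2_eq_2 funpow.simps comp_apply id_apply e d)
qed

lemma bracket_heis_exp: "bracket (heis h) (exp_field c) u a b = form h (lat_emb c) *\<^sub>V exp_field c (a + b) u"
  by (simp add: bracket_def commutator_def heis_exp_field add.commute)

lemma local_to_heis_exp: "local_to (heis h) (exp_field c)"
  unfolding local_to_def
proof (intro exI allI)
  fix u
  show "(dd ^^ 1) (bracket (heis h) (exp_field c) u) = 0"
    by (simp add: fun_eq_iff dd_def bracket_heis_exp algebra_simps)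
qed

section \<open>Components in C[L] and the binomial identity for two exponentials\<close>

definition vac_coeff :: "lat \<Rightarrow> VL \<Rightarrow> complex" where
  "vac_coeff \<beta> u = lookup u (({#}, {#}), \<beta>)"

lemma vac_coeff_simps:
  "vac_coeff \<beta> (u + v) = vac_coeff \<beta> u + vac_coeff \<beta> v"
  "vac_coeff \<beta> (u - v) = vac_coeff \<beta> u - vac_coeff \<beta> v"
  "vac_coeff \<beta> (c *\<^sub>V u) = c * vac_coeff \<beta> u"
  "vac_coeff \<beta> 0 = 0"
  "vac_coeff \<beta> (- u) = - vac_coeff \<beta> u"
  "vac_coeff \<beta> (evec \<gamma>) = (if \<gamma> = \<beta> then 1 else 0)"
  by (simp_all add: vac_coeff_def lookup_add lookup_minus lookup_uminus lookup_scl evec_def lookup_bvec)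

lemma vac_coeff_sum: "vac_coeff \<beta> (\<Sum>i\<in>A. f i) = (\<Sum>i\<in>A. vac_coeff \<beta> (f i))"
  by (induction A rule: infinite_finite_induct) (simp_all add: vac_coeff_simps)

lemma vac_coeff_heis_neg: "k < 0 \<Longrightarrow> vac_coeff \<beta> (heis h k u) = 0"
proof (induction u rule: VL_basis_induct)
  case (bvec b)
  then show ?case
    by (cases b, cases "fst b")
       (simp add: heis_neg creat_def distrib_right scl_mult_left bvec_mult vac_coeff_simps,
        simp add: vac_coeff_def lookup_bvec)
qed (simp_all add: heis_lin vac_coeff_simps)

text \<open>\<open>(2, 1)\<close> and \<open>(1, 2)\<close> are three times the fundamental weights:
  each pairs to 3 with one simple root and to 0 with the other, so its modes differentiate in one
  family of variables only.\<close>

lemma lookup_heis_pos: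
  "lookup (heis (2, 1) (int n + 1) u) ((N1, N2), \<gamma>)
     = of_nat (n + 1) * 3 * of_nat (count N1 n + 1) * lookup u ((add_mset n N1, N2), \<gamma>)"
  "lookup (heis (1, 2) (int n + 1) u) ((N1, N2), \<gamma>)
     = of_nat (n + 1) * 3 * of_nat (count N2 n + 1) * lookup u ((N1, add_mset n N2), \<gamma>)"
proof -
  have m: "M - {#n#} = N \<longleftrightarrow> M = add_mset n N" if "count M n \<noteq> 0" for M N :: "nat multiset"
    using that by (metis add_mset_remove_trivial count_inI insert_DiffM)
  have h: "heis h (int n + 1) (bvec ((M1, M2), \<delta>)) =
       (of_nat (n + 1) * form h (1, 0) * of_nat (count M1 n)) *\<^sub>V bvec ((M1 - {#n#}, M2), \<delta>) +
       (of_nat (n + 1) * form h (0, 1) * of_nat (count M2 n)) *\<^sub>V bvec ((M1, M2 - {#n#}), \<delta>)" for h M1 M2 \<delta>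
    by (simp add: heis_def heis_basis_def Let_def algebra_simps)
  show "lookup (heis (2, 1) (int n + 1) u) ((N1, N2), \<gamma>)
     = of_nat (n + 1) * 3 * of_nat (count N1 n + 1) * lookup u ((add_mset n N1, N2), \<gamma>)"
  proof (induction u rule: VL_basis_induct)
    case (bvec b)
    obtain M1 M2 \<delta> where b: "b = ((M1, M2), \<delta>)" by (metis surj_pair)
    show ?case
    proof (cases "count M1 n = 0")
      case True
      then have "M1 \<noteq> add_mset n N1" by auto
      then show ?thesis unfolding b h lookup_add lookup_scl lookup_bvec True by (simp add: form_def)
    next
      case False
      show ?thesis unfolding b h lookup_add lookup_scl lookup_bvec
        using m[OF False, of N1] by (auto simp: form_def)
    qed
  qed (simp_all add: heis_lin lookup_add lookup_scl distrib_left)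
  show "lookup (heis (1, 2) (int n + 1) u) ((N1, N2), \<gamma>)
     = of_nat (n + 1) * 3 * of_nat (count N2 n + 1) * lookup u ((N1, add_mset n N2), \<gamma>)"
  proof (induction u rule: VL_basis_induct)
    case (bvec b)
    obtain M1 M2 \<delta> where b: "b = ((M1, M2), \<delta>)" by (metis surj_pair)
    show ?case
    proof (cases "count M2 n = 0")
      case True
      then have "M2 \<noteq> add_mset n N2" by auto
      then show ?thesis unfolding b h lookup_add lookup_scl lookup_bvec True by (simp add: form_def)
    next
      case False
      show ?thesis unfolding b h lookup_add lookup_scl lookup_bvec
        using m[OF False, of N2] by (auto simp: form_def)
    qed
  qed (simp_all add: heis_lin lookup_add lookup_scl distrib_left)
qed

text \<open>A vector annihilated by all \<open>h(k)\<close> with \<open>k > 0\<close> lies in \<open>\<complex>[L]\<close>.\<close>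

lemma vacuum_like_eq_0:
  assumes "\<And>h k. k > 0 \<Longrightarrow> heis h k u = 0" "\<And>\<beta>. vac_coeff \<beta> u = 0"
  shows "u = 0"
proof (rule poly_mapping_eqI)
  fix b :: vidx
  obtain M1 M2 \<gamma> where b: "b = ((M1, M2), \<gamma>)" by (metis surj_pair)
  have nz: "(of_nat (n + 1) * 3 * of_nat (m + 1) :: complex) \<noteq> 0" for n m :: nat
    by (simp del: of_nat_Suc)
  consider "M1 = {#}" "M2 = {#}" | n N where "M1 = add_mset n N" | n N where "M2 = add_mset n N"
    by (metis multiset_cases)
  then show "lookup u b = lookup 0 b"
  proof cases
    case 1
    then show ?thesis using assms(2)[of \<gamma>] by (simp add: b vac_coeff_def)
  next
    case (2 n N)
    then show ?thesis
      using lookup_heis_pos(1)[of n u N M2 \<gamma>] assms(1)[of "int n + 1" "(2, 1)"] nz[of n "count N n"]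
      by (simp add: b del: of_nat_add of_nat_Suc)
  next
    case (3 n N)
    then show ?thesis
      using lookup_heis_pos(2)[of n u M1 N \<gamma>] assms(1)[of "int n + 1" "(1, 2)"] nz[of n "count N n"]
      by (simp add: b del: of_nat_add of_nat_Suc)
  qed
qed

lemma vac_coeff_exp_minus: "vac_coeff \<beta> (exp_minus c q (evec \<gamma>)) = (if q = 0 \<and> \<gamma> = \<beta> then 1 else 0)"
proof (cases "q = 0")
  case False
  have "of_nat q * vac_coeff \<beta> (exp_minus c q (evec \<gamma>)) = 0"
    unfolding vac_coeff_simps(3)[symmetric] exp_minus_rec vac_coeff_sum
    by (intro sum.neutral ballI) (simp add: vac_coeff_heis_neg)
  then show ?thesis using False by simp
qed (simp add: exp_minus_0 vac_coeff_simps)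

text \<open>The recursion for the coefficients of f = (1 - t)^x that follows from t f' = -x t/(1 -
  t) f.\<close>

lemma gbinomial_alternating_step:
  fixes x :: complex
  shows "of_nat p * ((- 1) ^ p * (x gchoose p)) = - x * (\<Sum>j<p. (- 1) ^ j * (x gchoose j))"
proof (induction p)
  case (Suc p)
  have "of_nat (Suc p) * (x gchoose Suc p) = (x - of_nat p) * (x gchoose p)"
    by (simp only: gbinomial_absorption gbinomial_absorb_comp)
  then have "of_nat (Suc p) * ((- 1) ^ Suc p * (x gchoose Suc p)) = - ((- 1) ^ p * ((x - of_nat p) * (x gchoose p)))"
    by (simp only: power_Suc mult_minus_left mult_1 mult_minus_right mult.left_commute[of "of_nat (Suc p)"])
  also have "\<dots> = of_nat p * ((- 1) ^ p * (x gchoose p)) - x * ((- 1) ^ p * (x gchoose p))"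
    by (simp add: algebra_simps)
  finally show ?case unfolding Suc.IH by (simp add: algebra_simps)
qed simp

lemma exp_field_heis:
  "exp_field a n (heis h k u) = heis h k (exp_field a n u) - form h (lat_emb a) *\<^sub>V exp_field a (n + k) u"
  using heis_exp_field[of h k a n u] by simp

lemma exp_field_exp_minus_rec:
  "of_nat p *\<^sub>V exp_field c m (exp_minus d p u) =
     (\<Sum>i=1..p. heis (lat_emb d) (- int i) (exp_field c m (exp_minus d (p - i) u))
        - of_int (lat_form c d) *\<^sub>V exp_field c (m - int i) (exp_minus d (p - i) u))"
proof -
  have "of_nat p *\<^sub>V exp_field c m (exp_minus d p u) = exp_field c m (of_nat p *\<^sub>V exp_minus d p u)"
    by (simp only: lin_scl[OF lin_exp_field])
  also have "\<dots> = (\<Sum>i=1..p. exp_field c m (heis (lat_emb d) (- int i) (exp_minus d (p - i) u)))"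
    unfolding exp_minus_rec lin_sum[OF lin_exp_field] ..
  finally show ?thesis by (simp add: exp_field_heis form_lat_emb lat_form_sym[of d])
qed

text \<open>Moving d(-i) to the left of Y(e^c, z) leaves a shift by i with factor -<c, d>, while
  whatever stands behind a creation operator has no component in C[L]. The resulting recursion is
  that of (1 - t)^<c,d>.\<close>

lemma vac_coeff_exp_field:
  "vac_coeff \<beta> (exp_field c m (exp_minus d p (evec \<gamma>))) =
    (if m = int p - 1 - lat_form c \<gamma> \<and> \<beta> = c + \<gamma> then (- 1) ^ p * (of_int (lat_form c d) gchoose p) else 0)"
proof (induction p arbitrary: m rule: less_induct)
  case (less p)
  show ?case
  proof (cases "p = 0")
    case True
    then show ?thesis
      by (auto simp: exp_minus_0 exp_field_evec Let_def vac_coeff_exp_minus vac_coeff_simps)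
  next
    case False
    let ?x = "of_int (lat_form c d) :: complex"
    have if_sum: "(\<Sum>i=1..p. - ?x * (if Q then f i else 0)) = (if Q then - ?x * (\<Sum>i=1..p. f i) else 0)"
      for Q and f :: "nat \<Rightarrow> complex"
      by (cases Q) (simp_all add: sum_distrib_left)
    have "of_nat p * vac_coeff \<beta> (exp_field c m (exp_minus d p (evec \<gamma>))) =
      (\<Sum>i=1..p. - ?x * vac_coeff \<beta> (exp_field c (m - int i) (exp_minus d (p - i) (evec \<gamma>))))"
      unfolding vac_coeff_simps(3)[symmetric] exp_field_exp_minus_rec vac_coeff_sum
      by (intro sum.cong refl) (simp add: vac_coeff_simps vac_coeff_heis_neg)
    also have "\<dots> = (\<Sum>i=1..p. - ?x * (if m = int p - 1 - lat_form c \<gamma> \<and> \<beta> = c + \<gamma> then (- 1) ^ (p - i) * (?x gchoose (p - i)) else 0))"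
      using False by (intro sum.cong refl) (auto simp: less)
    also have "\<dots> = (if m = int p - 1 - lat_form c \<gamma> \<and> \<beta> = c + \<gamma> then - ?x * (\<Sum>i=1..p. (- 1) ^ (p - i) * (?x gchoose (p - i))) else 0)"
      by (rule if_sum)
    also have "(\<Sum>i=1..p. (- 1) ^ (p - i) * (?x gchoose (p - i))) = (\<Sum>j<p. (- 1) ^ j * (?x gchoose j))"
      by (rule sum.reindex_bij_witness[of _ "\<lambda>j. p - j" "\<lambda>i. p - i"]) auto
    also have "- ?x * \<dots> = of_nat p * ((- 1) ^ p * (?x gchoose p))"
      by (simp only: gbinomial_alternating_step)
    finally show ?thesis using False by (auto split: if_splits)
  qed
qed

lemma exp_field_exp_minus_vanish: "m \<ge> int p - lat_form c \<gamma> \<Longrightarrow> exp_field c m (exp_minus d p (evec \<gamma>)) = 0"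
proof (induction p arbitrary: m rule: less_induct)
  case (less p)
  show ?case
  proof (cases "p = 0")
    case True
    then show ?thesis using less.prems by (simp add: exp_minus_0 exp_field_evec Let_def)
  next
    case False
    have "of_nat p *\<^sub>V exp_field c m (exp_minus d p (evec \<gamma>)) = 0"
      unfolding exp_field_exp_minus_rec
      using less by (intro sum.neutral ballI) (auto simp: lin_0[OF lin_heis])
    then show ?thesis using False by simp
  qed
qed

lemma exp_exp_evec:
  "exp_field c m (exp_field d n (evec \<gamma>)) = (if n < - lat_form d \<gamma> then
     exp_field c m (exp_minus d (nat (- n - 1 - lat_form d \<gamma>)) (evec (d + \<gamma>))) else 0)"
  using lin_0[OF lin_exp_field] by (auto simp: exp_field_evec[of d] Let_def)

lemma lat_form_add: "lat_form a (b + c) = lat_form a b + lat_form a c"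
  by (simp add: lat_form_def algebra_simps)

text \<open>The coefficient of t^p in the expansion of (1 - t)^x at t = 0, for p in all of the
  integers.\<close>

definition alt_binom :: "int \<Rightarrow> int \<Rightarrow> complex" where
  "alt_binom x p = (if p < 0 then 0 else (- 1) ^ nat p * (of_int x gchoose nat p))"

lemma vac_coeff_exp_exp:
  "vac_coeff \<beta> (exp_field c m (exp_field d n (evec \<gamma>))) =
    (if m + n = - 2 - lat_form c d - lat_form c \<gamma> - lat_form d \<gamma> \<and> \<beta> = c + d + \<gamma>
     then alt_binom (lat_form c d) (- n - 1 - lat_form d \<gamma>) else 0)"
  by (auto simp: exp_exp_evec alt_binom_def vac_coeff_exp_field lat_form_add vac_coeff_simps add.assoc)

text \<open>The expansions of \<open>(1 - x)\<^sup>a\<close> at \<open>x = 0\<close> and at \<open>x = \<infinity>\<close> differ by a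
  combination of derivatives of the delta function; the sign \<open>(-1)\<^sup>a\<close> is trivial since \<open>a\<close> is even.\<close>

lemma alt_binom_diff:
  assumes "even x"
  shows "alt_binom x p - alt_binom x (x - p) =
    (if x \<ge> 0 then 0 else of_int (p - x - 1) gchoose (nat (- x) - 1))"
proof (cases "x \<ge> 0")
  case True
  define b where "b = nat x"
  have x: "x = int b" "even b" using True assms by (simp_all add: b_def even_nat_iff)
  have F: "alt_binom x p = (if p < 0 then 0 else (- 1) ^ nat p * of_nat (b choose nat p))" for p
    by (simp add: alt_binom_def x binomial_gbinomial)
  have Z: "alt_binom x q = 0" if "q < 0 \<or> q > x" for q
    unfolding F using that x by (auto simp: binomial_eq_0)
  have "\<exists>k. p = int k \<and> k \<le> b" if "p \<ge> 0" "p \<le> x"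
    using that x by (intro exI[of _ "nat p"]) auto
  then consider "p < 0" | "p > x" | k where "p = int k" "k \<le> b"
    by (meson linorder_not_less)
  then show ?thesis
  proof cases
    case 3
    then have e: "x - p = int (b - k)" using x by simp
    have "(- 1 :: complex) ^ (b - k) = (- 1) ^ k"
      using 3 x by (cases "even k") (simp_all add: uminus_power_if)
    then have "alt_binom x (int k) = alt_binom x (int (b - k))"
      unfolding F nat_int using 3 by (simp add: binomial_symmetric[of k b])
    then show ?thesis using True unfolding e by (simp add: 3(1))
  qed (use True Z[of p] Z[of "x - p"] in simp_all)
next
  case False
  define b where "b = nat (- x) - 1"
  have x: "x = - int b - 1" "odd b"
    using False assms by (auto simp: b_def even_nat_iff)
  have F: "alt_binom x (int k) = of_nat (k + b choose b)" for k
  proof -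
    have "of_int x gchoose k = (- 1) ^ k * (of_nat (k + b) gchoose k :: complex)"
    proof -
      have e: "(of_int x :: complex) = - (of_nat b + 1)" by (simp add: x)
      show ?thesis unfolding e gbinomial_minus by (simp add: add.commute)
    qed
    also have "\<dots> = (- 1) ^ k * of_nat (k + b choose b)"
      by (simp only: binomial_gbinomial[symmetric]) (simp add: binomial_symmetric[of k "k + b"])
    finally show ?thesis by (simp add: alt_binom_def flip: mult.assoc power_mult_distrib)
  qed
  have N: "alt_binom x p = 0" if "p < 0" for p using that by (simp add: alt_binom_def)
  have r: "p - x - 1 = p + int b" "nat (- x) - 1 = b" using x by simp_all
  have "\<exists>k. p = int k" if "p \<ge> 0" using that by (metis nonneg_int_cases)
  moreover have "\<exists>k. p = - int b - 1 - int k" if "p + int b < 0"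
    using that by (intro exI[of _ "nat (- int b - 1 - p)"]) simp
  ultimately consider k where "p = int k" | "p < 0" "p + int b \<ge> 0" | k where "p = - int b - 1 - int k"
    by (meson linorder_not_less)
  then show ?thesis
  proof cases
    case 1
    have e: "p - x - 1 = int (k + b)" and neg: "x - p < 0" using 1 x by simp_all
    show ?thesis
      unfolding e r(2) N[OF neg] using False
      by (simp only: 1 F if_False of_int_of_nat_eq binomial_gbinomial diff_zero)
  next
    \<comment> \<open>In the gap -b <= p < 0 both expansions vanish, and p + b is one of the zeros
      0, ..., b - 1 of the binomial polynomial.\<close>
    case 2
    then obtain j where j: "p + int b = int j" "j < b" by (metis nonneg_int_cases add_less_same_cancel2 of_nat_less_iff)
    have "x - p < 0" using 2 x by simp
    moreover have "(of_int (int j) gchoose b :: complex) = 0"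
      using j by (simp add: binomial_eq_0 flip: binomial_gbinomial)
    ultimately show ?thesis using False 2 by (simp only: N r if_False j diff_self)
  next
    case 3
    have e: "x - p = int k" "p + int b = - int k - 1" using 3 x by simp_all
    have "of_int (- int k - 1) gchoose b = (- 1) ^ b * (of_nat (k + b) gchoose b :: complex)"
    proof -
      have e: "(of_int (- int k - 1) :: complex) = - (of_nat k + 1)" by simp
      show ?thesis unfolding e gbinomial_minus by (simp add: add.commute)
    qed
    \<comment> \<open>The sign (-1)^b is -1 because x is even and hence b odd.\<close>
    then have "of_int (- int k - 1) gchoose b = - (of_nat (k + b choose b) :: complex)"
      using x(2) by (simp add: binomial_gbinomial)
    moreover have "p < 0" using 3 by simp
    ultimately show ?thesis using False by (simp only: F N r if_False e diff_0)
  qed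
qed

text \<open>A polynomial of degree k supported on a line m + n = s, that is, a shifted k-th divided
  derivative of the delta function. By Pascal's rule each \<open>dd\<close> lowers its degree by
  one.\<close>

lemma dd_pow_binomial:
  "(dd ^^ Suc k) (\<lambda>m n. (if m + n = s then of_int (q - n) gchoose k else 0) *\<^sub>V v) = 0"
proof (induction k arbitrary: s q)
  case 0
  show ?case by (auto simp: fun_eq_iff dd_def)
next
  case (Suc k)
  have "dd (\<lambda>m n. (if m + n = s then of_int (q - n) gchoose Suc k else 0) *\<^sub>V v)
    = (\<lambda>m n. (if m + n = s - 1 then of_int (q - 1 - n) gchoose k else 0) *\<^sub>V v)"
  proof (intro ext)
    fix m n
    have "(of_int (q - n) gchoose Suc k) - (of_int (q - (n + 1)) gchoose Suc k) = (of_int (q - 1 - n) gchoose k :: complex)"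
      using gbinomial_Suc_Suc[of "of_int (q - 1 - n) :: complex" k] by (simp add: algebra_simps)
    then show "dd (\<lambda>m n. (if m + n = s then of_int (q - n) gchoose Suc k else 0) *\<^sub>V v) m n
      = (if m + n = s - 1 then of_int (q - 1 - n) gchoose k else 0) *\<^sub>V v"
      by (auto simp: dd_def simp flip: VL.scale_left_diff_distrib)
  qed
  then show ?case using Suc.IH[of "s - 1" "q - 1"] by (simp only: funpow_Suc_right[of "Suc k"] comp_apply)
qed

lemma dd_pow_shift:
  "(dd ^^ n) (\<lambda>a b. F (a + k) b) = (\<lambda>a b. (dd ^^ n) F (a + k) b)"
  "(dd ^^ n) (\<lambda>a b. F a (b + k)) = (\<lambda>a b. (dd ^^ n) F a (b + k))"
  by (induction n) (simp_all add: fun_eq_iff dd_def algebra_simps)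

lemma dd_pow_half_plane:
  assumes "\<And>a b. a + b \<ge> t \<Longrightarrow> F a b = 0"
  shows "a + b \<ge> t \<Longrightarrow> (dd ^^ n) F a b = 0"
  by (induction n arbitrary: a b) (simp_all add: dd_pow_Suc assms del: funpow.simps(2))

lemma even_lat_form: "even (lat_form a b)"
  by (simp add: lat_form_def)

lemma heis_bracket_exp:
  "heis h k (bracket (exp_field c) (exp_field d) u m n) = bracket (exp_field c) (exp_field d) (heis h k u) m n
    + form h (lat_emb c) *\<^sub>V bracket (exp_field c) (exp_field d) u (m + k) n
    + form h (lat_emb d) *\<^sub>V bracket (exp_field c) (exp_field d) u m (n + k)"
  by (simp add: bracket_def commutator_def exp_field_heis lin_diff[OF lin_exp_field] lin_scl[OF lin_exp_field]
      lin_diff[OF lin_heis] VL.scale_right_diff_distrib)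

lemma heis_dd_bracket_exp:
  "heis h k ((dd ^^ N) (bracket (exp_field c) (exp_field d) u) m n) = (dd ^^ N) (bracket (exp_field c) (exp_field d) (heis h k u)) m n
    + form h (lat_emb c) *\<^sub>V (dd ^^ N) (bracket (exp_field c) (exp_field d) u) (m + k) n
    + form h (lat_emb d) *\<^sub>V (dd ^^ N) (bracket (exp_field c) (exp_field d) u) m (n + k)"
proof -
  let ?B = "bracket (exp_field c) (exp_field d)"
  have "(\<lambda>m n. heis h k (?B u m n)) = ?B (heis h k u) + (\<lambda>m n. form h (lat_emb c) *\<^sub>V ?B u (m + k) n)
    + (\<lambda>m n. form h (lat_emb d) *\<^sub>V ?B u m (n + k))"
    by (simp add: fun_eq_iff heis_bracket_exp)
  then have "(dd ^^ N) (\<lambda>m n. heis h k (?B u m n)) m n = (dd ^^ N) (?B (heis h k u) + (\<lambda>m n. form h (lat_emb c) *\<^sub>V ?B u (m + k) n)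
    + (\<lambda>m n. form h (lat_emb d) *\<^sub>V ?B u m (n + k))) m n"
    by (simp only:)
  then show ?thesis
    unfolding dd_pow_lin[OF lin_heis] dd_pow_add dd_pow_lin[OF lin_scale[OF lin_id]] dd_pow_shift[of N "?B u"]
    by (simp only: plus_fun_apply)
qed

lemma local_to_exp_exp: "local_to (exp_field c) (exp_field d)"
proof -
  let ?B = "bracket (exp_field c) (exp_field d)"
  define x where "x = lat_form c d"
  define N where "N = nat (- x)"
  have ev: "even x" by (simp add: x_def even_lat_form)
  have base: "(dd ^^ N) (?B (evec \<gamma>)) m n = 0" for \<gamma> m n
  proof -
    define s where "s = - 2 - x - lat_form c \<gamma> - lat_form d \<gamma>"
    have van: "?B (evec \<gamma>) m n = 0" if "m + n \<ge> s + 1" for m n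
      using that exp_field_exp_minus_vanish[of "nat (- n - 1 - lat_form d \<gamma>)" c "d + \<gamma>" m d]
        exp_field_exp_minus_vanish[of "nat (- m - 1 - lat_form c \<gamma>)" d "c + \<gamma>" n c]
      by (auto simp: bracket_def commutator_def exp_exp_evec lat_form_add s_def x_def lat_form_sym[of d c])
    have vac0: "vac_coeff \<beta> ((dd ^^ N) (?B (evec \<gamma>)) m n) = 0" for \<beta> m n
    proof -
      define v where "v = (if \<beta> = c + d + \<gamma> then 1 else 0 :: VL)"
      \<comment> \<open>The scalar component is turned into a multiple of the vacuum vector, so that
        it becomes a linear map of \<open>VL\<close> and commutes with powers of
        \<open>dd\<close>.\<close>
      have P: "lin (\<lambda>u. vac_coeff \<beta> u *\<^sub>V 1)"
        by (simp add: lin_def vac_coeff_simps VL.scale_left_distrib)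
      have "(\<lambda>m n. vac_coeff \<beta> (?B (evec \<gamma>) m n) *\<^sub>V 1) =
        (\<lambda>m n. (if m + n = s then (if x \<ge> 0 then 0 else of_int ((- 2 - lat_form d \<gamma> - x) - n) gchoose (N - 1)) else 0) *\<^sub>V v)"
      proof (intro ext)
        fix m n
        let ?p = "- n - 1 - lat_form d \<gamma>"
        have vc: "vac_coeff \<beta> (?B (evec \<gamma>) m n) = (if m + n = s \<and> \<beta> = c + d + \<gamma> then
           alt_binom x ?p - alt_binom x (- m - 1 - lat_form c \<gamma>) else 0)"
          by (auto simp: bracket_def commutator_def vac_coeff_simps vac_coeff_exp_exp s_def x_def lat_form_sym[of d c] add.commute)
        show "vac_coeff \<beta> (?B (evec \<gamma>) m n) *\<^sub>V 1 =
          (if m + n = s then (if x \<ge> 0 then 0 else of_int ((- 2 - lat_form d \<gamma> - x) - n) gchoose (N - 1)) else 0) *\<^sub>V v"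
        proof (cases "m + n = s \<and> \<beta> = c + d + \<gamma>")
          case True
          then have e: "- m - 1 - lat_form c \<gamma> = x - ?p" "(- 2 - lat_form d \<gamma> - x) - n = ?p - x - 1"
            by (simp_all add: s_def)
          show ?thesis
            unfolding vc e(1) e(2) alt_binom_diff[OF ev] N_def v_def by (simp only: True simp_thms if_True)
        next
          case False
          then show ?thesis unfolding vc v_def by auto
        qed
      qed
      moreover have "(dd ^^ N) (\<lambda>m n. (if m + n = s then (if x \<ge> 0 then 0 else of_int ((- 2 - lat_form d \<gamma> - x) - n) gchoose (N - 1)) else 0) *\<^sub>V v) = 0"
      proof (cases "x \<ge> 0")
        case True
        then have "N = 0" by (simp add: N_def)
        then show ?thesis using True by (simp add: fun_eq_iff)
      next
        case False
        then have "N = Suc (N - 1)" by (simp add: N_def)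
        then show ?thesis using dd_pow_binomial[of "N - 1" s "- 2 - lat_form d \<gamma> - x" v] False
          by (simp only: if_False)
      qed
      ultimately have "(dd ^^ N) (\<lambda>m n. vac_coeff \<beta> (?B (evec \<gamma>) m n) *\<^sub>V 1) m n = 0"
        by simp
      then show ?thesis unfolding dd_pow_lin[OF P] by simp
    qed
    have Z: "?B 0 = 0"
      using lin_0[OF lin_exp_field] by (simp add: fun_eq_iff bracket_def commutator_def)
    show ?thesis
    \<comment> \<open>Descending induction on m + n. Above s both orders of the product vanish. For
      k > 0, h(k) leads from the coefficient at (m, n) to those at (m + k, n) and (m, n + k), which
      are already known to vanish.\<close>
    proof (induction "nat (s + 1 - (m + n))" arbitrary: m n rule: less_induct)
      case less
      show ?case
      proof (cases "m + n \<ge> s + 1")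
        case True
        then show ?thesis using dd_pow_half_plane[of "s + 1" "?B (evec \<gamma>)"] van by blast
      next
        case False
        show ?thesis
        proof (rule vacuum_like_eq_0[OF _ vac0])
          fix h and k :: int assume "k > 0"
          then have "(dd ^^ N) (?B (evec \<gamma>)) (m + k) n = 0" "(dd ^^ N) (?B (evec \<gamma>)) m (n + k) = 0"
            using False by (auto intro!: less)
          then show "heis h k ((dd ^^ N) (?B (evec \<gamma>)) m n) = 0"
            using \<open>k > 0\<close> by (simp add: heis_dd_bracket_exp heis_pos_evec Z dd_pow_0)
        qed
      qed
    qed
  qed
  have "(dd ^^ N) (?B u) = 0" for u
  proof (induction u rule: VL_heis_induct)
    case (evec \<gamma>)
    then show ?case by (simp add: fun_eq_iff base)
  next
    case (heis h k u)
    show ?case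
    proof (intro ext)
      fix m n
      show "(dd ^^ N) (?B (heis h k u)) m n = 0 m n"
        using heis_dd_bracket_exp[of h k N c d u m n] heis.IH lin_0[OF lin_heis] by simp
    qed
  next
    case (add u v)
    have "?B (u + v) = ?B u + ?B v"
      by (simp add: fun_eq_iff bracket_def commutator_def lin_add[OF lin_exp_field])
    then show ?case using add by (simp only: dd_pow_add) (simp add: fun_eq_iff)
  next
    case (scl r u)
    have "?B (r *\<^sub>V u) = (\<lambda>m n. r *\<^sub>V ?B u m n)"
      by (simp add: fun_eq_iff bracket_def commutator_def lin_scl[OF lin_exp_field] VL.scale_right_diff_distrib)
    then show ?case using scl by (simp only: dd_pow_lin[OF lin_scale[OF lin_id]]) (simp add: fun_eq_iff)
  qed
  then show ?thesis unfolding local_to_def by blast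
qed

section \<open>The state-field correspondence\<close>

definition fock_field :: "(cartan \<times> nat) list \<Rightarrow> lat \<Rightarrow> vfield" where
  "fock_field xs a = foldr (\<lambda>(h, r). normal_prod (div_deriv r (heis h))) xs (exp_field a)"

lemma fock_field_simps:
  "fock_field [] a = exp_field a"
  "fock_field ((h, r) # xs) a = normal_prod (div_deriv r (heis h)) (fock_field xs a)"
  by (simp_all add: fock_field_def)

lemma vertex_basis_eq:
  "vertex_basis ((M1, M2), a) = fock_field (map (Pair (1, 0)) (sorted_list_of_multiset M1) @
     map (Pair (0, 1)) (sorted_list_of_multiset M2)) a"
  by (simp add: vertex_basis_def fock_field_def)

lemma field_like_fock: "field_like (fock_field xs a)"
  by (induction xs) (auto simp: fock_field_simps field_like_exp_field
      intro!: field_like_normal_prod field_like_div_deriv field_like_heis)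

lemma creative_fock: "creative (fock_field xs a)"
  by (induction xs) (auto simp: fock_field_simps creative_exp_field
      intro!: normal_prod_vacuum field_like_div_deriv field_like_heis field_like_fock creative_div_deriv creative_heis)

lemma covariant_fock: "covariant transl (fock_field xs a)"
  by (induction xs) (auto simp: fock_field_simps covariant_exp_field
      intro!: covariant_normal_prod covariant_div_deriv covariant_heis field_like_div_deriv field_like_heis
        field_like_fock lin_transl)

lemma fock_heis_local: "local_to (fock_field xs a) (heis h)"
proof (induction xs arbitrary: h)
  case Nil
  then show ?case by (simp add: fock_field_simps local_to_sym[OF local_to_heis_exp])
next
  case (Cons x xs)
  obtain h' r where x: "x = (h', r)" by (cases x)
  have "local_to (div_deriv r (heis h')) (fock_field xs a)"
    by (intro local_to_div_deriv local_to_sym[OF Cons.IH] field_like_fock)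
  then show ?case
    unfolding x fock_field_simps
    by (rule Dong(2)[OF field_like_div_deriv[OF field_like_heis] field_like_fock field_like_heis _
        local_to_div_deriv[OF local_to_heis_heis field_like_heis] Cons.IH])
qed

lemma local_to_fock:
  assumes C: "field_like C" "\<And>h. local_to (heis h) C" "local_to (exp_field a) C"
  shows "local_to (fock_field xs a) C"
proof (induction xs)
  case Nil
  then show ?case by (simp add: fock_field_simps C)
next
  case (Cons x xs)
  obtain h r where x: "x = (h, r)" by (cases x)
  have "local_to (div_deriv r (heis h)) (fock_field xs a)"
    by (intro local_to_div_deriv local_to_sym[OF fock_heis_local] field_like_fock)
  then show ?case
    unfolding x fock_field_simps
    by (rule Dong(2)[OF field_like_div_deriv[OF field_like_heis] field_like_fock C(1) _
        local_to_div_deriv[OF C(2,1)] Cons.IH])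
qed

text \<open>Dong's lemma enlarges one side at a time: the second field is built up against an
  exponential, then the first one against the result.\<close>

lemma local_to_fock_fock: "local_to (fock_field xs a) (fock_field ys b)"
proof (rule local_to_fock)
  show "local_to (exp_field a) (fock_field ys b)"
    by (intro local_to_sym[OF local_to_fock] field_like_exp_field local_to_heis_exp local_to_exp_exp)
qed (intro field_like_fock local_to_sym[OF fock_heis_local])+

lemma fock_field_state:
  "fock_field (map (Pair (1, 0)) L1 @ map (Pair (0, 1)) L2) a (-1) 1 = bvec ((mset L1, mset L2), a)"
proof -
  have step: "fock_field ((h, r) # xs) a (-1) 1 = creat h r * fock_field xs a (-1) 1" for h r xs
    unfolding fock_field_simps
    by (subst normal_prod_vacuum(2))
       (auto intro!: field_like_div_deriv field_like_heis field_like_fock creative_div_deriv creative_heis creative_fock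
         simp: div_deriv_vacuum heis_neg)
  have "fock_field (map (Pair (0, 1)) L2) a (-1) 1 = bvec (({#}, mset L2), a)"
    by (induction L2) (simp_all add: step, simp_all add: fock_field_simps exp_field_vacuum evec_def creat_def bvec_mult)
  then show ?thesis
    by (induction L1) (simp_all add: step, simp add: creat_def bvec_mult)
qed

lemma vertex_basis_props:
  "field_like (vertex_basis b)" "creative (vertex_basis b)" "covariant transl (vertex_basis b)"
  "local_to (vertex_basis b) (vertex_basis c)" "vertex_basis b (-1) 1 = bvec b"
proof -
  obtain M1 M2 a where b: "b = ((M1, M2), a)" by (metis surj_pair)
  obtain N1 N2 d where c: "c = ((N1, N2), d)" by (metis surj_pair)
  show "field_like (vertex_basis b)" "creative (vertex_basis b)" "covariant transl (vertex_basis b)"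
    "local_to (vertex_basis b) (vertex_basis c)" "vertex_basis b (-1) 1 = bvec b"
    unfolding b c vertex_basis_eq
    by (simp_all add: field_like_fock creative_fock covariant_fock local_to_fock_fock fock_field_state)
qed

section \<open>Vertex operators of arbitrary states and their uniqueness\<close>

lemma vmode_bvec: "vmode (bvec b) = vertex_basis b"
  by (simp add: vmode_def fun_eq_iff)

lemma lin_vmode_state: "lin (\<lambda>v. vmode v n u)"
  unfolding vmode_def by (rule lin_lin_ext)

lemma vmode_add: "vmode (v + w) = (\<lambda>n u. vmode v n u + vmode w n u)"
  and vmode_scl: "vmode (c *\<^sub>V v) = (\<lambda>n u. c *\<^sub>V vmode v n u)"
  and vmode_0: "vmode 0 = (\<lambda>n u. 0)"
  and vmode_diff: "vmode (v - w) = (\<lambda>n u. vmode v n u - vmode w n u)"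
  by (simp_all add: fun_eq_iff lin_add[OF lin_vmode_state] lin_scl[OF lin_vmode_state] lin_0[OF lin_vmode_state]
      lin_diff[OF lin_vmode_state])

lemma field_like_vmode: "field_like (vmode v)"
  by (induction v rule: VL_basis_induct)
     (simp_all add: vmode_bvec vmode_add vmode_scl vertex_basis_props field_like_add field_like_scl)

lemma creative_vmode: "creative (vmode v)"
  by (induction v rule: VL_basis_induct)
     (simp_all add: vmode_bvec vmode_add vmode_scl vertex_basis_props creative_add creative_scl)

lemma covariant_vmode: "covariant transl (vmode v)"
  by (induction v rule: VL_basis_induct)
     (simp_all add: vmode_bvec vmode_add vmode_scl vertex_basis_props covariant_add covariant_scl lin_transl)

lemma vmode_vacuum: "vmode v (-1) 1 = v"
  by (induction v rule: VL_basis_induct)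
     (simp_all add: vmode_bvec vmode_add vmode_scl vertex_basis_props)

lemma lin_vmode: "lin (vmode v n)"
  by (rule field_like_lin[OF field_like_vmode])

lemma local_to_vmode: "local_to (vmode v) (vmode w)"
proof -
  have "local_to (vmode v) (vertex_basis c)" for c
    by (induction v rule: VL_basis_induct)
       (simp_all add: vmode_bvec vmode_add vmode_scl vertex_basis_props local_to_add local_to_scl)
  then have "local_to (vertex_basis c) (vmode v)" for c by (rule local_to_sym)
  then have "local_to (vmode w) (vmode v)"
    by (induction w rule: VL_basis_induct)
       (simp_all add: vmode_bvec vmode_add vmode_scl field_like_vmode local_to_add local_to_scl)
  then show ?thesis by (rule local_to_sym)
qed

text \<open>The difference of the two fields has state 0, so by covariance all its modes kill the
  vacuum, and by locality they then kill every \<open>v\<close>, which is itself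
  \<open>vmode v (-1) 1\<close>.\<close>

lemma Goddard_uniqueness:
  assumes "field_like A" "creative A" "covariant transl A" "\<And>v. local_to A (vmode v)"
  shows "A = vmode (A (-1) 1)"
proof -
  define D where "D = (\<lambda>k u. A k u + (-1) *\<^sub>V vmode (A (-1) 1) k u)"
  have D: "field_like D" "creative D" "covariant transl D" "\<And>v. local_to D (vmode v)"
    unfolding D_def
    by (intro field_like_add field_like_scl creative_add creative_scl covariant_add covariant_scl
        local_to_add local_to_scl assms field_like_vmode creative_vmode covariant_vmode
        local_to_vmode lin_transl)+
  have "D (-1) 1 = 0" by (simp add: D_def vmode_vacuum)
  then have "D k 1 = 0" for k
    by (rule covariant_vacuum_modes[OF lin_transl transl_1 D(3,1,2)])
  then have "D k u = 0" for k u
    using Goddard_vanishing[OF D(1) _ field_like_vmode creative_vmode D(4), of k u] by (simp add: vmode_vacuum)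
  note D0 = this
  show ?thesis
  proof (intro ext)
    fix k u
    have "A k u + (-1) *\<^sub>V vmode (A (-1) 1) k u = 0" using D0[of k u] unfolding D_def .
    then have "A k u = - ((-1) *\<^sub>V vmode (A (-1) 1) k u)" by (simp only: eq_neg_iff_add_eq_0)
    also have "- ((-1) *\<^sub>V x) = x" for x by simp
    finally show "A k u = vmode (A (-1) 1) k u" .
  qed
qed

lemma vmode_nprod: "vmode (vmode v (int i) w) = nprod i (vmode v) (vmode w)"
proof -
  note V = field_like_vmode creative_vmode covariant_vmode local_to_vmode
  have "nprod i (vmode v) (vmode w) = vmode (nprod i (vmode v) (vmode w) (-1) 1)"
    by (rule Goddard_uniqueness) (intro V field_like_nprod nprod_vacuum covariant_nprod lin_transl Dong)+
  then show ?thesis by (simp add: nprod_vacuum V vmode_vacuum)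
qed

lemma vmode_normal_prod: "vmode (vmode v (-1) w) = normal_prod (vmode v) (vmode w)"
proof -
  note V = field_like_vmode creative_vmode covariant_vmode local_to_vmode
  have "normal_prod (vmode v) (vmode w) = vmode (normal_prod (vmode v) (vmode w) (-1) 1)"
    by (rule Goddard_uniqueness) (intro V field_like_normal_prod normal_prod_vacuum covariant_normal_prod lin_transl Dong)+
  then show ?thesis by (simp add: normal_prod_vacuum V vmode_vacuum)
qed

lemma vmode_transl: "vmode (transl v) = deriv_field (vmode v)"
proof -
  have "deriv_field (vmode v) = vmode (deriv_field (vmode v) (-1) 1)"
    by (rule Goddard_uniqueness) (intro field_like_vmode creative_vmode covariant_vmode local_to_vmode
       field_like_deriv creative_deriv covariant_deriv lin_transl local_to_deriv)+
  moreover have "transl v = deriv_field (vmode v) (-1) 1"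
    using covariantD[OF covariant_vmode, of v "-1" 1] lin_0[OF lin_vmode]
    by (simp add: vmode_vacuum transl_1 deriv_field_def)
  ultimately show ?thesis by simp
qed

section \<open>The grading\<close>

definition weight :: "vidx \<Rightarrow> complex" where
  "weight = (\<lambda>((M1, M2), \<gamma>). of_nat (\<Sum>n\<in>#M1. n + 1) + of_nat (\<Sum>n\<in>#M2. n + 1) + of_int (lat_form \<gamma> \<gamma>) / 2)"

text \<open>L(0) of the standard conformal vector, introduced through its eigenvalues.\<close>

definition degr :: "VL \<Rightarrow> VL" where
  "degr = lin_ext (\<lambda>b. weight b *\<^sub>V bvec b)"

lemma lin_degr: "lin degr"
  unfolding degr_def by (rule lin_lin_ext)

lemmas degr_lin = lin_add[OF lin_degr] lin_scl[OF lin_degr]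

lemma degr_evec: "degr (evec \<gamma>) = (of_int (lat_form \<gamma> \<gamma>) / 2) *\<^sub>V evec \<gamma>"
  by (simp add: degr_def evec_def weight_def)

lemma degr_creat: "degr (creat h n * u) = creat h n * degr u + of_nat (n + 1) *\<^sub>V (creat h n * u)"
proof (induction u rule: VL_basis_induct)
  case (bvec b)
  obtain M1 M2 \<gamma> where b: "b = ((M1, M2), \<gamma>)" by (metis surj_pair)
  have "creat h n * bvec b = fst h *\<^sub>V bvec ((add_mset n M1, M2), \<gamma>) + snd h *\<^sub>V bvec ((M1, add_mset n M2), \<gamma>)"
    by (simp add: b creat_def distrib_right scl_mult_left bvec_mult)
  moreover have "weight ((add_mset n M1, M2), \<gamma>) = weight b + of_nat (n + 1)"
    "weight ((M1, add_mset n M2), \<gamma>) = weight b + of_nat (n + 1)"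
    by (simp_all add: weight_def b)
  moreover have d: "degr (bvec c) = weight c *\<^sub>V bvec c" for c by (simp add: degr_def)
  ultimately show ?case
    by (simp add: d degr_lin scl_mult_right VL.scale_left_distrib
        VL.scale_right_distrib algebra_simps)
qed (simp_all add: distrib_left scl_mult_right degr_lin VL.scale_right_distrib
    mult.commute algebra_simps)

definition homogeneous :: "complex \<Rightarrow> vfield \<Rightarrow> bool" where
  "homogeneous d A \<longleftrightarrow> (\<forall>n u. degr (A n u) = A n (degr u) + (d - of_int n - 1) *\<^sub>V A n u)"

lemma homogeneous_heis: "homogeneous 1 (heis h)"
proof -
  have neg: "degr (heis h k u) = heis h k (degr u) + of_int (- k) *\<^sub>V heis h k u" if "k < 0" for h k u
    using that by (simp add: heis_neg degr_creat)
  have "degr (heis h k u) = heis h k (degr u) + of_int (- k) *\<^sub>V heis h k u" for k u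
  proof (cases "k < 0")
    case False
    then show ?thesis
    proof (induction u rule: VL_heis_induct)
      case (evec \<gamma>)
      then show ?case
        by (cases "k = 0") (simp_all add: heis_0_evec heis_pos_evec degr_evec lin_scl[OF lin_degr] lin_scl[OF lin_heis]
           lin_0[OF lin_degr] mult.commute)
    next
      case (heis h' l u)
      have c: "heis h k (heis h' l v) = heis h' l (heis h k v) + (if k + l = 0 then of_int k * form h h' else 0) *\<^sub>V v" for v
        by (rule heis_commute)
      show ?case
        unfolding c neg[OF heis(1)] lin_add[OF lin_degr] lin_add[OF lin_heis] lin_scl[OF lin_degr] lin_scl[OF lin_heis]
          heis.IH[OF heis.prems]
        by (auto simp: VL.scale_left_distrib VL.scale_right_distrib VL.scale_left_diff_distrib VL.scale_right_diff_distrib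
            algebra_simps add_eq_0_iff)
    next
      case (add u v)
      then show ?case by (simp add: lin_add[OF lin_degr] lin_add[OF lin_heis] VL.scale_right_distrib)
    next
      case (scl c u)
      show ?case
        unfolding lin_scl[OF lin_degr] lin_scl[OF lin_heis] scl.IH[OF scl.prems] VL.scale_right_distrib
        by (simp add: mult.commute)
    qed
  qed (rule neg)
  then show ?thesis by (simp add: homogeneous_def)
qed

lemma degr_heis: "degr (heis h k u) = heis h k (degr u) + of_int (- k) *\<^sub>V heis h k u"
  using homogeneous_heis[of h] by (simp add: homogeneous_def)

lemma degr_exp_minus_evec: "degr (exp_minus a p (evec \<gamma>)) = (of_nat p + of_int (lat_form \<gamma> \<gamma>) / 2) *\<^sub>V exp_minus a p (evec \<gamma>)"
proof (induction p rule: less_induct)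
  case (less p)
  show ?case
  proof (cases "p = 0")
    case True
    then show ?thesis by (simp add: exp_minus_0 degr_evec)
  next
    case False
    let ?w = "of_nat p + of_int (lat_form \<gamma> \<gamma>) / 2 :: complex"
    have "of_nat p *\<^sub>V degr (exp_minus a p (evec \<gamma>))
       = (\<Sum>i=1..p. degr (heis (lat_emb a) (- int i) (exp_minus a (p - i) (evec \<gamma>))))"
      by (simp only: lin_scl[OF lin_degr, symmetric] exp_minus_rec lin_sum[OF lin_degr])
    also have "\<dots> = (\<Sum>i=1..p. ?w *\<^sub>V heis (lat_emb a) (- int i) (exp_minus a (p - i) (evec \<gamma>)))"
      by (intro sum.cong refl)
         (simp add: degr_heis less lin_scl[OF lin_heis] of_nat_diff del: VL.scale_left_diff_distrib
           flip: VL.scale_left_distrib)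
    also have "\<dots> = of_nat p *\<^sub>V ?w *\<^sub>V exp_minus a p (evec \<gamma>)"
      unfolding VL.scale_sum_right[symmetric] exp_minus_rec[symmetric] by (rule VL.scale_left_commute)
    finally have "degr (exp_minus a p (evec \<gamma>)) = ?w *\<^sub>V exp_minus a p (evec \<gamma>) \<or> (of_nat p :: complex) = 0"
      by (simp only: VL.scale_cancel_left)
    then show ?thesis using False by simp
  qed
qed

lemma homogeneous_exp_field: "homogeneous (of_int (lat_form a a) / 2) (exp_field a)"
  unfolding homogeneous_def
proof (intro allI)
  fix n u
  show "degr (exp_field a n u) = exp_field a n (degr u) + (of_int (lat_form a a) / 2 - of_int n - 1) *\<^sub>V exp_field a n u"
  proof (induction u arbitrary: n rule: VL_heis_induct)
    case (evec \<gamma>)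
    define p where "p = - n - 1 - lat_form a \<gamma>"
    have l: "lat_form (a + \<gamma>) (a + \<gamma>) = lat_form a a + 2 * lat_form a \<gamma> + lat_form \<gamma> \<gamma>"
      by (simp add: lat_form_def algebra_simps)
    show ?case
    proof (cases "p < 0")
      case True
      then show ?thesis
        by (simp add: exp_field_evec Let_def p_def[symmetric] lin_0[OF lin_degr] degr_evec lin_scl[OF lin_exp_field])
    next
      case False
      then have n: "(of_nat (nat p) :: complex) = - of_int n - 1 - of_int (lat_form a \<gamma>)"
        by (simp add: p_def)
      show ?thesis using False
        by (simp add: exp_field_evec Let_def p_def[symmetric] degr_evec lin_scl[OF lin_exp_field] degr_exp_minus_evec n l
            add_divide_distrib flip: VL.scale_left_distrib)
    qed
  next
    case (heis h k u)
    show ?case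
      unfolding exp_field_heis lin_diff[OF lin_degr] lin_scl[OF lin_degr] degr_heis heis.IH
        exp_field_lin heis_lin
      by (simp add: VL.scale_left_distrib VL.scale_right_distrib VL.scale_left_diff_distrib VL.scale_right_diff_distrib
            algebra_simps)
  qed (simp_all add: degr_lin exp_field_lin
        VL.scale_right_distrib mult.commute)
qed

lemma homogeneous_deriv: "homogeneous d A \<Longrightarrow> homogeneous (d + 1) (deriv_field A)"
  unfolding homogeneous_def deriv_field_def lin_scl[OF lin_degr]
  by (simp only: VL.scale_right_distrib VL.scale_scale) (simp add: mult.commute)

lemma homogeneous_scl: "homogeneous d A \<Longrightarrow> homogeneous d (\<lambda>n u. c *\<^sub>V A n u)"
  unfolding homogeneous_def by (simp add: lin_scl[OF lin_degr] VL.scale_right_distrib mult.commute)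

lemma homogeneous_div_deriv: "homogeneous d A \<Longrightarrow> homogeneous (d + of_nat r) (div_deriv r A)"
proof (induction r)
  case (Suc r)
  have "homogeneous (d + of_nat r + 1) (deriv_field (div_deriv r A))"
    by (intro homogeneous_deriv Suc)
  then show ?case unfolding div_deriv_Suc using homogeneous_scl by (simp add: add_ac)
qed (simp add: div_deriv_0)

lemma homogeneous_normal_prod:
  assumes A: "field_like A" "homogeneous d A" and B: "field_like B" "homogeneous e B"
  shows "homogeneous (d + e) (normal_prod A B)"
  unfolding homogeneous_def
proof (intro allI)
  fix k u
  define t where "t u j = (if j < 0 then A j (B (k - j - 1) u) else B (k - j - 1) (A j u))" for u j
  have NP: "normal_prod A B k v = Sum_any (t v)" for v
    by (simp add: normal_prod_def t_def)
  have fin: "finite {j. t v j \<noteq> 0}" for v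
    unfolding t_def by (rule normal_prod_finite[OF A(1) B(1)])
  let ?c = "d + e - of_int k - 1"
  have hA: "degr (A n v) = A n (degr v) + (d - of_int n - 1) *\<^sub>V A n v" for n v
    using A(2) by (simp add: homogeneous_def)
  have hB: "degr (B n v) = B n (degr v) + (e - of_int n - 1) *\<^sub>V B n v" for n v
    using B(2) by (simp add: homogeneous_def)
  have e: "degr (t u j) = t (degr u) j + ?c *\<^sub>V t u j" for j
    by (simp add: t_def hA hB lin_add lin_scl field_like_lin A B add.assoc flip: VL.scale_left_distrib)
  have "degr (normal_prod A B k u) = Sum_any (\<lambda>j. degr (t u j))"
    unfolding NP by (rule lin_Sum_any[OF lin_degr fin])
  also have "\<dots> = Sum_any (t (degr u)) + Sum_any (\<lambda>j. ?c *\<^sub>V t u j)"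
    unfolding e by (intro Sum_any.distrib fin finite_support_pull[OF lin_scale[OF lin_id]])
  also have "Sum_any (\<lambda>j. ?c *\<^sub>V t u j) = ?c *\<^sub>V Sum_any (t u)"
    by (rule lin_Sum_any[OF lin_scale[OF lin_id] fin, symmetric])
  finally show "degr (normal_prod A B k u) = normal_prod A B k (degr u) + ?c *\<^sub>V normal_prod A B k u"
    unfolding NP .
qed

lemma homogeneous_fock:
  "homogeneous (of_nat (\<Sum>(h, r)\<leftarrow>xs. r + 1) + of_int (lat_form a a) / 2) (fock_field xs a)"
proof (induction xs)
  case Nil
  then show ?case by (simp add: fock_field_simps homogeneous_exp_field)
next
  case (Cons x xs)
  obtain h r where x: "x = (h, r)" by (cases x)
  have "homogeneous (1 + of_nat r + (of_nat (\<Sum>(h, r)\<leftarrow>xs. r + 1) + of_int (lat_form a a) / 2)) (fock_field (x # xs) a)"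
    unfolding x fock_field_simps
    by (intro homogeneous_normal_prod homogeneous_div_deriv homogeneous_heis field_like_div_deriv field_like_heis field_like_fock Cons)
  then show ?case by (simp add: x add_ac)
qed

lemma degr_vmode: "degr (vmode v n u) = vmode v n (degr u) + vmode (degr v) n u - of_int (n + 1) *\<^sub>V vmode v n u"
proof (induction v rule: VL_basis_induct)
  case (bvec b)
  obtain M1 M2 a where b: "b = ((M1, M2), a)" by (metis surj_pair)
  have s: "sum_list (map f (sorted_list_of_multiset M)) = (\<Sum>n\<in>#M. f n)" for M and f :: "nat \<Rightarrow> nat"
    by (metis mset_map mset_sorted_list_of_multiset sum_mset_sum_list)
  have "homogeneous (weight b) (vertex_basis b)"
    using homogeneous_fock[of "map (Pair (1, 0)) (sorted_list_of_multiset M1) @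
     map (Pair (0, 1)) (sorted_list_of_multiset M2)" a]
    by (simp add: b vertex_basis_eq weight_def comp_def s del: sum_list_Suc)
  moreover have d: "degr (bvec b) = weight b *\<^sub>V bvec b" by (simp add: degr_def)
  ultimately show ?case
    by (simp add: vmode_bvec homogeneous_def d vmode_scl algebra_simps)
next
  case (add v w)
  then show ?case by (simp add: vmode_add lin_add[OF lin_degr] VL.scale_right_distrib)
next
  case (scl c v)
  show ?case
    unfolding vmode_scl lin_scl[OF lin_degr] scl.IH VL.scale_right_diff_distrib VL.scale_right_distrib
    by (simp add: mult.commute)
qed

text \<open>Weights are nonnegative: the oscillator part is a sum of positive mode numbers, and the
  lattice part is half of a form which is twice a sum of squares.\<close>

lemma degr_eigen_neg:
  assumes "degr u = of_int k *\<^sub>V u" "k < 0"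
  shows "u = 0"
proof (rule poly_mapping_eqI)
  fix b
  have l: "lookup (degr u) b = weight b * lookup u b"
    by (induction u rule: VL_basis_induct)
       (auto simp: degr_lin lookup_add lookup_scl distrib_left,
        auto simp: degr_def lookup_scl lookup_bvec)
  obtain M1 M2 \<gamma> where b: "b = ((M1, M2), \<gamma>)" by (metis surj_pair)
  have "lat_form \<gamma> \<gamma> = 2 * ((fst \<gamma>)\<^sup>2 + (snd \<gamma>)\<^sup>2 + (fst \<gamma> - snd \<gamma>)\<^sup>2)"
    by (simp add: lat_form_def power2_eq_square algebra_simps)
  then have "of_int (lat_form \<gamma> \<gamma>) / 2 = (of_int ((fst \<gamma>)\<^sup>2 + (snd \<gamma>)\<^sup>2 + (fst \<gamma> - snd \<gamma>)\<^sup>2) :: complex)"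
    by simp
  then have "weight b = of_int (int ((\<Sum>n\<in>#M1. n + 1) + (\<Sum>n\<in>#M2. n + 1)) + ((fst \<gamma>)\<^sup>2 + (snd \<gamma>)\<^sup>2 + (fst \<gamma> - snd \<gamma>)\<^sup>2))"
    (is "_ = of_int ?w") unfolding b weight_def by (simp only: prod.case of_int_add of_int_of_nat_eq of_nat_add)
  moreover have "?w \<ge> 0" by (intro add_nonneg_nonneg of_nat_0_le_iff zero_le_power2)
  ultimately have "weight b \<noteq> of_int k" using assms(2) by (metis linorder_not_less of_int_eq_iff)
  then show "lookup u b = lookup 0 b"
    using l assms(1) by (simp add: lookup_scl)
qed

lemma vmode_high:
  assumes "degr v = of_nat p *\<^sub>V v" "degr w = of_nat q *\<^sub>V w" "i \<ge> int (p + q)"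
  shows "vmode v i w = 0"
proof (rule degr_eigen_neg)
  show "degr (vmode v i w) = of_int (int p + int q - i - 1) *\<^sub>V vmode v i w"
    by (simp add: degr_vmode assms vmode_scl lin_scl[OF lin_vmode] algebra_simps)
qed (use assms in simp)

theorem vmode_commutator:
  assumes "degr v = of_nat p *\<^sub>V v" "degr w = of_nat q *\<^sub>V w"
  shows "commutator (vmode v m) (vmode w n) u =
    (\<Sum>i<p + q. (of_int m gchoose i) *\<^sub>V vmode (vmode v (int i) w) (m + n - int i) u)"
proof -
  obtain N where N: "\<And>u. (dd ^^ N) (bracket (vmode v) (vmode w) u) = 0"
    using local_to_vmode unfolding local_to_def by blast
  \<comment> \<open>The order of locality is not known explicitly. It is raised to at least p + q,
    and the products from p + q on vanish for reasons of weight.\<close>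
  define M where "M = max N (p + q)"
  have M: "(dd ^^ M) (bracket (vmode v) (vmode w) u) = 0"
    using dd_pow_mono[OF N] by (simp add: M_def)
  have "commutator (vmode v m) (vmode w n) u = bracket (vmode v) (vmode w) u m ((m + n) - m)"
    by (simp add: bracket_def)
  also have "\<dots> = (\<Sum>i<M. (of_int m gchoose i) *\<^sub>V vmode (vmode v (int i) w) (m + n - int i) u)"
    unfolding dd_newton[OF M] vmode_nprod nprod_def ..
  also have "\<dots> = (\<Sum>i<p + q. (of_int m gchoose i) *\<^sub>V vmode (vmode v (int i) w) (m + n - int i) u)"
    by (intro sum.mono_neutral_right) (auto simp: M_def vmode_high[OF assms] vmode_0)
  finally show ?thesis .
qed

section \<open>Calculus of states\<close>

lemma vmode_evec: "vmode (evec a) = exp_field a"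
  by (simp add: evec_def vmode_bvec vertex_basis_eq fock_field_simps)

lemma heis_vmode_local: "local_to (heis h) (vmode v)"
proof -
  have "local_to (vmode v) (heis h)"
    by (induction v rule: VL_basis_induct)
       (auto simp: vmode_bvec vmode_add vmode_scl field_like_heis vertex_basis_eq fock_heis_local
         local_to_add local_to_scl)
  then show ?thesis by (rule local_to_sym)
qed

lemma vmode_heis_mult: "vmode (creat h r * v) = normal_prod (div_deriv r (heis h)) (vmode v)"
proof -
  note V = field_like_vmode creative_vmode covariant_vmode local_to_vmode
  note H = field_like_heis creative_heis covariant_heis
  have dl: "local_to (div_deriv r (heis h)) (vmode v)" for v
    by (intro local_to_div_deriv heis_vmode_local V)
  have D: "field_like (div_deriv r (heis h))" "creative (div_deriv r (heis h))" "covariant transl (div_deriv r (heis h))"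
    by (intro field_like_div_deriv creative_div_deriv covariant_div_deriv H lin_transl)+
  have "normal_prod (div_deriv r (heis h)) (vmode v) = vmode (normal_prod (div_deriv r (heis h)) (vmode v) (-1) 1)"
    by (rule Goddard_uniqueness)
       (rule field_like_normal_prod[OF D(1) V(1)] normal_prod_vacuum(1)[OF D(1) V(1) D(2) V(2)]
         covariant_normal_prod[OF lin_transl D(1,3) V(1,3)] Dong(2)[OF D(1) V(1) V(1) dl dl V(4)])+
  also have "normal_prod (div_deriv r (heis h)) (vmode v) (-1) 1 = creat h r * v"
    by (simp add: normal_prod_vacuum D V vmode_vacuum div_deriv_vacuum heis_neg)
  finally show ?thesis by simp
qed

lemma degr_1: "degr 1 = 0"
  using degr_evec[of 0] by (simp add: evec_0 lat_form_0)

lemma vmode_creat: "vmode (creat h 0) = heis h"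
proof -
  have "heis h = vmode (heis h (-1) 1)"
  by (rule Goddard_uniqueness[OF field_like_heis creative_heis covariant_heis heis_vmode_local])
  then show ?thesis by (simp add: heis_neg)
qed

lemma degr_creat_0: "degr (creat h 0) = of_nat 1 *\<^sub>V creat h 0"
  using degr_creat[of h 0 1] by (simp add: degr_1)

lemma Sum_any_interval:
  assumes "\<And>j::int. j < a \<Longrightarrow> g j = 0" "\<And>j. j > b \<Longrightarrow> g j = 0"
  shows "Sum_any g = sum_list (map g [a..b])"
proof -
  have "Sum_any g = sum g {a..b}"
    using assms by (intro Sum_any.expand_superset) (auto simp: not_less[symmetric])
  then show ?thesis by (metis set_upto sum_set_upto_conv_sum_list_int)
qed

text \<open>Below the first range the mode of \<open>v\<close> exceeds what the weights allow on
  \<open>u\<close>; above the second one h(j) kills \<open>u\<close>. Both ranges are concrete once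
  k, p, q are numbers, so they can be unfolded.\<close>

lemma vmode_creat_mult:
  assumes v: "degr v = of_nat p *\<^sub>V v" and u: "degr u = of_nat q *\<^sub>V u"
  shows "vmode (creat h 0 * v) k u = (\<Sum>j\<leftarrow>[k - int (p + q)..-1]. heis h j (vmode v (k - j - 1) u))
     + (\<Sum>j\<leftarrow>[0..int q]. vmode v (k - j - 1) (heis h j u))"
proof -
  let ?g = "\<lambda>j. if j < 0 then heis h j (vmode v (k - j - 1) u) else vmode v (k - j - 1) (heis h j u)"
  have high: "heis h j u = 0" if "j > int q" for j
    using vmode_high[OF degr_creat_0 u, of j] that by (simp add: vmode_creat)
  have low: "vmode v (k - j - 1) u = 0" if "j < k - int (p + q)" for j
    using vmode_high[OF v u, of "k - j - 1"] that by simp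
  have "vmode (creat h 0 * v) k u = Sum_any ?g"
    by (simp add: vmode_heis_mult div_deriv_0 normal_prod_def)
  also have "\<dots> = Sum_any (\<lambda>j. if j < 0 then ?g j else 0) + Sum_any (\<lambda>j. if j < 0 then 0 else ?g j)"
  proof (subst Sum_any.distrib[symmetric])
    have f: "finite {j. ?g j \<noteq> 0}"
      by (rule normal_prod_finite[OF field_like_heis field_like_vmode])
    show "finite {j. (if j < 0 then ?g j else 0) \<noteq> 0}" "finite {j. (if j < 0 then 0 else ?g j) \<noteq> 0}"
      by (rule finite_subset[OF _ f], auto)+
    show "Sum_any ?g = Sum_any (\<lambda>j. (if j < 0 then ?g j else 0) + (if j < 0 then 0 else ?g j))"
      by (rule Sum_any.cong) auto
  qed
  also have "Sum_any (\<lambda>j. if j < 0 then ?g j else 0) = (\<Sum>j\<leftarrow>[k - int (p + q)..-1]. if j < 0 then ?g j else 0)"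
    by (rule Sum_any_interval) (simp_all add: low lin_0[OF lin_heis])
  also have "\<dots> = (\<Sum>j\<leftarrow>[k - int (p + q)..-1]. heis h j (vmode v (k - j - 1) u))"
    by (intro arg_cong[where f = sum_list] map_cong) auto
  also have "Sum_any (\<lambda>j. if j < 0 then 0 else ?g j) = (\<Sum>j\<leftarrow>[0..int q]. if j < 0 then 0 else ?g j)"
    by (rule Sum_any_interval) (simp_all add: high lin_0[OF lin_vmode])
  also have "\<dots> = (\<Sum>j\<leftarrow>[0..int q]. vmode v (k - j - 1) (heis h j u))"
    by (intro arg_cong[where f = sum_list] map_cong) auto
  finally show ?thesis .
qed

lemma transl_creat: "transl (creat h n * u) = creat h n * transl u + of_nat (n + 1) *\<^sub>V (creat h (n + 1) * u)"
  using covariantD[OF covariant_heis, of h "- int n - 1" u] by (simp add: heis_neg nat_add_distrib)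

lemma transl_evec: "transl (evec \<gamma>) = creat (lat_emb \<gamma>) 0 * evec \<gamma>"
  using transl_exp_minus_evec[of 0 0 \<gamma>] by (simp add: exp_minus_0 heis_neg)

section \<open>States and modes in terms of beta_1, beta_2\<close>

definition X :: "nat \<Rightarrow> VL" where "X k = creat (lat_emb (1, 0)) k"
definition Y :: "nat \<Rightarrow> VL" where "Y k = creat (lat_emb (0, 1)) k"
definition hz :: "lat \<Rightarrow> int \<Rightarrow> VL \<Rightarrow> VL" where "hz a = heis (lat_emb a)"
text \<open>The coefficient of \<open>z\<^sup>p\<close> in \<open>exp (\<Sum>\<^sub>n\<^sub>>\<^sub>0 c(-n)/n z\<^sup>n) e\<^sup>f\<close>.\<close>

definition Sf :: "lat \<Rightarrow> int \<Rightarrow> lat \<Rightarrow> VL" where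
  "Sf c p f = (if p < 0 then 0 else exp_minus c (nat p) (evec f))"

lemma creat_lat_emb: "creat (lat_emb a) k = of_int (fst a) *\<^sub>V X k + of_int (snd a) *\<^sub>V Y k"
  by (simp add: X_def Y_def creat_def lat_emb_def VL.scale_right_distrib mult.commute)

lemma lin_hz: "lin (hz a k)" by (simp add: hz_def lin_heis)

lemma hz_neg: "k < 0 \<Longrightarrow> hz a k u = of_int (fst a) *\<^sub>V (X (nat (- k - 1)) * u) + of_int (snd a) *\<^sub>V (Y (nat (- k - 1)) * u)"
  by (simp add: hz_def heis_neg creat_lat_emb distrib_right scl_mult_left)

lemma hz_creat_pos: "k > 0 \<Longrightarrow> hz a k (creat (lat_emb b) l * u) = creat (lat_emb b) l * hz a k u
    + (if k = int l + 1 then of_int (k * lat_form a b) *\<^sub>V u else 0)"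
  by (simp add: hz_def heis_pos_mult_creat form_lat_emb)

lemma hz_pos:
  "k > 0 \<Longrightarrow> hz a k (X l * u) = X l * hz a k u + (if k = int l + 1 then of_int (k * lat_form a (1, 0)) *\<^sub>V u else 0)"
  "k > 0 \<Longrightarrow> hz a k (Y l * u) = Y l * hz a k u + (if k = int l + 1 then of_int (k * lat_form a (0, 1)) *\<^sub>V u else 0)"
  "k > 0 \<Longrightarrow> hz a k (evec d) = 0"
  unfolding X_def Y_def by (simp_all only: hz_creat_pos) (simp add: hz_def heis_pos_evec)

lemma hz_0:
  "hz a 0 (X l * u) = X l * hz a 0 u" "hz a 0 (Y l * u) = Y l * hz a 0 u"
  "hz a 0 (evec d) = of_int (lat_form a d) *\<^sub>V evec d"
  by (simp_all add: hz_def X_def Y_def heis_0_mult_creat heis_0_evec form_lat_emb)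

lemma exp_field_state:
  "exp_field c n (X l * u) = X l * exp_field c n u - of_int (lat_form c (1, 0)) *\<^sub>V exp_field c (n - int l - 1) u"
  "exp_field c n (Y l * u) = Y l * exp_field c n u - of_int (lat_form c (0, 1)) *\<^sub>V exp_field c (n - int l - 1) u"
  "exp_field c n (evec d) = Sf c (- n - 1 - lat_form c d) (c + d)"
  using exp_field_heis[of c n "lat_emb (1, 0)" "- int l - 1" u] exp_field_heis[of c n "lat_emb (0, 1)" "- int l - 1" u]
  by (simp_all add: X_def Y_def heis_neg form_lat_emb lat_form_sym[of _ c] Sf_def exp_field_evec Let_def algebra_simps)

lemma Sf_neg: "p < 0 \<Longrightarrow> Sf c p f = 0" by (simp add: Sf_def)

lemma Sf_rec: "of_nat k *\<^sub>V Sf c (int k) f = (\<Sum>i=1..k. hz c (- int i) (Sf c (int k - int i) f))"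
  unfolding Sf_def hz_def using exp_minus_rec[of k c "evec f"]
  by (simp add: of_nat_diff[symmetric] cong: sum.cong) (intro sum.cong, auto simp: nat_diff_distrib)

text \<open>These are complete homogeneous symmetric functions with the c(-i) as power sums. Degree
  4 is the highest that occurs, as the products evaluated directly have weight at most 4.\<close>

lemma Sf_simps:
  "Sf c 0 f = evec f"
  "Sf c 1 f = hz c (-1) (evec f)"
  "Sf c 2 f = (1 / 2) *\<^sub>V (hz c (-1) (Sf c 1 f) + hz c (-2) (evec f))"
  "Sf c 3 f = (1 / 3) *\<^sub>V (hz c (-1) (Sf c 2 f) + hz c (-2) (Sf c 1 f) + hz c (-3) (evec f))"
  "Sf c 4 f = (1 / 4) *\<^sub>V (hz c (-1) (Sf c 3 f) + hz c (-2) (Sf c 2 f) + hz c (-3) (Sf c 1 f) + hz c (-4) (evec f))"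
proof -
  have d: "v = (1 / c) *\<^sub>V w" if "c *\<^sub>V v = w" "c \<noteq> 0" for c v w using that by auto
  show 0: "Sf c 0 f = evec f" by (simp add: Sf_def exp_minus_0)
  show "Sf c 1 f = hz c (-1) (evec f)" using Sf_rec[of 1 c f] by (simp add: 0)
  show "Sf c 2 f = (1 / 2) *\<^sub>V (hz c (-1) (Sf c 1 f) + hz c (-2) (evec f))"
    using Sf_rec[of 2 c f] by (intro d) (simp_all add: 0 numeral_eq_Suc)
  show "Sf c 3 f = (1 / 3) *\<^sub>V (hz c (-1) (Sf c 2 f) + hz c (-2) (Sf c 1 f) + hz c (-3) (evec f))"
    using Sf_rec[of 3 c f] by (intro d) (simp_all add: 0 numeral_eq_Suc)
  show "Sf c 4 f = (1 / 4) *\<^sub>V (hz c (-1) (Sf c 3 f) + hz c (-2) (Sf c 2 f) + hz c (-3) (Sf c 1 f) + hz c (-4) (evec f))"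
    using Sf_rec[of 4 c f] by (intro d) (simp_all add: 0 numeral_eq_Suc)
qed

lemma transl_state:
  "transl (X l * u) = X l * transl u + of_nat (l + 1) *\<^sub>V (X (l + 1) * u)"
  "transl (Y l * u) = Y l * transl u + of_nat (l + 1) *\<^sub>V (Y (l + 1) * u)"
  "transl (evec d) = of_int (fst d) *\<^sub>V (X 0 * evec d) + of_int (snd d) *\<^sub>V (Y 0 * evec d)"
proof -
  show "transl (X l * u) = X l * transl u + of_nat (l + 1) *\<^sub>V (X (l + 1) * u)"
    "transl (Y l * u) = Y l * transl u + of_nat (l + 1) *\<^sub>V (Y (l + 1) * u)"
    unfolding X_def Y_def by (rule transl_creat)+
  show "transl (evec d) = of_int (fst d) *\<^sub>V (X 0 * evec d) + of_int (snd d) *\<^sub>V (Y 0 * evec d)"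
    by (simp only: transl_evec creat_lat_emb distrib_right scl_mult_left)
qed

lemma degr_state:
  "degr (X l * u) = X l * degr u + of_nat (l + 1) *\<^sub>V (X l * u)"
  "degr (Y l * u) = Y l * degr u + of_nat (l + 1) *\<^sub>V (Y l * u)"
  unfolding X_def Y_def by (simp_all only: degr_creat)

text \<open>Numeral scalars become ring elements of \<open>VL\<close>, so that ring normalisation
  can collect equal monomials.\<close>

lemma scl_numeral:
  "numeral w *\<^sub>V v = numeral w * v"
  "c *\<^sub>V (numeral w * v) = (c * numeral w) *\<^sub>V v"
proof -
  have 1: "numeral w *\<^sub>V v = numeral w * v" for w v
    by (simp add: scl_eq_mult)
  show "numeral w *\<^sub>V v = numeral w * v" by (rule 1)
  show "c *\<^sub>V (numeral w * v) = (c * numeral w) *\<^sub>V v" unfolding 1[symmetric] by simp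
qed

lemma lin_numeral: "lin f \<Longrightarrow> f (numeral w * u) = numeral w * f u"
  using lin_scl[of f "numeral w" u] by (simp add: scl_numeral)

lemma XY_numeral: "X l * (numeral w * u) = numeral w * (X l * u)" "Y l * (numeral w * u) = numeral w * (Y l * u)"
  by (simp_all add: mult.left_commute)

text \<open>Serves to clear denominators: an explicit identity of states is first multiplied by a
  common multiple of its denominators, after which its coefficients are integers.\<close>

lemma scl_cancel: "c \<noteq> 0 \<Longrightarrow> c *\<^sub>V x = c *\<^sub>V y \<Longrightarrow> x = y"
  by simp

lemma vmode_X_mult:
  assumes v: "degr v = of_nat p *\<^sub>V v" and u: "degr u = of_nat q *\<^sub>V u"
  shows "vmode (X 0 * v) k u = (\<Sum>j\<leftarrow>[k - int (p + q)..-1]. hz (1, 0) j (vmode v (k - j - 1) u))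
     + (\<Sum>j\<leftarrow>[0..int q]. vmode v (k - j - 1) (hz (1, 0) j u))"
   "vmode (Y 0 * v) k u = (\<Sum>j\<leftarrow>[k - int (p + q)..-1]. hz (0, 1) j (vmode v (k - j - 1) u))
     + (\<Sum>j\<leftarrow>[0..int q]. vmode v (k - j - 1) (hz (0, 1) j u))"
  unfolding X_def Y_def hz_def by (rule vmode_creat_mult[OF assms])+

lemma vmode_X: "vmode (X 0 * evec (0, 0)) = hz (1, 0)" "vmode (Y 0 * evec (0, 0)) = hz (0, 1)"
  using evec_0 by (simp_all add: X_def Y_def hz_def vmode_creat zero_prod_def)

lemma degr_XY: "degr (X 0 * evec (0, 0)) = of_nat 1 *\<^sub>V (X 0 * evec (0, 0))" "degr (Y 0 * evec (0, 0)) = of_nat 1 *\<^sub>V (Y 0 * evec (0, 0))"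
  using evec_0 by (simp_all add: X_def Y_def degr_creat_0[simplified] zero_prod_def)

text \<open>In the next definitions \<open>q\<close> is the weight of \<open>u\<close>; it bounds the modes that contribute.\<close>

definition quad :: "lat \<Rightarrow> lat \<Rightarrow> nat \<Rightarrow> int \<Rightarrow> VL \<Rightarrow> VL" where
  "quad a b q k u = (\<Sum>j\<leftarrow>[k - int (1 + q)..-1]. hz a j (hz b (k - j - 1) u))
     + (\<Sum>j\<leftarrow>[0..int q]. hz b (k - j - 1) (hz a j u))"

lemma vmode_quad:
  assumes "degr u = of_nat q *\<^sub>V u"
  shows "vmode (X 0 * (X 0 * evec (0, 0))) k u = quad (1, 0) (1, 0) q k u"
    "vmode (X 0 * (Y 0 * evec (0, 0))) k u = quad (1, 0) (0, 1) q k u"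
    "vmode (Y 0 * (Y 0 * evec (0, 0))) k u = quad (0, 1) (0, 1) q k u"
  unfolding quad_def vmode_X_mult(1)[OF degr_XY(1) assms] vmode_X_mult(1)[OF degr_XY(2) assms]
    vmode_X_mult(2)[OF degr_XY(2) assms] vmode_X by simp_all

definition omega_XY :: VL where
  "omega_XY = (1 / 10) *\<^sub>V (X 0 * (X 0 * evec (0, 0))) + (1 / 10) *\<^sub>V (X 0 * (Y 0 * evec (0, 0)))
    + (1 / 10) *\<^sub>V (Y 0 * (Y 0 * evec (0, 0)))
    - (1 / 5) *\<^sub>V (evec (1, 0) + evec (-1, 0) + evec (0, 1) + evec (0, -1) + evec (1, 1) + evec (-1, -1))"

text \<open>With beta = sqrt 2 alpha, the square of alpha(-1) is half that of beta(-1), so the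
  irrational factor disappears.\<close>

lemma w_vec_eq: "w_vec r = (1 / 4) *\<^sub>V (creat (lat_emb r) 0 * creat (lat_emb r) 0) - (evec r + evec (- r))"
proof -
  have "creat (lat_emb r) 0 = of_real (sqrt 2) *\<^sub>V creat (root_comb r) 0"
    by (simp add: creat_def lat_emb_def root_comb_def VL.scale_right_distrib)
  moreover have "complex_of_real (sqrt 2) * complex_of_real (sqrt 2) = 2"
    by (simp flip: of_real_mult)
  ultimately have "creat (lat_emb r) 0 * creat (lat_emb r) 0 = 2 *\<^sub>V (creat (root_comb r) 0 * creat (root_comb r) 0)"
    by (simp add: scl_mult_left scl_mult_right)
  then show ?thesis by (simp add: w_vec_def heis_neg)
qed

lemmas lins = lin_add[OF lin_hz] lin_scl[OF lin_hz] lin_diff[OF lin_hz] lin_minus[OF lin_hz] lin_0[OF lin_hz]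
  exp_field_lin lin_diff[OF lin_exp_field] lin_minus[OF lin_exp_field] lin_0[OF lin_exp_field]
  transl_lin lin_diff[OF lin_transl] lin_minus[OF lin_transl] lin_0[OF lin_transl]
  degr_lin lin_diff[OF lin_degr] lin_minus[OF lin_degr] lin_0[OF lin_degr]

lemmas scls = VL.scale_right_distrib VL.scale_right_diff_distrib scl_mult_left scl_mult_right
  distrib_left distrib_right right_diff_distrib left_diff_distrib

lemmas modes = hz_neg hz_pos hz_0 exp_field_state Sf_neg Sf_simps transl_state degr_state degr_evec

lemma evec_00: "evec (0, 0) = 1" using evec_0 by (simp add: zero_prod_def)

text \<open>The squares of beta_0, beta_1, beta_2 add up to 2 (beta_1^2 + beta_1 beta_2 + beta_2^2).
  Times 1/4 from each w and 1/5 from omega, this gives the coefficient 1/10.\<close>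

lemma omega_eq: "omega = omega_XY"
  by (rule scl_cancel[of 20], simp,
      simp add: omega_def omega_XY_def w_vec_eq \<alpha>\<^sub>0_def \<alpha>\<^sub>1_def \<alpha>\<^sub>2_def creat_lat_emb evec_00 scls
        del: VL.scale_cancel_left; simp add: scl_numeral algebra_simps)

lemma degr_omega_XY: "degr omega_XY = of_nat 2 *\<^sub>V omega_XY"
  by (simp add: omega_XY_def lins modes lat_form_def scls scl_numeral)

lemma vmode_omega_XY:
  assumes "degr u = of_nat q *\<^sub>V u"
  shows "vmode omega_XY k u = (1 / 10) *\<^sub>V quad (1, 0) (1, 0) q k u + (1 / 10) *\<^sub>V quad (1, 0) (0, 1) q k u
    + (1 / 10) *\<^sub>V quad (0, 1) (0, 1) q k u - (1 / 5) *\<^sub>V (exp_field (1, 0) k u + exp_field (-1, 0) k u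
      + exp_field (0, 1) k u + exp_field (0, -1) k u + exp_field (1, 1) k u + exp_field (-1, -1) k u)"
  by (simp add: omega_XY_def vmode_add vmode_diff vmode_scl vmode_quad[OF assms] vmode_evec)

lemma upto_int:
  "[0..numeral n] = 0 # [1..numeral n :: int]" "[1..numeral n] = 1 # [2..numeral n :: int]"
  "[- numeral n..-1] = - numeral n # [- numeral n + 1..-1 :: int]" "[0..0::int] = [0]" "[1..1::int] = [1]"
  "[- 1..- 1::int] = [- 1]" "[0..1::int] = [0, 1]"
  by (subst upto.simps, simp)+

lemmas calc = lins modes lin_numeral[OF lin_hz] lin_numeral[OF lin_exp_field] lin_numeral[OF lin_transl]
  lin_numeral[OF lin_degr] XY_numeral lat_form_def scls scl_numeral upto_rec_numeral upto_int

text \<open>J written out in the monomial basis. The linear factor in front of each exponential is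
  orthogonal to its exponent, for instance 2 beta_1 + beta_2 to beta_2.\<close>

definition J_XY :: VL where
  "J_XY = (1 / 2) *\<^sub>V (X 0 * (Y 1 * evec (0, 0))) - (1 / 2) *\<^sub>V (X 1 * (Y 0 * evec (0, 0)))
    + 2 *\<^sub>V (X 0 * evec (0, 1)) + Y 0 * evec (0, 1) - 2 *\<^sub>V (X 0 * evec (0, -1)) - Y 0 * evec (0, -1)
    - X 0 * evec (1, 0) - 2 *\<^sub>V (Y 0 * evec (1, 0)) + X 0 * evec (-1, 0) + 2 *\<^sub>V (Y 0 * evec (-1, 0))
    + X 0 * evec (1, 1) - Y 0 * evec (1, 1) - X 0 * evec (-1, -1) + Y 0 * evec (-1, -1)"

definition w1_XY :: VL where "w1_XY = (1 / 4) *\<^sub>V (X 0 * (X 0 * evec (0, 0))) - (evec (1, 0) + evec (-1, 0))"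
definition w2_XY :: VL where "w2_XY = (1 / 4) *\<^sub>V (Y 0 * (Y 0 * evec (0, 0))) - (evec (0, 1) + evec (0, -1))"

lemma w1_eq: "w_vec \<alpha>\<^sub>1 = w1_XY" and w2_eq: "w_vec \<alpha>\<^sub>2 = w2_XY"
  by (simp_all add: w_vec_eq \<alpha>\<^sub>1_def \<alpha>\<^sub>2_def w1_XY_def w2_XY_def creat_lat_emb evec_00)

lemma degr_w: "degr w1_XY = of_nat 2 *\<^sub>V w1_XY" "degr w2_XY = of_nat 2 *\<^sub>V w2_XY"
  by (simp_all add: w1_XY_def w2_XY_def calc)

lemma vmode_w:
  assumes "degr u = of_nat q *\<^sub>V u"
  shows "vmode w1_XY k u = (1 / 4) *\<^sub>V quad (1, 0) (1, 0) q k u - (exp_field (1, 0) k u + exp_field (-1, 0) k u)"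
    "vmode w2_XY k u = (1 / 4) *\<^sub>V quad (0, 1) (0, 1) q k u - (exp_field (0, 1) k u + exp_field (0, -1) k u)"
  by (simp_all add: w1_XY_def w2_XY_def vmode_add vmode_diff vmode_scl vmode_quad[OF assms] vmode_evec)

lemma YX: "Y i * (X j * u) = X j * (Y i * u)" "X 1 * (X 0 * u) = X 0 * (X 1 * u)"
  by (simp_all add: mult.left_commute)

lemma J_eq: "J_vec = J_XY"
  by (rule scl_cancel[of 4], simp,
      unfold J_vec_def w1_eq w2_eq vmode_w[OF degr_w(1)] vmode_w[OF degr_w(2)] quad_def,
      simp add: w1_XY_def w2_XY_def J_XY_def calc YX del: VL.scale_cancel_left; simp add: algebra_simps)

lemma degr_J_XY: "degr J_XY = of_nat 3 *\<^sub>V J_XY"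
  by (simp add: J_XY_def calc)

text \<open>Modes of the normally ordered product of beta_1(z) and the derivative of beta_2(z); the
  factor j + 1 - k is due to the derivative.\<close>

definition quad1 :: "nat \<Rightarrow> int \<Rightarrow> VL \<Rightarrow> VL" where
  "quad1 q k u = (\<Sum>j\<leftarrow>[k - 2 - int q..-1]. of_int (j + 1 - k) *\<^sub>V hz (1, 0) j (hz (0, 1) (k - j - 2) u))
     + (\<Sum>j\<leftarrow>[0..int q]. of_int (j + 1 - k) *\<^sub>V hz (0, 1) (k - j - 2) (hz (1, 0) j u))"

lemma degr_Y1: "degr (Y 1 * evec (0, 0)) = of_nat 2 *\<^sub>V (Y 1 * evec (0, 0))"
  by (simp add: calc)

lemma vmode_X0_Y1:
  assumes "degr u = of_nat q *\<^sub>V u"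
  shows "vmode (X 0 * (Y 1 * evec (0, 0))) k u = quad1 q k u"
proof -
  have "Y 1 * evec (0, 0) = transl (Y 0 * evec (0, 0))" by (simp add: calc)
  then have v: "vmode (Y 1 * evec (0, 0)) n w = of_int (- n) *\<^sub>V hz (0, 1) (n - 1) w" for n w
    by (simp only: vmode_transl deriv_field_def vmode_X)
  have e: "k - int (2 + q) = k - 2 - int q" "k - j - 1 - 1 = k - j - 2" "- (k - j - 1) = j + 1 - k" for j by simp_all
  show ?thesis
    unfolding quad1_def vmode_X_mult(1)[OF degr_Y1 assms] v lin_scl[OF lin_hz] e ..
qed

definition expq :: "lat \<Rightarrow> lat \<Rightarrow> nat \<Rightarrow> int \<Rightarrow> VL \<Rightarrow> VL" where
  "expq h c q k u = (\<Sum>j\<leftarrow>[k - 2 - int q..-1]. hz h j (exp_field c (k - j - 1) u))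
     + (\<Sum>j\<leftarrow>[0..int q]. exp_field c (k - j - 1) (hz h j u))"

lemma vmode_expq:
  assumes "degr u = of_nat q *\<^sub>V u" "lat_form c c = 4"
  shows "vmode (creat (lat_emb h) 0 * evec c) k u = expq h c q k u"
proof -
  have "degr (evec c) = of_nat 2 *\<^sub>V evec c" by (simp add: degr_evec assms)
  then have "vmode (creat (lat_emb h) 0 * evec c) k u
    = (\<Sum>j\<leftarrow>[k - int (2 + q)..-1]. heis (lat_emb h) j (vmode (evec c) (k - j - 1) u))
     + (\<Sum>j\<leftarrow>[0..int q]. vmode (evec c) (k - j - 1) (heis (lat_emb h) j u))"
    by (rule vmode_creat_mult[OF _ assms(1)])
  moreover have e: "k - int (2 + q) = k - 2 - int q" by simp
  ultimately show ?thesis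
    unfolding expq_def hz_def vmode_evec e by simp
qed

text \<open>beta_1(-2) beta_2(-1) is traded for T (beta_1(-1) beta_2(-1)), whose modes are known, so
  that only one product with a differentiated factor remains.\<close>

lemma J_XY_alt: "J_XY = X 0 * (Y 1 * evec (0, 0)) - (1 / 2) *\<^sub>V transl (X 0 * (Y 0 * evec (0, 0)))
  + (creat (lat_emb (2, 1)) 0 * evec (0, 1) + creat (lat_emb (-2, -1)) 0 * evec (0, -1)
    + creat (lat_emb (-1, -2)) 0 * evec (1, 0) + creat (lat_emb (1, 2)) 0 * evec (-1, 0)
    + creat (lat_emb (1, -1)) 0 * evec (1, 1) + creat (lat_emb (-1, 1)) 0 * evec (-1, -1))"
  by (rule scl_cancel[of 2], simp,
      simp add: J_XY_def calc creat_lat_emb YX del: VL.scale_cancel_left; simp add: algebra_simps)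

lemma vmode_J_XY:
  assumes "degr u = of_nat q *\<^sub>V u"
  shows "vmode J_XY k u = quad1 q k u + (of_int k / 2) *\<^sub>V quad (1, 0) (0, 1) q (k - 1) u
    + (expq (2, 1) (0, 1) q k u + expq (-2, -1) (0, -1) q k u + expq (-1, -2) (1, 0) q k u
      + expq (1, 2) (-1, 0) q k u + expq (1, -1) (1, 1) q k u + expq (-1, 1) (-1, -1) q k u)"
proof -
  have n: "lat_form (0, 1) (0, 1) = 4" "lat_form (0, -1) (0, -1) = 4" "lat_form (1, 0) (1, 0) = 4"
    "lat_form (-1, 0) (-1, 0) = 4" "lat_form (1, 1) (1, 1) = 4" "lat_form (-1, -1) (-1, -1) = 4"
    by (simp_all add: lat_form_def)
  show ?thesis
    unfolding J_XY_alt vmode_add vmode_diff vmode_scl vmode_transl deriv_field_def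
      vmode_X0_Y1[OF assms] vmode_quad(2)[OF assms] n[THEN vmode_expq[OF assms]] by simp
qed

section \<open>The products of omega and J\<close>

definition Lam :: VL where "Lam = vmode omega_XY (-1) omega_XY"

lemmas states = omega_XY_def J_XY_def YX numeral_2_eq_2[symmetric]

text \<open>3/5 is half the central charge 6/5. The first identity is a genuine computation, since
  \<open>transl\<close> belongs to another conformal vector.\<close>

lemma omega_omega:
  "vmode omega_XY 0 omega_XY = transl omega_XY" "vmode omega_XY 1 omega_XY = 2 *\<^sub>V omega_XY"
  "vmode omega_XY 2 omega_XY = 0" "vmode omega_XY 3 omega_XY = (3 / 5) *\<^sub>V evec (0, 0)"
  by ((rule scl_cancel[of 300], simp, unfold vmode_omega_XY[OF degr_omega_XY] quad_def,
      simp add: states calc del: VL.scale_cancel_left; simp add: algebra_simps)+)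

text \<open>J is a primary vector of weight 3 for omega; five products cover all i below 2 +
  3.\<close>

lemma omega_J:
  "vmode omega_XY 0 J_XY = transl J_XY" "vmode omega_XY 1 J_XY = 3 *\<^sub>V J_XY" "vmode omega_XY 2 J_XY = 0"
  "vmode omega_XY 3 J_XY = 0" "vmode omega_XY 4 J_XY = 0"
  by ((rule scl_cancel[of 60], simp, unfold vmode_omega_XY[OF degr_J_XY] quad_def,
      simp add: states calc del: VL.scale_cancel_left; simp add: algebra_simps)+)

lemma J_5_J: "vmode J_XY 5 J_XY = (- 84) *\<^sub>V evec (0, 0)"
  by (rule scl_cancel[of 4], simp, unfold vmode_J_XY[OF degr_J_XY] quad_def quad1_def expq_def,
      simp add: states calc del: VL.scale_cancel_left; simp add: algebra_simps)

lemma J_4_J: "vmode J_XY 4 J_XY = 0"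
  by (rule scl_cancel[of 4], simp, unfold vmode_J_XY[OF degr_J_XY] quad_def quad1_def expq_def,
      simp add: states calc del: VL.scale_cancel_left; simp add: algebra_simps)

lemma J_3_J: "vmode J_XY 3 J_XY = (- 420) *\<^sub>V omega_XY"
  by (rule scl_cancel[of 4], simp, unfold vmode_J_XY[OF degr_J_XY] quad_def quad1_def expq_def,
      simp add: states calc del: VL.scale_cancel_left; simp add: algebra_simps)

lemma J_2_J: "vmode J_XY 2 J_XY = (- 210) *\<^sub>V transl omega_XY"
  by (rule scl_cancel[of 12], simp, unfold vmode_J_XY[OF degr_J_XY] quad_def quad1_def expq_def,
      simp add: states calc del: VL.scale_cancel_left; simp add: algebra_simps)

text \<open>Of weight 4, where the composite \<open>Lam\<close> first enters; it is expanded in the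
  monomial basis together with the left side.\<close>

lemma J_1_J: "vmode J_XY 1 J_XY = (- 240) *\<^sub>V Lam + 9 *\<^sub>V transl (transl omega_XY)"
  by (rule scl_cancel[of 1200], simp, unfold Lam_def vmode_omega_XY[OF degr_omega_XY] vmode_J_XY[OF degr_J_XY] quad_def quad1_def expq_def,
      simp add: states calc del: VL.scale_cancel_left; simp add: algebra_simps)

section \<open>The commutation relations\<close>

lemma gbinomial_minus_one: "((- 1 :: complex) gchoose i) = (- 1) ^ i"
  using gbinomial_minus[of "1 :: complex" i] by (simp flip: binomial_gbinomial)

text \<open>Both expansions of the commutator \<open>[v\<^sub>-\<^sub>1, w\<^sub>0]\<close> are applied to the vacuum.\<close>

lemma skew_symmetry_0:
  assumes v: "degr v = of_nat p *\<^sub>V v" and w: "degr w = of_nat q *\<^sub>V w" and "p + q > 0"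
  shows "vmode w 0 v = - (\<Sum>i<p + q. (- 1) ^ i *\<^sub>V vmode (vmode v (int i) w) (- 1 - int i) 1)"
proof -
  have "(\<Sum>i<p + q. (- 1) ^ i *\<^sub>V vmode (vmode v (int i) w) (- 1 - int i) 1)
    = commutator (vmode v (-1)) (vmode w 0) 1"
    by (simp add: vmode_commutator[OF v w] gbinomial_minus_one)
  also have "\<dots> = - commutator (vmode w 0) (vmode v (-1)) 1"
    by (simp add: commutator_def)
  also have "commutator (vmode w 0) (vmode v (-1)) 1
     = (\<Sum>i<q + p. ((0 :: complex) gchoose i) *\<^sub>V vmode (vmode w (int i) v) (- 1 - int i) 1)"
    by (simp add: vmode_commutator[OF w v])
  also have "\<dots> = (\<Sum>i\<in>{0}. ((0 :: complex) gchoose i) *\<^sub>V vmode (vmode w (int i) v) (- 1 - int i) 1)"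
    using assms(3) by (intro sum.mono_neutral_right) (auto simp: gbinomial_0_left)
  also have "\<dots> = vmode w 0 v" by (simp add: vmode_vacuum)
  finally show ?thesis by simp
qed

lemma vmode_transl_apply: "vmode (transl v) k u = of_int (- k) *\<^sub>V vmode v (k - 1) u"
  by (simp only: vmode_transl deriv_field_def)

lemma vmode_uminus: "vmode (- v) k u = - vmode v k u"
  by (rule lin_minus[OF lin_vmode_state])

text \<open>This lemma and the next two are instances of v_{-1-n} 1 = T^n v / n!.\<close>

lemma vmode_minus_2: "vmode v (- 2) 1 = transl v"
  using vmode_transl_apply[of v "-1" 1] by (simp add: vmode_vacuum)

lemma vmode_minus_3: "vmode v (- 3) 1 = (1 / 2) *\<^sub>V transl (transl v)"
  using vmode_transl_apply[of v "-2" 1] by (simp add: vmode_minus_2)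

lemma vmode_minus_4: "vmode v (- 4) 1 = (1 / 6) *\<^sub>V transl (transl (transl v))"
proof (rule scl_cancel[of 3])
  show "3 *\<^sub>V vmode v (- 4) 1 = 3 *\<^sub>V (1 / 6) *\<^sub>V transl (transl (transl v))"
    using vmode_transl_apply[of v "-3" 1] by (simp add: vmode_minus_3)
qed simp

lemma vmode_evec_00: "vmode (evec (0, 0)) k u = (if k = - 1 then u else 0)"
  using vmode_evec[of 0] exp_field_zero by (simp add: zero_prod_def)

lemma sum_lessThan_small:
  "(\<Sum>i<4. f i) = f 0 + f 1 + f 2 + f (3 :: nat)"
  "(\<Sum>i<5. f i) = f 0 + f 1 + f 2 + f 3 + f (4 :: nat)"
  "(\<Sum>i<6. f i) = f 0 + f 1 + f 2 + f 3 + f 4 + f (5 :: nat)"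
  by (simp_all add: eval_nat_numeral)

text \<open>For two equal states skew symmetry carries J_0 J on both sides with opposite signs,
  hence determines 2 J_0 J by the higher products. The coefficient of T^3 omega is (9 + 105 - 70)/2
  = 22; the constant J_5 J contributes nothing.\<close>

lemma J_0_J: "vmode J_XY 0 J_XY = (- 120) *\<^sub>V transl Lam + 22 *\<^sub>V transl (transl (transl omega_XY))"
proof -
  let ?T = "transl (transl (transl omega_XY))"
  define K where "K = (- 240) *\<^sub>V Lam + 9 *\<^sub>V transl (transl omega_XY)"
  have J1: "vmode J_XY 1 J_XY = K" by (simp only: J_1_J K_def)
  have "vmode J_XY 0 J_XY = - (vmode J_XY 0 J_XY - transl K + vmode ((- 210) *\<^sub>V transl omega_XY) (- 3) 1
     - vmode ((- 420) *\<^sub>V omega_XY) (- 4) 1)"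
    using skew_symmetry_0[OF degr_J_XY degr_J_XY]
    by (simp add: sum_lessThan_small J1 J_2_J J_3_J J_4_J J_5_J vmode_0 vmode_scl vmode_uminus vmode_evec_00 vmode_minus_2 vmode_vacuum)
  also have "vmode ((- 210) *\<^sub>V transl omega_XY) (- 3) 1 = (- 105) *\<^sub>V ?T"
    by (simp only: vmode_scl vmode_minus_3) simp
  also have "vmode ((- 420) *\<^sub>V omega_XY) (- 4) 1 = (- 70) *\<^sub>V ?T"
    by (simp only: vmode_scl vmode_minus_4) simp
  finally have "2 *\<^sub>V vmode J_XY 0 J_XY = transl K + 105 *\<^sub>V ?T - 70 *\<^sub>V ?T"
    by (simp add: scl_numeral)
  also have "transl K = (- 240) *\<^sub>V transl Lam + 9 *\<^sub>V ?T"
    by (simp only: K_def transl_lin)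
  finally have "2 *\<^sub>V vmode J_XY 0 J_XY = 2 *\<^sub>V ((- 120) *\<^sub>V transl Lam + 22 *\<^sub>V ?T)"
    by (simp add: VL.scale_right_distrib VL.scale_right_diff_distrib scl_numeral del: VL.scale_cancel_left)
  then show ?thesis by (rule scl_cancel[rotated]) simp
qed

lemma gbinomial_small:
  fixes x :: complex
  shows "x gchoose 2 = x * (x - 1) / 2" "x gchoose 3 = x * (x - 1) * (x - 2) / 6"
    "x gchoose 4 = x * (x - 1) * (x - 2) * (x - 3) / 24"
    "x gchoose 5 = x * (x - 1) * (x - 2) * (x - 3) * (x - 4) / 120"
  by (simp_all add: gbinomial_prod_rev eval_nat_numeral algebra_simps)

lemma L_op_eq: "L_op n = vmode omega_XY (n + 1)" and J_op_eq: "J_op n = vmode J_XY (n + 2)"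
  by (simp_all add: L_op_def J_op_def omega_eq J_eq)

lemma commutator_L_L:
  "commutator (L_op m) (L_op n) u = of_int (m - n) *\<^sub>V L_op (m + n) u
       + (if m + n = 0 then of_int (m ^ 3 - m) / 12 * (6 / 5) else 0) *\<^sub>V u"
proof -
  have "commutator (L_op m) (L_op n) u = of_int (- (m + n + 2)) *\<^sub>V vmode omega_XY (m + n + 1) u
      + of_int (m + 1) *\<^sub>V 2 *\<^sub>V vmode omega_XY (m + n + 1) u
      + (of_int (m + 1) gchoose 3) *\<^sub>V (3 / 5) *\<^sub>V (if m + n = 0 then u else 0)"
    using vmode_commutator[OF degr_omega_XY degr_omega_XY, of "m + 1" "n + 1" u]
    by (simp add: L_op_eq sum_lessThan_small omega_omega
        vmode_transl_apply vmode_scl vmode_0 vmode_evec_00 add_ac)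
  also have "(of_int (m + 1) gchoose 3) *\<^sub>V (3 / 5) *\<^sub>V (if m + n = 0 then u else 0)
     = (if m + n = 0 then of_int (m ^ 3 - m) / 12 * (6 / 5) else 0) *\<^sub>V u"
  proof -
    have "(of_int (m + 1) gchoose 3) * (3 / 5) = (of_int (m ^ 3 - m) / 12 * (6 / 5) :: complex)"
      by (simp add: gbinomial_small power3_eq_cube field_simps)
    then show ?thesis by simp
  qed
  also have "of_int (- (m + n + 2)) *\<^sub>V vmode omega_XY (m + n + 1) u + of_int (m + 1) *\<^sub>V 2 *\<^sub>V vmode omega_XY (m + n + 1) u
     = of_int (m - n) *\<^sub>V L_op (m + n) u"
    by (simp only: VL.scale_scale VL.scale_left_distrib[symmetric] L_op_eq) (simp add: algebra_simps)
  finally show ?thesis .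
qed

lemma commutator_L_J: "commutator (L_op m) (J_op n) u = of_int (2 * m - n) *\<^sub>V J_op (m + n) u"
proof -
  have "commutator (L_op m) (J_op n) u = of_int (- (m + n + 3)) *\<^sub>V vmode J_XY (m + n + 2) u
      + of_int (m + 1) *\<^sub>V 3 *\<^sub>V vmode J_XY (m + n + 2) u"
    using vmode_commutator[OF degr_omega_XY degr_J_XY, of "m + 1" "n + 2" u]
    by (simp add: L_op_eq J_op_eq sum_lessThan_small omega_J
        vmode_transl_apply vmode_scl vmode_0 add_ac)
  also have "\<dots> = of_int (2 * m - n) *\<^sub>V J_op (m + n) u"
    by (simp only: VL.scale_scale VL.scale_left_distrib[symmetric] J_op_eq) (simp add: algebra_simps)
  finally show ?thesis .
qed

lemma L_L_normal:
  shows "finite {k. k \<le> -2 \<and> L_op k (L_op (s - k) u) \<noteq> 0}" (is "finite ?A")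
    and "finite {k. k \<ge> -1 \<and> L_op (s - k) (L_op k u) \<noteq> 0}" (is "finite ?B")
    and "vmode Lam (s + 3) u = Sum_any (\<lambda>k. if k \<le> -2 then L_op k (L_op (s - k) u) else 0)
            + Sum_any (\<lambda>k. if k \<ge> -1 then L_op (s - k) (L_op k u) else 0)"
proof -
  define g where "g j = (if j < 0 then vmode omega_XY j (vmode omega_XY (s + 3 - j - 1) u)
    else vmode omega_XY (s + 3 - j - 1) (vmode omega_XY j u))" for j
  have fg: "finite {j. g j \<noteq> 0}"
    unfolding g_def by (rule normal_prod_finite[OF field_like_vmode field_like_vmode])
  \<comment> \<open>L(k) is the mode k + 1 of omega, so the cut j < 0 of the normally ordered
    product becomes k <= -2.\<close>
  have e: "g (k + 1) = (if k \<le> -2 then L_op k (L_op (s - k) u) else L_op (s - k) (L_op k u))" for k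
    by (simp add: g_def L_op_eq algebra_simps)
  have f: "finite {k. g (k + 1) \<noteq> 0}"
    using finite_vimageI[OF fg, of "\<lambda>k. k + 1"] by (simp add: vimage_def inj_def)
  show A: "finite ?A" and B: "finite ?B"
    by (rule finite_subset[OF _ f]; force simp: e)+
  have "vmode Lam (s + 3) u = Sum_any g"
    unfolding Lam_def vmode_normal_prod normal_prod_def g_def ..
  also have "\<dots> = Sum_any (\<lambda>k. g (k + 1))" by (rule Sum_any_shift[symmetric])
  also have "\<dots> = Sum_any (\<lambda>k. (if k \<le> -2 then L_op k (L_op (s - k) u) else 0)
      + (if k \<ge> -1 then L_op (s - k) (L_op k u) else 0))"
    unfolding e by (rule Sum_any.cong) auto
  also have "\<dots> = Sum_any (\<lambda>k. if k \<le> -2 then L_op k (L_op (s - k) u) else 0)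
            + Sum_any (\<lambda>k. if k \<ge> -1 then L_op (s - k) (L_op k u) else 0)"
  proof (rule Sum_any.distrib)
    show "finite {k. (if k \<le> -2 then L_op k (L_op (s - k) u) else 0) \<noteq> 0}"
      using A by (rule rev_finite_subset) auto
    show "finite {k. (if k \<ge> -1 then L_op (s - k) (L_op k u) else 0) \<noteq> 0}"
      using B by (rule rev_finite_subset) auto
  qed
  finally show "vmode Lam (s + 3) u = Sum_any (\<lambda>k. if k \<le> -2 then L_op k (L_op (s - k) u) else 0)
            + Sum_any (\<lambda>k. if k \<ge> -1 then L_op (s - k) (L_op k u) else 0)" .
qed

lemma commutator_J_J:
  "commutator (J_op m) (J_op n) u =
    of_int ((m - n) * (22 * (m + n + 2) * (m + n + 3) + 35 * (m + 2) * (n + 2))) *\<^sub>V L_op (m + n) u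
    - of_int (120 * (m - n)) *\<^sub>V vmode Lam (m + n + 3) u
    - (if m + n = 0 then 7 / 10 * of_int (m * (m\<^sup>2 - 1) * (m\<^sup>2 - 4)) else 0) *\<^sub>V u"
proof -
  define s where "s = m + n"
  define w where "w = vmode omega_XY (s + 1) u"
  define l where "l = vmode Lam (s + 3) u"
  have idx: "s + 4 - 1 = s + 3" "s + 3 - 1 = s + 2" "s + 2 - 1 = s + 1" by simp_all
  have T1: "vmode (transl omega_XY) (s + 2) u = of_int (- (s + 2)) *\<^sub>V w"
    and T4: "vmode (transl Lam) (s + 4) u = of_int (- (s + 4)) *\<^sub>V l"
    by (simp_all only: vmode_transl_apply w_def l_def idx)
  have T2: "vmode (transl (transl omega_XY)) (s + 3) u = of_int ((s + 3) * (s + 2)) *\<^sub>V w"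
    by (simp only: vmode_transl_apply[of "transl omega_XY"] idx T1 VL.scale_scale of_int_mult[symmetric] minus_mult_minus)
  have T3: "vmode (transl (transl (transl omega_XY))) (s + 4) u = of_int (- ((s + 4) * (s + 3) * (s + 2))) *\<^sub>V w"
    by (simp only: vmode_transl_apply[of "transl (transl omega_XY)"] idx T2 VL.scale_scale of_int_mult[symmetric]
        mult_minus_left mult.assoc)
  note T = T1 T2 T3 T4
  have C0: "vmode (vmode J_XY 0 J_XY) (s + 4) u = of_int (120 * (s + 4)) *\<^sub>V l + of_int (- (22 * (s + 4) * (s + 3) * (s + 2))) *\<^sub>V w"
    unfolding J_0_J vmode_add vmode_scl T by (simp add: mult_ac)
  have C1: "vmode (vmode J_XY 1 J_XY) (s + 3) u = (- 240) *\<^sub>V l + of_int (9 * (s + 3) * (s + 2)) *\<^sub>V w"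
    unfolding J_1_J vmode_add vmode_scl T l_def by (simp add: mult_ac)
  have C2: "vmode (vmode J_XY 2 J_XY) (s + 2) u = of_int (210 * (s + 2)) *\<^sub>V w"
    unfolding J_2_J vmode_scl T by simp
  have C3: "vmode (vmode J_XY 3 J_XY) (s + 1) u = (- 420) *\<^sub>V w"
    unfolding J_3_J vmode_scl w_def ..
  have C5: "vmode (vmode J_XY 5 J_XY) (s - 1) u = (- 84) *\<^sub>V (if s = 0 then u else 0)"
    unfolding J_5_J vmode_scl vmode_evec_00 by simp
  have i: "m + 2 + (n + 2) - int 0 = s + 4" "m + 2 + (n + 2) - int 1 = s + 3" "m + 2 + (n + 2) - int 2 = s + 2"
    "m + 2 + (n + 2) - int 3 = s + 1" "m + 2 + (n + 2) - int 4 = s" "m + 2 + (n + 2) - int 5 = s - 1"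
    by (simp_all add: s_def)
  let ?b = "\<lambda>i. (of_int (m + 2) :: complex) gchoose i"
  have "commutator (J_op m) (J_op n) u = (\<Sum>i<6. ?b i *\<^sub>V vmode (vmode J_XY (int i) J_XY) (m + 2 + (n + 2) - int i) u)"
    using vmode_commutator[OF degr_J_XY degr_J_XY, of "m + 2" "n + 2" u] by (simp add: J_op_eq)
  also have "\<dots> = ?b 0 *\<^sub>V vmode (vmode J_XY 0 J_XY) (s + 4) u + ?b 1 *\<^sub>V vmode (vmode J_XY 1 J_XY) (s + 3) u
      + ?b 2 *\<^sub>V vmode (vmode J_XY 2 J_XY) (s + 2) u + ?b 3 *\<^sub>V vmode (vmode J_XY 3 J_XY) (s + 1) u
      + ?b 5 *\<^sub>V vmode (vmode J_XY 5 J_XY) (s - 1) u"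
    unfolding sum_lessThan_small i by (simp add: J_4_J vmode_0)
  also have "\<dots> = (?b 0 * of_int (120 * (s + 4)) + ?b 1 * (- 240)) *\<^sub>V l
      + (?b 0 * of_int (- (22 * (s + 4) * (s + 3) * (s + 2))) + ?b 1 * of_int (9 * (s + 3) * (s + 2))
        + ?b 2 * of_int (210 * (s + 2)) + ?b 3 * (- 420)) *\<^sub>V w
      + (?b 5 * (- 84)) *\<^sub>V (if s = 0 then u else 0)"
    unfolding C0 C1 C2 C3 C5 VL.scale_right_distrib VL.scale_scale VL.scale_left_distrib by (simp only: add_ac)
  \<comment> \<open>With s = m + n this is 120 (s + 4) - 240 (m + 2), from T \<open>Lam\<close> in
    J_0 J and \<open>Lam\<close> in J_1 J.\<close>
  also have "?b 0 * of_int (120 * (s + 4)) + ?b 1 * (- 240) = - of_int (120 * (m - n))"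
    by (simp add: s_def algebra_simps)
  also have "?b 0 * of_int (- (22 * (s + 4) * (s + 3) * (s + 2))) + ?b 1 * of_int (9 * (s + 3) * (s + 2))
        + ?b 2 * of_int (210 * (s + 2)) + ?b 3 * (- 420)
     = of_int ((m - n) * (22 * (s + 2) * (s + 3) + 35 * (m + 2) * (n + 2)))"
    by (simp add: s_def gbinomial_small field_simps)
  also have "(?b 5 * (- 84)) *\<^sub>V (if s = 0 then u else 0)
     = - ((if s = 0 then 7 / 10 * of_int (m * (m\<^sup>2 - 1) * (m\<^sup>2 - 4)) else 0) *\<^sub>V u)"
  proof -
    \<comment> \<open>(m+2 choose 5) is (m+2)(m+1)m(m-1)(m-2)/120, and 84/120 = 7/10.\<close>
    have "?b 5 * (- 84) = - (7 / 10 * of_int (m * (m\<^sup>2 - 1) * (m\<^sup>2 - 4)))"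
      by (simp add: gbinomial_small power2_eq_square) (simp add: field_simps)
    then show ?thesis by simp
  qed
  finally show ?thesis
    unfolding l_def w_def s_def L_op_eq by (simp add: algebra_simps)
qed

text \<open>\<open>Sum_any\<close> over an infinite support is 0 by convention; the two finiteness
  claims ensure that the quadratic sums have their intended meaning.\<close>

theorem theorem3p3:
  fixes m n :: int and u :: VL
  shows
    "(commutator (L_op m) (L_op n) u =
       of_int (m - n) *\<^sub>V L_op (m + n) u
       + (if m + n = 0 then of_int (m ^ 3 - m) / 12 * (6 / 5) else 0) *\<^sub>V u)
     \<and> (commutator (L_op m) (J_op n) u = of_int (2 * m - n) *\<^sub>V J_op (m + n) u)
     \<and> finite {k. k \<le> -2 \<and> L_op k (L_op (m + n - k) u) \<noteq> 0}
     \<and> finite {k. k \<ge> -1 \<and> L_op (m + n - k) (L_op k u) \<noteq> 0}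
     \<and> (commutator (J_op m) (J_op n) u =
       of_int ((m - n) * (22 * (m + n + 2) * (m + n + 3) + 35 * (m + 2) * (n + 2)))
         *\<^sub>V L_op (m + n) u
       - of_int (120 * (m - n)) *\<^sub>V
           (Sum_any (\<lambda>k. if k \<le> -2 then L_op k (L_op (m + n - k) u) else 0)
            + Sum_any (\<lambda>k. if k \<ge> -1 then L_op (m + n - k) (L_op k u) else 0))
       - (if m + n = 0 then 7 / 10 * of_int (m * (m\<^sup>2 - 1) * (m\<^sup>2 - 4)) else 0) *\<^sub>V u)"
  using commutator_L_L commutator_L_J L_L_normal commutator_J_J by metis

end
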